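(* Let $a\ge b\ge-1/2$ be real numbers and let $(z,z')\in\mathbb C^2$ satisfy $$(z-k)(z'-k)>0\ \ \forall k\in\mathbb Z,\qquad (z+k+2\epsilon)(z'+k+2\epsilon)>0\ \ \forall k\in\mathbb N,\qquad z+z'>-(1+b).$$ For each $N\ge1$ let $(P_N(t))_{t\ge0}$ be the Feller semigroup on $\mathbb{GT}^+_N$ whose $q$-matrix is $R^{(N)}_{u,u'}$ with $(u,u')=(z+N-1,z'+N-1)$. Then $$P_{N+1}(t)\Lambda^{N+1}_N=\Lambda^{N+1}_NP_N(t)\qquad\text{for all } N\ge2,\ t\ge0.$$
   Context: Notation. $\mathbb Z_+=\{0,1,2,\dots\}$, $\mathbb N=\{1,2,\dots\}$, $\epsilon=\frac{a+b+1}{2}\ge0$, $\widehat x=(x+\epsilon)^2$ for $x\in\mathbb Z_+$. $\mathbb{GT}^+_N$ is the set of $\lambda=(\lambda_1\ge\dots\ge\lambda_N)$ with $\lambda_i\in\mathbb Z_+$. To $\lambda$ (resp. $\nu$) in $\mathbb{GT}^+_N$ associate $l_i=\lambda_i+N-i$ (resp. $n_i=\nu_i+N-i$) and $\widehat l_i=(l_i+\epsilon)^2$ (resp. $\widehat n_i$). Transition rates. $\mathcal H^\circ$ is the set of $(u,u')\in\mathbb C^2$ with $(u-k)(u'-k)>0$ for all $k\in\mathbb Z_+$, $(u+k+2\epsilon)(u'+k+2\epsilon)>0$ for all $k\in\mathbb N$, and $u+u'+b>-1$. (If $(z,z')$ satisfies the displayed conditions of the claim then $(z+m,z'+m)\in\mathcal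 H^\circ$ for all $m\in\mathbb Z_+$.) For $(u,u')\in\mathcal H^\circ$ put $$\beta(x)=\frac{(x+2\epsilon)(x+a+1)(x-u)(x-u')}{2(x+\epsilon)(2x+2\epsilon+1)}\ (x\in\mathbb Z_+),\qquad \delta(x)=\frac{x(x+b)(x+u+2\epsilon)(x+u'+2\epsilon)}{2(x+\epsilon)(2x+2\epsilon-1)}\ (x\in\mathbb N),\quad\delta(0)=0,$$ where for $x=0$ and $\epsilon=0$ the factor $\frac{x+2\epsilon}{2(x+\epsilon)}$ is read as $1$, i.e. $\beta(0)=\frac{(a+1)uu'}{2\epsilon+1}$. Let $R=[R(x,y)]_{x,y\in\mathbb Z_+}$ be the tridiagonal matrix with $R(x,x+1)=\beta(x)$, $R(x,x-1)=\delta(x)$, $R(x,x)=-\beta(x)-\delta(x)$, all other entries $0$. For $N\ge1$, $\lambda,\nu\in\mathbb{GT}^+_N$, $$R^{(N)}_{u,u'}(\lambda,\nu)=\frac{\prod_{i<j}(\widehat n_i-\widehat n_j)}{\prod_{i<j}(\widehat l_i-\widehat l_j)}\sum_{k=1}^N R(l_k,n_k)\mathbf 1_{\{l_i=n_i\ \forall i\ne k\}}-c_N\mathbf 1_{\{\lambda=\nu\}},\quad c_N=\frac{N(N-1)(N-2)}3-\frac{N(N-1)}2(u+u'+b).$$ There is a unique (standard) Markov semigroup on the countable set $\mathbb{GT}^+_N$ with $q$-matrix $R^{(N)}_{u,u'}$ (the $q$-matrix of a semigroup $P(t)$ is the entrywise limit $\lim_{h\downarrow0}(P(h)-I)/h$),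 and it is a Feller semigroup. Kernels. Let $\mathfrak P_k(x|a,b)$ be the Jacobi polynomials: $\deg\mathfrak P_k=k$, orthogonal on $[-1,1]$ with weight $(1-x)^a(1+x)^b$. For $\lambda\in\mathbb{GT}^+_N$ put $\mathfrak P_\lambda(x_1,\dots,x_N|a,b)=\det_{1\le i,j\le N}[\mathfrak P_{\lambda_i+N-i}(x_j|a,b)]/\prod_{i<j}(x_i-x_j)$ and $\Phi_\lambda=\mathfrak P_\lambda/\mathfrak P_\lambda(1,\dots,1|a,b)$ (the denominator is nonzero); $\{\Phi_\mu\}_{\mu\in\mathbb{GT}^+_N}$ is a basis of the symmetric polynomials in $N$ variables. The stochastic matrix $\Lambda^{N+1}_N=[\Lambda^{N+1}_N(\lambda,\mu)]_{\lambda\in\mathbb{GT}^+_{N+1},\mu\in\mathbb{GT}^+_N}$ is defined by $$\Phi_\lambda(x_1,\dots,x_N,1|a,b)=\sum_{\mu\in\mathbb{GT}^+_N}\Lambda^{N+1}_N(\lambda,\mu)\Phi_\mu(x_1,\dots,x_N|a,b).$$ The products in the claim are products of (infinite) stochastic matrices of format $\mathbb{GT}^+_{N+1}\times\mathbb{GT}^+_N$. *)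

theory Defs
  imports
    "HOL-Analysis.Analysis"
    "HOL-Library.Complex_Order"
    "Jordan_Normal_Form.Determinant"
begin

text \<open>
  Signatures are lists of natural numbers and all indices are shifted to start at 0: the
  entry \<open>lam ! i\<close> is \<open>\<lambda>\<^sub>i\<^sub>+\<^sub>1\<close>, hence \<open>l\<^sub>i\<^sub>+\<^sub>1 = lam ! i + (N - 1 - i)\<close>.  A point
  \<open>(x\<^sub>1, \<dots>, x\<^sub>N)\<close> is a function \<open>x :: nat \<Rightarrow> real\<close> of which only \<open>x 0, \<dots>, x (N - 1)\<close> matter.

  On complex numbers, \<open>w > 0\<close> is the order of Complex_Order: it means that \<open>w\<close> is real and
  positive.
\<close>

definition GT_plus :: "nat \<Rightarrow> nat list set" where
  "GT_plus N = {lam. length lam = N \<and> sorted_wrt (\<ge>) lam}"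

definition shifted :: "nat \<Rightarrow> nat list \<Rightarrow> nat \<Rightarrow> nat" where
  "shifted N lam i = lam ! i + (N - 1 - i)"

definition vandermonde :: "nat \<Rightarrow> (nat \<Rightarrow> real) \<Rightarrow> real" where
  "vandermonde N x = (\<Prod>i<N. \<Prod>j\<in>{i<..<N}. (x i - x j))"


section \<open>Semigroups on a countable set\<close>

text \<open>
  Matrices with index sets \<open>E\<close>, \<open>F\<close> are two-argument functions; only entries with indices in
  \<open>E\<close> and \<open>F\<close> are relevant.
\<close>

definition matrix_prod ::
    "'b set \<Rightarrow> ('a \<Rightarrow> 'b \<Rightarrow> real) \<Rightarrow> ('b \<Rightarrow> 'c \<Rightarrow> real) \<Rightarrow> 'a \<Rightarrow> 'c \<Rightarrow> real" where
  "matrix_prod F A B x y = (\<Sum>\<^sub>\<infinity>w\<in>F. A x w * B w y)"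

definition stochastic_matrix :: "'a set \<Rightarrow> 'b set \<Rightarrow> ('a \<Rightarrow> 'b \<Rightarrow> real) \<Rightarrow> bool" where
  "stochastic_matrix E F A \<longleftrightarrow>
     (\<forall>x\<in>E. (\<forall>y\<in>F. A x y \<ge> 0) \<and> (A x has_sum 1) F)"

definition markov_semigroup :: "'a set \<Rightarrow> (real \<Rightarrow> 'a \<Rightarrow> 'a \<Rightarrow> real) \<Rightarrow> bool" where
  "markov_semigroup E P \<longleftrightarrow>
     (\<forall>t\<ge>0. stochastic_matrix E E (P t)) \<and>
     (\<forall>x\<in>E. \<forall>y\<in>E. P 0 x y = of_bool (x = y)) \<and>
     (\<forall>s\<ge>0. \<forall>t\<ge>0. \<forall>x\<in>E. \<forall>y\<in>E. P (s + t) x y = matrix_prod E (P s) (P t) x y) \<and>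
     (\<forall>x\<in>E. \<forall>y\<in>E. ((\<lambda>t. P t x y) \<longlongrightarrow> of_bool (x = y)) (at_right 0))"

text \<open>The space \<open>C\<^sub>0(E)\<close> for the discrete topology on \<open>E\<close>.\<close>

definition C0 :: "'a set \<Rightarrow> ('a \<Rightarrow> real) set" where
  "C0 E = {f. \<forall>e>0. finite {x\<in>E. \<bar>f x\<bar> \<ge> e}}"

definition semigroup_apply ::
    "'a set \<Rightarrow> (real \<Rightarrow> 'a \<Rightarrow> 'a \<Rightarrow> real) \<Rightarrow> real \<Rightarrow> ('a \<Rightarrow> real) \<Rightarrow> 'a \<Rightarrow> real" where
  "semigroup_apply E P t f x = (\<Sum>\<^sub>\<infinity>y\<in>E. P t x y * f y)"

definition feller_semigroup :: "'a set \<Rightarrow> (real \<Rightarrow> 'a \<Rightarrow> 'a \<Rightarrow> real) \<Rightarrow> bool" where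
  "feller_semigroup E P \<longleftrightarrow>
     markov_semigroup E P \<and>
     (\<forall>t\<ge>0. \<forall>f\<in>C0 E. semigroup_apply E P t f \<in> C0 E) \<and>
     (\<forall>f\<in>C0 E. uniform_limit E (\<lambda>t. semigroup_apply E P t f) f (at_right 0))"

text \<open>
  The \<open>q\<close>-matrix is allowed to be complex because the rates below are written in terms of the
  complex parameters \<open>u, u'\<close>; a real semigroup forces it to be real.
\<close>

definition has_q_matrix ::
    "'a set \<Rightarrow> (real \<Rightarrow> 'a \<Rightarrow> 'a \<Rightarrow> real) \<Rightarrow> ('a \<Rightarrow> 'a \<Rightarrow> complex) \<Rightarrow> bool" where
  "has_q_matrix E P Q \<longleftrightarrow>
     (\<forall>x\<in>E. \<forall>y\<in>E.
        ((\<lambda>h. complex_of_real ((P h x y - of_bool (x = y)) / h)) \<longlongrightarrow> Q x y) (at_right 0))"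


section \<open>Transition rates\<close>

definition eps :: "real \<Rightarrow> real \<Rightarrow> real" where
  "eps a b = (a + b + 1) / 2"

text \<open>
  For \<open>x = 0\<close> and \<open>eps a b = 0\<close> the factor \<open>(x + 2\<epsilon>) / (2 (x + \<epsilon>))\<close> is read as 1.
\<close>

definition birth_rate :: "real \<Rightarrow> real \<Rightarrow> complex \<Rightarrow> complex \<Rightarrow> nat \<Rightarrow> complex" where
  "birth_rate a b u u' n =
     (let x = of_nat n :: complex; e = complex_of_real (eps a b) in
      if n = 0 \<and> eps a b = 0 then (complex_of_real a + 1) * u * u' / (2 * e + 1)
      else (x + 2 * e) * (x + complex_of_real a + 1) * (x - u) * (x - u')
           / (2 * (x + e) * (2 * x + 2 * e + 1)))"

definition death_rate :: "real \<Rightarrow> real \<Rightarrow> complex \<Rightarrow> complex \<Rightarrow> nat \<Rightarrow> complex" where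
  "death_rate a b u u' n =
     (let x = of_nat n :: complex; e = complex_of_real (eps a b) in
      if n = 0 then 0
      else x * (x + complex_of_real b) * (x + u + 2 * e) * (x + u' + 2 * e)
           / (2 * (x + e) * (2 * x + 2 * e - 1)))"

definition R_one :: "real \<Rightarrow> real \<Rightarrow> complex \<Rightarrow> complex \<Rightarrow> nat \<Rightarrow> nat \<Rightarrow> complex" where
  "R_one a b u u' x y =
     (if y = x + 1 then birth_rate a b u u' x
      else if x = y + 1 then death_rate a b u u' x
      else if x = y then - birth_rate a b u u' x - death_rate a b u u' x
      else 0)"

definition hat :: "real \<Rightarrow> real \<Rightarrow> nat \<Rightarrow> real" where
  "hat a b x = (real x + eps a b)\<^sup>2"

definition c_const :: "real \<Rightarrow> nat \<Rightarrow> complex \<Rightarrow> complex \<Rightarrow> complex" where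
  "c_const b N u u' =
     of_nat N * (of_nat N - 1) * (of_nat N - 2) / 3
     - of_nat N * (of_nat N - 1) / 2 * (u + u' + complex_of_real b)"

definition R_mat ::
    "real \<Rightarrow> real \<Rightarrow> nat \<Rightarrow> complex \<Rightarrow> complex \<Rightarrow> nat list \<Rightarrow> nat list \<Rightarrow> complex" where
  "R_mat a b N u u' lam nu =
     (let l = shifted N lam; n = shifted N nu in
      complex_of_real (vandermonde N (\<lambda>i. hat a b (n i)) / vandermonde N (\<lambda>i. hat a b (l i)))
      * (\<Sum>k<N. R_one a b u u' (l k) (n k) * of_bool (\<forall>i<N. i \<noteq> k \<longrightarrow> l i = n i))
      - c_const b N u u' * of_bool (lam = nu))"


section \<open>Jacobi polynomials and the kernels\<close>

text \<open>
  Each Jacobi polynomial is determined up to a nonzero factor, which cancels in the normalized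
  polynomials \<open>Jacobi_norm\<close> below.
\<close>

definition jacobi_polynomials :: "real \<Rightarrow> real \<Rightarrow> (nat \<Rightarrow> real poly) \<Rightarrow> bool" where
  "jacobi_polynomials a b p \<longleftrightarrow>
     (\<forall>k. p k \<noteq> 0 \<and> degree (p k) = k) \<and>
     (\<forall>j k. j \<noteq> k \<longrightarrow>
        (LINT x:{-1..1}|lborel.
           poly (p j) x * poly (p k) x * ((1 - x) powr a * (1 + x) powr b)) = 0)"

text \<open>Real polynomial functions in the variables \<open>x 0, \<dots>, x (N - 1)\<close>.\<close>

inductive_set polyfun :: "nat \<Rightarrow> ((nat \<Rightarrow> real) \<Rightarrow> real) set" for N :: nat where
  polyfun_const: "(\<lambda>x. c) \<in> polyfun N"
| polyfun_var: "i < N \<Longrightarrow> (\<lambda>x. x i) \<in> polyfun N"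
| polyfun_add: "f \<in> polyfun N \<Longrightarrow> g \<in> polyfun N \<Longrightarrow> (\<lambda>x. f x + g x) \<in> polyfun N"
| polyfun_mult: "f \<in> polyfun N \<Longrightarrow> g \<in> polyfun N \<Longrightarrow> (\<lambda>x. f x * g x) \<in> polyfun N"

text \<open>
  The quotient of the determinant by the Vandermonde product is taken among polynomials, so that
  it also makes sense at points with coinciding coordinates, in particular at \<open>(1, \<dots>, 1)\<close>.
\<close>

definition Jacobi_multi ::
    "(nat \<Rightarrow> real poly) \<Rightarrow> nat \<Rightarrow> nat list \<Rightarrow> (nat \<Rightarrow> real) \<Rightarrow> real" where
  "Jacobi_multi p N lam =
     (THE F. F \<in> polyfun N \<and>
        (\<forall>x. F x * vandermonde N x =
           Determinant.det (Matrix.mat N N (\<lambda>(i, j). poly (p (shifted N lam i)) (x j)))))"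

definition Jacobi_norm ::
    "(nat \<Rightarrow> real poly) \<Rightarrow> nat \<Rightarrow> nat list \<Rightarrow> (nat \<Rightarrow> real) \<Rightarrow> real" where
  "Jacobi_norm p N lam x = Jacobi_multi p N lam x / Jacobi_multi p N lam (\<lambda>i. 1)"

text \<open>
  The matrix of format \<open>GT_plus (N + 1) \<times> GT_plus N\<close>: its row \<open>lam\<close> is the finitely supported family of
  coefficients in the expansion of \<open>Jacobi_norm p (N + 1) lam\<close> at \<open>(x 0, \<dots>, x (N - 1), 1)\<close>.
\<close>

definition Lambda_kernel :: "(nat \<Rightarrow> real poly) \<Rightarrow> nat \<Rightarrow> nat list \<Rightarrow> nat list \<Rightarrow> real" where
  "Lambda_kernel p N lam =
     (THE c. finite {mu. c mu \<noteq> 0} \<and> {mu. c mu \<noteq> 0} \<subseteq> GT_plus N \<and>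
        (\<forall>x. Jacobi_norm p (N + 1) lam (x(N := 1)) =
           (\<Sum>mu | c mu \<noteq> 0. c mu * Jacobi_norm p N mu x)))"

end

theory Submission
  imports Defs
begin

text \<open>
  The rates of the one-particle chain are \<open>R = (X + c) T - \<kappa> ([T, X] - (a + 1))\<close>, where \<open>T\<close> is a birth
  and death generator, dual to multiplication by \<open>(t - 1) / 2\<close> on normalized Jacobi polynomials,
  and \<open>X\<close> is multiplication by \<open>x (x + 2\<epsilon>)\<close>, dual to the Jacobi differential operator.  Let \<open>G\<close> be the
  Green function of \<open>T\<close>, so that \<open>T G = 1\<close>.  Both \<open>R\<close> and \<open>G\<close> act by at most two terms on the basis
  \<open>\<phi>\<^sub>m(x) = (hat x - hat 0) \<dots> (hat x - hat (m - 1))\<close>, and there one reads off that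
  \<open>R\<^sub>u G - G R\<^sub>u\<^sub>-\<^sub>1\<close> is a multiple of \<open>G\<close> up to functions that are constant in the first argument.

  Expanding a determinant of Jacobi polynomials whose last column is evaluated at 1, the kernel
  becomes, up to Vandermonde factors, the determinant of order \<open>N + 1\<close> with entries \<open>G(l\<^sub>i, m\<^sub>j)\<close> and a
  last column of ones.  The constants disappear against that column, so the one-particle relation
  gives the commutation of the generators with the kernel.  Monotonicity of the scale function of \<open>T\<close>
  shows that the kernel is nonnegative and its columns vanish at infinity.

  Hence both sides of the claim, as functions of \<open>t\<close>, are curves in \<open>C\<^sub>0\<close> that solve the same backward
  equation with the same initial value, and they agree by the maximum principle.
\<close>

section \<open>Determinants of doubly indexed families\<close>

text \<open>The constant \<open>c_const\<close> comes from the one-particle relation: each of the N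
  Green columns contributes \<open>- (s + b)\<close>, where s = u + u', and c_N solves N (s + b) +
  c_{N+1}(s) = c_N(s - 2). The argument s - 2 reflects that u and u' both drop by 1 from level N + 1
  to level N. Conservativity of the generators is not given; it follows by induction on N, because
  the kernel K is stochastic and hence G_{N+1} 1 = G_{N+1} K 1 = K G_N 1 = 0. The analytic obstacle
  is that the rates are unbounded, so indicator functions and columns of the kernel are not known to
  lie in the domain of the generator. The backward equation is therefore taken pointwise: for a
  conservative matrix with finite rows, (P(h) - I) / h converges in l^1 along each row, which gives
  the left difference quotient at each state. The maximum principle is arranged to work with such
  quotients. On an infinite state space it also needs both curves to stay in \<open>C0\<close>; this
  is where the decay of the kernel columns is used.\<close>

lemma prod_sum_PiE_lessThan:
  fixes A :: "nat \<Rightarrow> 'r \<Rightarrow> real"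
  assumes "\<And>i. finite (S i)"
  shows "(\<Prod>i<n. \<Sum>r\<in>S i. A i r) = (\<Sum>f\<in>PiE {..<n} S. \<Prod>i<n. A i (f i))"
proof (induction n)
  case (Suc n)
  have inj: "inj_on (\<lambda>(y, g). g(n := y)) (S n \<times> PiE {..<n} S)"
  proof (rule inj_onI, clarify)
    fix y g y' g'
    assume g: "g \<in> PiE {..<n} S" "g' \<in> PiE {..<n} S" and eq: "g(n := y) = g'(n := y')"
    have "g i = g' i" for i
      using g fun_cong[OF eq, of i] by (cases "i = n") (auto simp: PiE_def extensional_def)
    then show "y = y' \<and> g = g'" using fun_cong[OF eq, of n] by auto
  qed
  have "PiE {..<Suc n} S = (\<lambda>(y, g). g(n := y)) ` (S n \<times> PiE {..<n} S)"
    by (simp add: lessThan_Suc PiE_insert_eq)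
  then have "(\<Sum>f\<in>PiE {..<Suc n} S. \<Prod>i<Suc n. A i (f i))
      = (\<Sum>(y, g)\<in>S n \<times> PiE {..<n} S. (\<Prod>i<n. A i (g i)) * A n y)"
    by (simp only: sum.reindex[OF inj]) (simp add: case_prod_beta)
  also have "\<dots> = (\<Sum>r\<in>S n. A n r) * (\<Sum>f\<in>PiE {..<n} S. \<Prod>i<n. A i (f i))"
    by (simp add: sum_product sum.cartesian_product mult.commute)
  finally show ?case using Suc by (simp add: mult.commute)
qed simp

text \<open>Determinants of index functions: entries outside the n by n block do not matter
  (\<open>ndet_cong\<close>), so rows and columns can be rewritten under binders without dimension
  side conditions.\<close>

definition ndet :: "nat \<Rightarrow> (nat \<Rightarrow> nat \<Rightarrow> real) \<Rightarrow> real" where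
  "ndet n A = Determinant.det (Matrix.mat n n (\<lambda>(i, j). A i j))"

lemma ndet_leibniz:
  "ndet n A = (\<Sum>p | p permutes {..<n}. of_int (sign p) * (\<Prod>i<n. A i (p i)))"
proof -
  let ?M = "Matrix.mat n n (\<lambda>(i, j). A i j)"
  have "ndet n A = (\<Sum>p | p permutes {0..<n}. of_int (sign p) * (\<Prod>i=0..<n. ?M $$ (i, p i)))"
    unfolding ndet_def by (rule det_def') simp
  also have "\<dots> = (\<Sum>p | p permutes {0..<n}. of_int (sign p) * (\<Prod>i=0..<n. A i (p i)))"
  proof (intro sum.cong prod.cong refl arg_cong2[where f = "(*)"])
    fix p i assume "p \<in> {p. p permutes {0..<n}}" "i \<in> {0..<n}"
    then have "p i < n" using permutes_in_image[of p "{0..<n}" i] by simp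
    then show "?M $$ (i, p i) = A i (p i)" using \<open>i \<in> {0..<n}\<close> by simp
  qed
  finally show ?thesis by (simp add: lessThan_atLeast0)
qed

lemma ndet_cong: "(\<And>i j. i < n \<Longrightarrow> j < n \<Longrightarrow> A i j = B i j) \<Longrightarrow> ndet n A = ndet n B"
  unfolding ndet_def by (intro arg_cong[where f = Determinant.det] eq_matI) auto

lemma ndet_transpose: "ndet n (\<lambda>i j. A j i) = ndet n A"
proof -
  have "Matrix.mat n n (\<lambda>(i, j). A j i) = transpose_mat (Matrix.mat n n (\<lambda>(i, j). A i j))"
    by (intro eq_matI) auto
  then show ?thesis
    unfolding ndet_def by (simp add: Determinant.det_transpose[of _ n])
qed

lemma ndet_leibniz':
  "ndet n A = (\<Sum>p | p permutes {..<n}. of_int (sign p) * (\<Prod>j<n. A (p j) j))"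
  by (subst ndet_transpose[symmetric]) (rule ndet_leibniz)

lemma ndet_equal_rows:
  assumes "i < n" "k < n" "i \<noteq> k" "\<And>j. j < n \<Longrightarrow> A i j = A k j"
  shows "ndet n A = 0"
  unfolding ndet_def using assms
  by (intro det_identical_rows[of _ n i k] eq_vecI) auto

lemma ndet_equal_cols:
  assumes "i < n" "k < n" "i \<noteq> k" "\<And>j. j < n \<Longrightarrow> A j i = A j k"
  shows "ndet n A = 0"
  by (subst ndet_transpose[symmetric]) (rule ndet_equal_rows[OF assms])

lemma ndet_zero_col:
  assumes "k < n" "\<And>j. j < n \<Longrightarrow> A j k = 0"
  shows "ndet n A = 0"
  unfolding ndet_leibniz'
proof (intro sum.neutral ballI)
  fix p assume "p \<in> {p. p permutes {..<n}}"
  then have "p k < n" using permutes_in_image[of p "{..<n}" k] assms by simp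
  then have "(\<Prod>j<n. A (p j) j) = 0" using assms by (intro prod_zero) auto
  then show "of_int (sign p) * (\<Prod>j<n. A (p j) j) = 0" by simp
qed

lemma ndet_zero_row:
  assumes "k < n" "\<And>j. j < n \<Longrightarrow> A k j = 0"
  shows "ndet n A = 0"
  by (subst ndet_transpose[symmetric]) (rule ndet_zero_col[of k], use assms in auto)

lemma ndet_scale_cols: "ndet n (\<lambda>i j. c j * A i j) = (\<Prod>j<n. c j) * ndet n A"
  unfolding ndet_leibniz' sum_distrib_left by (intro sum.cong) (auto simp: prod.distrib)

lemma ndet_scale_rows: "ndet n (\<lambda>i j. c i * A i j) = (\<Prod>i<n. c i) * ndet n A"
  unfolding ndet_leibniz sum_distrib_left by (intro sum.cong) (auto simp: prod.distrib)

lemma ndet_sum_cols: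
  assumes "\<And>j. finite (S j)"
  shows "ndet n (\<lambda>i j. \<Sum>r\<in>S j. A i j r) = (\<Sum>f\<in>PiE {..<n} S. ndet n (\<lambda>i j. A i j (f j)))"
proof -
  have "ndet n (\<lambda>i j. \<Sum>r\<in>S j. A i j r)
     = (\<Sum>p | p permutes {..<n}. of_int (sign p) * (\<Sum>f\<in>PiE {..<n} S. \<Prod>j<n. A (p j) j (f j)))"
    unfolding ndet_leibniz'
    by (intro sum.cong refl arg_cong2[where f = "(*)"]
        prod_sum_PiE_lessThan[OF assms, where A = "\<lambda>j. A (_ j) j"])
  also have "\<dots> = (\<Sum>f\<in>PiE {..<n} S. ndet n (\<lambda>i j. A i j (f j)))"
    unfolding ndet_leibniz' sum_distrib_left by (rule sum.swap)
  finally show ?thesis .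
qed

lemma ndet_sum_rows:
  assumes "\<And>i. finite (S i)"
  shows "ndet n (\<lambda>i j. \<Sum>r\<in>S i. A i j r) = (\<Sum>f\<in>PiE {..<n} S. ndet n (\<lambda>i j. A i j (f i)))"
  by (subst ndet_transpose[symmetric], subst (2) ndet_transpose[symmetric])
     (rule ndet_sum_cols[OF assms])

text \<open>Expand multilinearly, choosing in each column either the original (0) or the added
  multiple (1). Every choice other than all 0 contains a column proportional to the last
  one.\<close>

lemma ndet_add_last_col:
  "ndet (Suc n) (\<lambda>i j. if j < n then A i j + v j * A i n else A i n) = ndet (Suc n) A"
proof -
  define B where "B = (\<lambda>i j (r::nat). if r = 0 then A i j else v j * A i n)"
  define S where "S = (\<lambda>j. if j < n then {0, 1 :: nat} else {0})"
  have "ndet (Suc n) (\<lambda>i j. if j < n then A i j + v j * A i n else A i n)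
      = ndet (Suc n) (\<lambda>i j. \<Sum>r\<in>S j. B i j r)"
    by (intro ndet_cong) (auto simp: S_def B_def less_Suc_eq)
  also have "\<dots> = (\<Sum>f\<in>PiE {..<Suc n} S. ndet (Suc n) (\<lambda>i j. B i j (f j)))"
    by (rule ndet_sum_cols) (simp add: S_def)
  also have "\<dots> = (\<Sum>f\<in>{restrict (\<lambda>_. 0) {..<Suc n}}. ndet (Suc n) (\<lambda>i j. B i j (f j)))"
  proof (rule sum.mono_neutral_right)
    show "\<forall>f\<in>PiE {..<Suc n} S - {restrict (\<lambda>_. 0) {..<Suc n}}. ndet (Suc n) (\<lambda>i j. B i j (f j)) = 0"
    proof
      fix f assume f: "f \<in> PiE {..<Suc n} S - {restrict (\<lambda>_. 0) {..<Suc n}}"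
      then obtain k where k: "k < Suc n" "f k \<noteq> 0"
        by (auto simp: PiE_def extensional_def fun_eq_iff restrict_def split: if_splits)
      have kn: "k < n" "f n = 0" using f k by (auto simp: S_def PiE_def Pi_def less_Suc_eq)
      define w where "w = (\<lambda>j. if j = k then v k else 1)"
      have "ndet (Suc n) (\<lambda>i j. B i j (f j)) = ndet (Suc n) (\<lambda>i j. w j * (if j = k then A i n else B i j (f j)))"
        using k by (intro ndet_cong) (auto simp: w_def B_def)
      also have "\<dots> = 0" unfolding ndet_scale_cols
        using ndet_equal_cols[of k "Suc n" n "\<lambda>i j. if j = k then A i n else B i j (f j)"] kn
        by (simp add: B_def)
      finally show "ndet (Suc n) (\<lambda>i j. B i j (f j)) = 0" .
    qed
  qed (auto simp: S_def intro!: finite_PiE)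
  also have "\<dots> = ndet (Suc n) A"
    by (simp add: B_def cong: ndet_cong)
  finally show ?thesis .
qed

lemma ndet_laplace_last_col:
  "ndet (Suc n) A = (\<Sum>k<Suc n. A k n * ((- 1) ^ (k + n) *
      ndet n (\<lambda>i j. A (if i < k then i else Suc i) j)))"
proof -
  let ?M = "Matrix.mat (Suc n) (Suc n) (\<lambda>(i, j). A i j)"
  have "mat_delete ?M k n = Matrix.mat n n (\<lambda>(i, j). A (if i < k then i else Suc i) j)" if "k < Suc n" for k
    using that by (intro eq_matI) (auto simp: mat_delete_def)
  then show ?thesis
    unfolding ndet_def
    by (subst laplace_expansion_column[of _ "Suc n" n]) (auto simp: cofactor_def intro!: sum.cong)
qed

lemma ndet_corner_col:
  assumes "\<And>i. i < n \<Longrightarrow> A i n = 0" "A n n = 1"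
  shows "ndet (Suc n) A = ndet n A"
proof -
  have "ndet (Suc n) A = (- 1) ^ (n + n) * ndet n (\<lambda>i j. A (if i < n then i else Suc i) j)"
    by (subst ndet_laplace_last_col) (simp add: assms)
  then show ?thesis by (simp cong: ndet_cong)
qed

lemma ndet_corner_row:
  assumes "\<And>i. i < n \<Longrightarrow> A n i = 0" "A n n = 1"
  shows "ndet (Suc n) A = ndet n A"
  using ndet_corner_col[of n "\<lambda>i j. A j i"] assms by (simp add: ndet_transpose[of _ A])

lemma ndet_first_col:
  assumes "\<And>i. i < n \<Longrightarrow> A (Suc i) 0 = 0" "A 0 0 = 1"
  shows "ndet (Suc n) A = ndet n (\<lambda>i j. A (Suc i) (Suc j))"
proof -
  let ?M = "Matrix.mat (Suc n) (Suc n) (\<lambda>(i, j). A i j)"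
  have "mat_delete ?M 0 0 = Matrix.mat n n (\<lambda>(i, j). A (Suc i) (Suc j))"
    by (intro eq_matI) (auto simp: mat_delete_def)
  then show ?thesis
    unfolding ndet_def
    by (subst laplace_expansion_column[of _ "Suc n" 0])
       (auto simp: cofactor_def sum.lessThan_Suc_shift assms simp del: sum.lessThan_Suc)
qed

text \<open>Subtracting \<open>A n j\<close> times the column of ones from column j turns the last
  row into (0, ..., 0, 1).\<close>

lemma ndet_border:
  "ndet (Suc n) (\<lambda>i j. if j < n then A i j else 1) = ndet n (\<lambda>i j. A i j - A n j)"
proof -
  have "ndet (Suc n) (\<lambda>i j. if j < n then A i j else 1)
     = ndet (Suc n) (\<lambda>i j. if j < n then A i j - A n j else 1)"
    using ndet_add_last_col[of n "\<lambda>i j. if j < n then A i j else 1" "\<lambda>j. - A n j"]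
    by (auto cong: if_cong)
  also have "\<dots> = ndet n (\<lambda>i j. A i j - A n j)"
    by (subst ndet_corner_row) (auto intro!: ndet_cong)
  finally show ?thesis .
qed

lemma ndet_mult: "ndet n (\<lambda>i j. \<Sum>k<n. A i k * B k j) = ndet n A * ndet n B"
proof -
  have "Matrix.mat n n (\<lambda>(i, j). \<Sum>k<n. A i k * B k j)
      = Matrix.mat n n (\<lambda>(i, j). A i j) * Matrix.mat n n (\<lambda>(i, j). B i j)"
    by (intro eq_matI) (auto simp: scalar_prod_def lessThan_atLeast0)
  then show ?thesis unfolding ndet_def by (simp add: det_mult[of _ n])
qed

text \<open>This form serves positivity and decay of the kernel: consecutive rows of Green functions
  differ by a sum over a single interval (\<open>green_diff\<close>).\<close>

lemma ndet_border_consecutive: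
  "ndet (Suc n) (\<lambda>i j. if j < n then A i j else 1) = ndet n (\<lambda>i j. A i j - A (Suc i) j)"
proof -
  let ?A = "\<lambda>i j. if j < n then A i j else (1::real)"
  \<comment> \<open>Left multiplication by this unit upper bidiagonal matrix replaces every row but
    the last by its difference with the next row; the ones in the last column then cancel except in
    the corner.\<close>
  define L :: "nat \<Rightarrow> nat \<Rightarrow> real" where "L = (\<lambda>i k. if k = i then 1 else if k = Suc i then - 1 else 0)"
  have "ndet (Suc n) L = 1"
  proof -
    have "ndet (Suc n) L = prod_list (diag_mat (Matrix.mat (Suc n) (Suc n) (\<lambda>(i, j). L i j)))"
      unfolding ndet_def by (rule det_upper_triangular) (auto simp: upper_triangular_def L_def)
    also have "diag_mat (Matrix.mat (Suc n) (Suc n) (\<lambda>(i, j). L i j)) = map (\<lambda>_. 1) [0..<Suc n]"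
      unfolding diag_mat_def by (intro map_cong) (auto simp: L_def)
    finally show ?thesis by (simp add: map_replicate_const)
  qed
  then have "ndet (Suc n) ?A = ndet (Suc n) (\<lambda>i j. \<Sum>k<Suc n. L i k * ?A k j)"
    by (simp only: ndet_mult)
  also have "\<dots> = ndet (Suc n) (\<lambda>i j. if i < n then ?A i j - ?A (Suc i) j else ?A n j)"
  proof (intro ndet_cong)
    fix i j assume "i < Suc n" "j < Suc n"
    have "(\<Sum>k<Suc n. L i k * ?A k j)
       = (\<Sum>k<Suc n. (if k = i then ?A k j else 0) - (if k = Suc i then ?A k j else 0))"
      by (intro sum.cong) (auto simp: L_def)
    also have "\<dots> = (if i < n then ?A i j - ?A (Suc i) j else ?A n j)"
      using \<open>i < Suc n\<close> by (simp only: sum_subtractf sum.delta finite_lessThan) (auto simp: less_Suc_eq)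
    finally show "(\<Sum>k<Suc n. L i k * ?A k j) = (if i < n then ?A i j - ?A (Suc i) j else ?A n j)" .
  qed
  also have "\<dots> = ndet n (\<lambda>i j. A i j - A (Suc i) j)"
    by (subst ndet_corner_col) (auto intro!: ndet_cong)
  finally show ?thesis .
qed

text \<open>Both sides are the derivative of det (A + t B) at t = 0: in each Leibniz term one factor
  is replaced, and the factors may be counted by rows or by columns.\<close>

lemma sum_ndet_replace_row_eq_col:
  "(\<Sum>k<n. ndet n (\<lambda>i j. if i = k then B i j else A i j))
    = (\<Sum>k<n. ndet n (\<lambda>i j. if j = k then B i j else A i j))"
proof -
  have *: "(\<Sum>k<n. \<Prod>i<n. if i = k then B i (p i) else A i (p i))
     = (\<Sum>k<n. \<Prod>i<n. if p i = k then B i (p i) else A i (p i))" if p: "p permutes {..<n}" for p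
  proof -
    have eq: "p i = p k \<longleftrightarrow> i = k" for i k
      using permutes_inj[OF p] by (auto dest: injD)
    have "(\<Sum>k<n. \<Prod>i<n. if p i = k then B i (p i) else A i (p i))
       = (\<Sum>k<n. \<Prod>i<n. if p i = p k then B i (p i) else A i (p i))"
      by (subst sum.permute[OF p]) (simp add: comp_def)
    then show ?thesis by (simp add: eq)
  qed
  show ?thesis
    unfolding ndet_leibniz
    by (subst (1 2) sum.swap) (rule sum.cong[OF refl], simp only: sum_distrib_left[symmetric] mem_Collect_eq *)
qed

text \<open>The order relation is a totally positive kernel: the determinant is 1 if the two
  sequences interlace and 0 otherwise.\<close>

lemma ndet_step_nonneg:
  assumes "\<And>i. Suc i < n \<Longrightarrow> k (Suc i) \<le> k i" "\<And>i. Suc i < n \<Longrightarrow> m (Suc i) \<le> m i"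
  shows "ndet n (\<lambda>i j. of_bool (m j \<le> (k i :: nat))) \<ge> 0"
  using assms
proof (induction n arbitrary: k m)
  case 0
  show ?case by (simp add: ndet_leibniz)
next
  case (Suc n)
  have k0: "k i \<le> k 0" if "i \<le> n" for i
    using that
  proof (induction i)
    case (Suc i)
    then show ?case using Suc.prems \<open>\<And>i. Suc i < Suc n \<Longrightarrow> k (Suc i) \<le> k i\<close>[of i] by simp
  qed simp
  have m0: "m i \<le> m 0" if "i \<le> n" for i
    using that
  proof (induction i)
    case (Suc i)
    then show ?case using \<open>\<And>i. Suc i < Suc n \<Longrightarrow> m (Suc i) \<le> m i\<close>[of i] by simp
  qed simp
  \<comment> \<open>Either the first column vanishes, or the first two rows consist of ones, or the
    first column is (1, 0, ..., 0) and can be expanded.\<close>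
  consider "\<not> m 0 \<le> k 0" | "0 < n" "m 0 \<le> k 1" | "m 0 \<le> k 0" "n = 0 \<or> \<not> m 0 \<le> k 1" by auto
  then show ?case
  proof cases
    case 1
    then have "ndet (Suc n) (\<lambda>i j. of_bool (m j \<le> k i)) = 0"
      using k0 by (intro ndet_zero_col[of 0]) (force simp: less_Suc_eq_le)+
    then show ?thesis by simp
  next
    case 2
    then have "m 0 \<le> k 0" using k0[of 1] by simp
    then have "ndet (Suc n) (\<lambda>i j. of_bool (m j \<le> k i)) = 0"
      using 2 by (intro ndet_equal_rows[of 0 _ 1])
        (auto simp: less_Suc_eq_le dest: m0 le_trans[of "m _" "m 0"])
    then show ?thesis by simp
  next
    case 3
    have k1: "k (Suc i) \<le> k 1" if "i < n" for i
      using that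
    proof (induction i)
      case (Suc i)
      then show ?case using \<open>\<And>i. Suc i < Suc n \<Longrightarrow> k (Suc i) \<le> k i\<close>[of "Suc i"] by simp
    qed simp
    have "\<not> m 0 \<le> k (Suc i)" if "i < n" for i
      using 3 k1[OF that] that by auto
    then have "ndet (Suc n) (\<lambda>i j. of_bool (m j \<le> k i)) = ndet n (\<lambda>i j. of_bool (m (Suc j) \<le> k (Suc i)))"
      using 3 by (intro ndet_first_col) auto
    also have "\<dots> \<ge> 0" using Suc.prems by (intro Suc.IH) auto
    finally show ?thesis by simp
  qed
qed

lemma ndet_abs_le:
  assumes "\<And>i j. i < n \<Longrightarrow> j < n \<Longrightarrow> \<bar>A i j\<bar> \<le> c i"
  shows "\<bar>ndet n A\<bar> \<le> fact n * (\<Prod>i<n. c i)"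
proof -
  have "\<bar>ndet n A\<bar> \<le> (\<Sum>p | p permutes {..<n}. \<bar>of_int (sign p) * (\<Prod>i<n. A i (p i))\<bar>)"
    unfolding ndet_leibniz by (rule sum_abs)
  also have "\<dots> \<le> (\<Sum>p | p permutes {..<n}. \<Prod>i<n. c i)"
  proof (rule sum_mono)
    fix p assume "p \<in> {p. p permutes {..<n}}"
    then have p: "p i < n" if "i < n" for i using permutes_in_image[of p "{..<n}" i] that by simp
    have "\<bar>of_int (sign p) * (\<Prod>i<n. A i (p i))\<bar> = (\<Prod>i<n. \<bar>A i (p i)\<bar>)"
      by (simp add: abs_mult abs_prod sign_def)
    also have "\<dots> \<le> (\<Prod>i<n. c i)" using assms p by (intro prod_mono) auto
    finally show "\<bar>of_int (sign p) * (\<Prod>i<n. A i (p i))\<bar> \<le> (\<Prod>i<n. c i)" .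
  qed
  also have "\<dots> = fact n * (\<Prod>i<n. c i)" by (simp add: card_permutations[of _ n])
  finally show ?thesis .
qed

section \<open>Vandermonde products, and linearity in a single row or column\<close>

lemma vandermonde_Suc:
  "vandermonde (Suc n) x = vandermonde n x * (\<Prod>i<n. x i - x n)"
proof -
  have "(\<Prod>j\<in>{i<..<Suc n}. x i - x j) = (\<Prod>j\<in>{i<..<n}. x i - x j) * (x i - x n)" if "i < n" for i
  proof -
    have "{i<..<Suc n} = insert n {i<..<n}" using that by auto
    then show ?thesis by (simp add: mult.commute)
  qed
  then have "(\<Prod>i<n. \<Prod>j\<in>{i<..<Suc n}. x i - x j) = (\<Prod>i<n. (\<Prod>j\<in>{i<..<n}. x i - x j) * (x i - x n))"
    by (intro prod.cong) auto
  moreover have "{n<..<Suc n} = {}" by auto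
  ultimately show ?thesis by (simp add: vandermonde_def prod.distrib)
qed

text \<open>Bordering subtracts the values at \<open>y n\<close>; each entry becomes divisible by
  \<open>y i - y n\<close>, and synthetic division leaves monic polynomials of degree one
  less.\<close>

lemma ndet_monic_poly:
  assumes "\<And>k. k < n \<Longrightarrow> degree (f k) = k \<and> lead_coeff (f k) = 1"
  shows "ndet n (\<lambda>i j. poly (f (n - 1 - j)) (y i)) = vandermonde n y"
  using assms
proof (induction n arbitrary: f)
  case 0
  show ?case by (simp add: ndet_leibniz vandermonde_def)
next
  case (Suc n)
  define g where "g = (\<lambda>k. synthetic_div (f (Suc k)) (y n))"
  have fg: "poly (f (Suc k)) t - poly (f (Suc k)) (y n) = (t - y n) * poly (g k) t" for k t
  proof -
    have "poly (f (Suc k)) t = poly ([:- y n, 1:] * g k + [:poly (f (Suc k)) (y n):]) t"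
      unfolding g_def by (simp only: synthetic_div_correct'[of "y n" "f (Suc k)"])
    then show ?thesis by (simp add: algebra_simps)
  qed
  have g: "degree (g k) = k \<and> lead_coeff (g k) = 1" if "k < n" for k
  proof -
    have d: "degree (f (Suc k)) = Suc k" "lead_coeff (f (Suc k)) = 1" using Suc.prems[of "Suc k"] that by auto
    then have dg: "degree (g k) = k" by (simp add: g_def degree_synthetic_div)
    have "f (Suc k) = [:- y n, 1:] * g k + [:poly (f (Suc k)) (y n):]"
      unfolding g_def by (rule synthetic_div_correct'[symmetric])
    then have "coeff (f (Suc k)) (Suc k) = coeff ([:- y n, 1:] * g k + [:poly (f (Suc k)) (y n):]) (Suc k)"
      by (rule arg_cong)
    also have "\<dots> = coeff (g k) k - y n * coeff (g k) (Suc k)"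
      by simp
    finally have "coeff (f (Suc k)) (Suc k) = coeff (g k) k - y n * coeff (g k) (Suc k)" .
    then show ?thesis using d dg by (simp add: coeff_eq_0)
  qed
  have f0: "f 0 = [:1:]"
    using Suc.prems[of 0] by (metis degree_eq_zeroE lead_coeff_pCons(2) zero_less_Suc)
  have "ndet (Suc n) (\<lambda>i j. poly (f (Suc n - 1 - j)) (y i))
      = ndet (Suc n) (\<lambda>i j. if j < n then poly (f (n - j)) (y i) else 1)"
    by (intro ndet_cong) (auto simp: f0 less_Suc_eq)
  also have "\<dots> = ndet n (\<lambda>i j. poly (f (n - j)) (y i) - poly (f (n - j)) (y n))"
    by (rule ndet_border)
  also have "\<dots> = ndet n (\<lambda>i j. (y i - y n) * poly (g (n - 1 - j)) (y i))"
    by (intro ndet_cong) (simp add: fg[symmetric] Suc_diff_Suc)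
  also have "\<dots> = (\<Prod>i<n. y i - y n) * vandermonde n y"
    unfolding ndet_scale_rows by (subst Suc.IH[OF g]) simp_all
  finally show ?case by (simp add: vandermonde_Suc)
qed

lemma ndet_row_sum:
  assumes "k < n"
  shows "(\<Sum>y\<in>Y. c y * ndet n (\<lambda>i j. if i = k then v y j else A i j))
    = ndet n (\<lambda>i j. if i = k then \<Sum>y\<in>Y. c y * v y j else A i j)"
proof -
  have expand: "ndet n (\<lambda>i j. if i = k then w j else A i j)
     = (\<Sum>p | p permutes {..<n}. of_int (sign p) * (w (p k) * (\<Prod>i\<in>{..<n} - {k}. A i (p i))))" for w
    unfolding ndet_leibniz
  proof (rule sum.cong[OF refl])
    fix p
    have "(\<Prod>i<n. if i = k then w (p i) else A i (p i)) = w (p k) * (\<Prod>i\<in>{..<n} - {k}. A i (p i))"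
      using assms by (subst prod.remove[of _ k]) auto
    then show "of_int (sign p) * (\<Prod>i<n. if i = k then w (p i) else A i (p i))
       = of_int (sign p) * (w (p k) * (\<Prod>i\<in>{..<n} - {k}. A i (p i)))" by simp
  qed
  show ?thesis
    unfolding expand sum_distrib_left sum_distrib_right
    by (subst sum.swap) (simp add: mult_ac)
qed

lemma ndet_col_sum:
  assumes "k < n"
  shows "(\<Sum>y\<in>Y. c y * ndet n (\<lambda>i j. if j = k then v y i else A i j))
    = ndet n (\<lambda>i j. if j = k then \<Sum>y\<in>Y. c y * v y i else A i j)"
  using ndet_row_sum[OF assms, of c v "\<lambda>i j. A j i" Y]
  by (subst (1 2) ndet_transpose[symmetric]) simp

lemma ndet_col_add3:
  assumes "k < n"
  shows "ndet n (\<lambda>i j. if j = k then u i + c * v i + d * w i else A i j)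
    = ndet n (\<lambda>i j. if j = k then u i else A i j) + c * ndet n (\<lambda>i j. if j = k then v i else A i j)
      + d * ndet n (\<lambda>i j. if j = k then w i else A i j)"
  using ndet_col_sum[OF assms, of "\<lambda>y. if y = 0 then 1 else if y = 1 then c else d"
      "\<lambda>y. if y = 0 then u else if y = 1 then v else w" A "{..<3::nat}"]
  by (simp add: numeral_3_eq_3 cong: if_cong)

section \<open>Signatures and alternating functions\<close>

lemma GT_plus_antimono: "mu \<in> GT_plus n \<Longrightarrow> i < k \<Longrightarrow> k < n \<Longrightarrow> mu ! k \<le> mu ! i"
  by (auto simp: GT_plus_def sorted_wrt_iff_nth_less)

lemma shifted_less:
  assumes "mu \<in> GT_plus n" "i < k" "k < n"
  shows "shifted n mu k < shifted n mu i"
  using GT_plus_antimono[OF assms] assms by (simp add: shifted_def)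

lemma inj_on_shifted: "mu \<in> GT_plus n \<Longrightarrow> inj_on (shifted n mu) {..<n}"
  by (rule linorder_inj_onI) (auto dest: shifted_less)

lemma shifted_inject:
  assumes "mu \<in> GT_plus n" "nu \<in> GT_plus n" "\<And>i. i < n \<Longrightarrow> shifted n mu i = shifted n nu i"
  shows "mu = nu"
proof (rule nth_equalityI)
  show "length mu = length nu" using assms by (simp add: GT_plus_def)
  fix i assume "i < length mu"
  then have "shifted n mu i = shifted n nu i" using assms by (simp add: GT_plus_def)
  then show "mu ! i = nu ! i" unfolding shifted_def by (rule add_right_imp_eq)
qed

lemma obtain_shifted:
  assumes "\<And>i k. i < k \<Longrightarrow> k < n \<Longrightarrow> d k < d i"
  obtains mu where "mu \<in> GT_plus n" "\<And>i. i < n \<Longrightarrow> shifted n mu i = d i"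
proof -
  define mu where "mu = map (\<lambda>i. d i - (n - 1 - i)) [0..<n]"
  have step: "d k + (k - i) \<le> d i" if "i \<le> k" "k < n" for i k
    using that
  proof (induction k)
    case (Suc k)
    show ?case
    proof (cases "i = Suc k")
      case False
      then have "d k + (k - i) \<le> d i" "d (Suc k) < d k" using Suc assms[of k "Suc k"] by auto
      then show ?thesis using Suc.prems False by (simp add: Suc_diff_le)
    qed simp
  qed simp
  \<comment> \<open>A strictly decreasing tuple of naturals stays above its distance from the end,
    so the truncated subtraction in \<open>mu\<close> is exact.\<close>
  have ge: "n - 1 - i \<le> d i" if "i < n" for i
    using step[of i "n - 1"] that by linarith
  have "mu ! k \<le> mu ! i" if "i < k" "k < n" for i k
    using step[of i k] ge[of k] that by (simp add: mu_def)
  then have "mu \<in> GT_plus n"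
    unfolding GT_plus_def sorted_wrt_iff_nth_less by (simp add: mu_def)
  moreover have "shifted n mu i = d i" if "i < n" for i
    using ge[OF that] that by (simp add: shifted_def mu_def)
  ultimately show thesis using that by blast
qed

text \<open>A strictly decreasing tuple is the decreasing enumeration of its set of values.\<close>

lemma shifted_image_inject:
  assumes "mu \<in> GT_plus n" "nu \<in> GT_plus n" "shifted n mu ` {..<n} = shifted n nu ` {..<n}"
  shows "mu = nu"
proof -
  let ?l = "\<lambda>mu. rev (map (shifted n mu) [0..<n])"
  have l: "sorted (?l mu)" "distinct (?l mu)" if "mu \<in> GT_plus n" for mu
  proof -
    show "sorted (?l mu)"
      unfolding sorted_wrt_rev unfolding sorted_wrt_iff_nth_less
      using shifted_less[OF that] by (auto intro: less_imp_le)
    show "distinct (?l mu)" using inj_on_shifted[OF that] by (simp add: distinct_map lessThan_atLeast0)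
  qed
  have "?l mu = ?l nu"
    using l[OF assms(1)] l[OF assms(2)] assms(3)
    by (intro sorted_distinct_set_unique) (auto simp: lessThan_atLeast0)
  then have "map (shifted n mu) [0..<n] = map (shifted n nu) [0..<n]" by (simp only: rev_is_rev_conv)
  then show ?thesis using assms(1,2) by (intro shifted_inject) (auto simp: map_eq_conv)
qed

text \<open>Finite truncations of \<open>GT_plus\<close>. Rows of the kernel, and rows and columns
  of the generators, are supported in one of them, which makes the sums over signatures
  finite.\<close>

definition GT_below :: "nat \<Rightarrow> nat \<Rightarrow> nat list set" where
  "GT_below n M = {mu \<in> GT_plus n. \<forall>i<n. shifted n mu i < M}"

lemma finite_GT_below: "finite (GT_below n M)"
proof (rule finite_subset)
  show "GT_below n M \<subseteq> {mu. set mu \<subseteq> {..<M} \<and> length mu = n}"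
    by (fastforce simp: GT_below_def GT_plus_def shifted_def in_set_conv_nth)
qed (rule finite_lists_length_eq, simp)

text \<open>Phrased for functions of tuples, so that it covers a determinant as a function of its
  row labels or of its column labels; the last clause lets tuples be arbitrary beyond the first n
  entries.\<close>

definition alternating :: "nat \<Rightarrow> ((nat \<Rightarrow> nat) \<Rightarrow> real) \<Rightarrow> bool" where
  "alternating n D \<longleftrightarrow>
     (\<forall>m p. p permutes {..<n} \<longrightarrow> D (m \<circ> p) = of_int (sign p) * D m) \<and>
     (\<forall>m. \<not> inj_on m {..<n} \<longrightarrow> D m = 0) \<and>
     (\<forall>m m'. (\<forall>i<n. m i = m' i) \<longrightarrow> D m = D m')"

lemma alternating_cong: "alternating n D \<Longrightarrow> (\<And>i. i < n \<Longrightarrow> m i = m' i) \<Longrightarrow> D m = D m'"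
  by (auto simp: alternating_def)

lemma ndet_permute_cols:
  assumes "p permutes {..<n}"
  shows "ndet n (\<lambda>i j. A i (p j)) = of_int (sign p) * ndet n A"
proof -
  have p: "p permutes {0..<n}" using assms by (simp add: lessThan_atLeast0)
  have pi: "p i < n" if "i < n" for i using permutes_in_image[OF assms, of i] that by simp
  have "ndet n (\<lambda>i j. A i (p j)) = ndet n (\<lambda>i j. A j (p i))"
    by (rule ndet_transpose[symmetric])
  also have "\<dots> = Determinant.det (Matrix.mat n n (\<lambda>(i, j). Matrix.mat n n (\<lambda>(i, j). A j i) $$ (p i, j)))"
    unfolding ndet_def using pi by (intro arg_cong[where f = Determinant.det] eq_matI) auto
  also have "\<dots> = of_int (sign p) * ndet n (\<lambda>i j. A j i)"
    unfolding ndet_def by (rule det_permute_rows[OF _ p]) simp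
  finally show ?thesis by (simp add: ndet_transpose[of _ A])
qed

lemma alternating_ndet_cols:
  assumes "n \<le> N"
  shows "alternating n (\<lambda>m. ndet N (\<lambda>i j. if j < n then A i (m j) else B i j))"
  unfolding alternating_def
proof (intro conjI allI impI)
  fix m :: "nat \<Rightarrow> nat" and p assume p: "p permutes {..<n}"
  have pi: "p i < n \<longleftrightarrow> i < n" for i using permutes_in_image[OF p, of i] by simp
  have "ndet N (\<lambda>i j. if j < n then A i ((m \<circ> p) j) else B i j)
      = ndet N (\<lambda>i j. (\<lambda>i j. if j < n then A i (m j) else B i j) i (p j))"
    using p by (intro ndet_cong) (auto simp: pi permutes_not_in)
  also have "\<dots> = of_int (sign p) * ndet N (\<lambda>i j. if j < n then A i (m j) else B i j)"
    by (rule ndet_permute_cols[OF permutes_subset[OF p]]) (use assms in auto)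
  finally show "ndet N (\<lambda>i j. if j < n then A i ((m \<circ> p) j) else B i j)
     = of_int (sign p) * ndet N (\<lambda>i j. if j < n then A i (m j) else B i j)" .
next
  fix m :: "nat \<Rightarrow> nat" assume "\<not> inj_on m {..<n}"
  then obtain i k where "i < n" "k < n" "i \<noteq> k" "m i = m k" by (auto simp: inj_on_def)
  then show "ndet N (\<lambda>i j. if j < n then A i (m j) else B i j) = 0"
    using assms by (intro ndet_equal_cols[of i N k]) auto
qed (auto intro!: ndet_cong)

lemma alternating_ndet_rows: "alternating n (\<lambda>m. ndet n (\<lambda>i j. A (m i) j))"
  using alternating_ndet_cols[of n n "\<lambda>i k. A k i" "\<lambda>i j. 0"]
  by (subst ndet_transpose[symmetric]) (simp add: if_distrib cong: ndet_cong if_cong)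

text \<open>Every injective tuple is a strictly decreasing one composed with a unique permutation.\<close>

lemma sum_alternating:
  assumes D: "alternating n D"
  shows "(\<Sum>m\<in>PiE {..<n} (\<lambda>_. {..<M}). (\<Prod>j<n. w j (m j)) * D m)
    = (\<Sum>mu\<in>GT_below n M. D (shifted n mu) * ndet n (\<lambda>i j. w j (shifted n mu i)))"
proof -
  let ?P = "{p. p permutes {..<n}}"
  let ?I = "{m \<in> PiE {..<n} (\<lambda>_. {..<M}). inj_on m {..<n}}"
  define g where "g = (\<lambda>(mu, p). restrict (shifted n mu \<circ> p) {..<n})"
  have inP: "p i < n" if "p permutes {..<n}" "i < n" for p i using permutes_in_image[OF that(1), of i] that by simp
  have bij: "bij_betw g (GT_below n M \<times> ?P) ?I"
  proof (rule bij_betw_imageI)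
    show "inj_on g (GT_below n M \<times> ?P)"
    proof (rule inj_onI, clarify)
      fix mu p mu' p'
      assume mu: "mu \<in> GT_below n M" "mu' \<in> GT_below n M" and p: "p permutes {..<n}" "p' permutes {..<n}"
        and eq: "g (mu, p) = g (mu', p')"
      have eq': "shifted n mu (p i) = shifted n mu' (p' i)" if "i < n" for i
        using fun_cong[OF eq, of i] that by (simp add: g_def)
      have "shifted n mu ` p ` {..<n} = shifted n mu' ` p' ` {..<n}"
        unfolding image_image by (rule image_cong[OF refl]) (simp add: eq')
      then have "mu = mu'"
        using mu by (intro shifted_image_inject) (auto simp: permutes_image[OF p(1)] permutes_image[OF p(2)] GT_below_def)
      moreover have "p i = p' i" for i
      proof (cases "i < n")
        case True
        then show ?thesis
          using eq'[OF True] \<open>mu = mu'\<close> inj_on_shifted[of mu n] mu inP[OF p(1) True] inP[OF p(2) True]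
          by (auto simp: GT_below_def inj_on_def)
      next
        case False
        then show ?thesis using p by (simp add: permutes_not_in)
      qed
      ultimately show "mu = mu' \<and> p = p'" by auto
    qed
    show "g ` (GT_below n M \<times> ?P) = ?I"
    proof (intro equalityI subsetI)
      fix m assume "m \<in> g ` (GT_below n M \<times> ?P)"
      then obtain mu p where mu: "mu \<in> GT_below n M" and p: "p permutes {..<n}"
        and m: "m = restrict (shifted n mu \<circ> p) {..<n}" by (auto simp: g_def)
      have "inj_on (shifted n mu \<circ> p) {..<n}"
        using p mu by (intro comp_inj_on) (auto simp: permutes_image permutes_inj_on GT_below_def inj_on_shifted)
      then show "m \<in> ?I"
        using mu inP[OF p] by (auto simp: m GT_below_def inj_on_def)
    next
      fix m assume m: "m \<in> ?I"
      then have fin: "finite (m ` {..<n})" and card: "card (m ` {..<n}) = n"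
        by (auto simp: card_image)
      \<comment> \<open>The decreasing enumeration of the values of \<open>m\<close> yields the
        signature; \<open>p\<close> below records the rank of each \<open>m i\<close> in it.\<close>
      define xs where "xs = rev (sorted_list_of_set (m ` {..<n}))"
      have len: "length xs = n" and set: "set xs = m ` {..<n}" and dist: "distinct xs"
        using fin card by (auto simp: xs_def)
      have desc: "xs ! k < xs ! i" if "i < k" "k < n" for i k
      proof -
        have "sorted_wrt (\<lambda>x y. y < x) xs"
          unfolding xs_def sorted_wrt_rev using fin by (simp add: sorted_list_of_set.finite_set_strict_sorted)
        then show ?thesis using that len by (simp add: sorted_wrt_iff_nth_less)
      qed
      obtain mu where mu: "mu \<in> GT_plus n" "\<And>i. i < n \<Longrightarrow> shifted n mu i = xs ! i"
        using obtain_shifted[of n "(!) xs"] desc by metis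
      have "xs ! i < M" if "i < n" for i
      proof -
        have "xs ! i \<in> m ` {..<n}" using nth_mem[of i xs] that len set by simp
        then obtain k where k: "k \<in> {..<n}" "xs ! i = m k" by blast
        have "m \<in> PiE {..<n} (\<lambda>_. {..<M})" using m by simp
        then show ?thesis using PiE_mem[of m "{..<n}" "\<lambda>_. {..<M}" k] k by simp
      qed
      then have mub: "mu \<in> GT_below n M" using mu by (auto simp: GT_below_def)
      have img: "shifted n mu ` {..<n} = m ` {..<n}"
      proof -
        have "shifted n mu ` {..<n} = (!) xs ` {..<n}" by (rule image_cong[OF refl]) (simp add: mu(2))
        also have "\<dots> = set xs" using len by (auto simp: set_conv_nth)
        finally show ?thesis using set by simp
      qed
      define p where "p = (\<lambda>i. if i < n then inv_into {..<n} (shifted n mu) (m i) else i)"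
      have sp: "shifted n mu (p i) = m i \<and> p i < n" if "i < n" for i
      proof -
        have "m i \<in> shifted n mu ` {..<n}" using img that by auto
        then show ?thesis
          using f_inv_into_f[of "m i" "shifted n mu" "{..<n}"] inv_into_into[of "m i" "shifted n mu" "{..<n}"] that
          by (simp add: p_def)
      qed
      have "inj_on p {..<n}"
      proof (rule inj_onI)
        fix i k assume *: "i \<in> {..<n}" "k \<in> {..<n}" "p i = p k"
        then have "m i = m k" using sp[of i] sp[of k] by simp
        moreover have "inj_on m {..<n}" using m by simp
        ultimately show "i = k" using * by (auto dest: inj_onD)
      qed
      moreover from this have "p ` {..<n} = {..<n}"
        using sp by (intro card_subset_eq) (auto simp: card_image)
      ultimately have "p permutes {..<n}"
        by (intro bij_imp_permutes) (auto simp: bij_betw_def p_def)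
      moreover have "m = g (mu, p)"
      proof
        fix i
        show "m i = g (mu, p) i"
          using m sp[of i] by (cases "i < n") (auto simp: g_def PiE_def extensional_def)
      qed
      ultimately show "m \<in> g ` (GT_below n M \<times> ?P)" using mub by blast
    qed
  qed
  have "(\<Sum>m\<in>PiE {..<n} (\<lambda>_. {..<M}). (\<Prod>j<n. w j (m j)) * D m) = (\<Sum>m\<in>?I. (\<Prod>j<n. w j (m j)) * D m)"
    using D by (intro sum.mono_neutral_right) (auto simp: alternating_def intro!: finite_PiE)
  also have "\<dots> = (\<Sum>x\<in>GT_below n M \<times> ?P. (\<Prod>j<n. w j (g x j)) * D (g x))"
    by (rule sum.reindex_bij_betw[OF bij, symmetric])
  also have "\<dots> = (\<Sum>mu\<in>GT_below n M. \<Sum>p\<in>?P. (\<Prod>j<n. w j (g (mu, p) j)) * D (g (mu, p)))"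
    by (simp add: sum.cartesian_product)
  also have "\<dots> = (\<Sum>mu\<in>GT_below n M. \<Sum>p\<in>?P. D (shifted n mu) * (of_int (sign p) * (\<Prod>j<n. w j (shifted n mu (p j)))))"
  proof (intro sum.cong refl)
    fix mu p assume "p \<in> ?P"
    have "D (g (mu, p)) = D (shifted n mu \<circ> p)"
      by (rule alternating_cong[OF D]) (simp add: g_def)
    also have "\<dots> = of_int (sign p) * D (shifted n mu)"
      using D \<open>p \<in> ?P\<close> by (auto simp: alternating_def)
    finally show "(\<Prod>j<n. w j (g (mu, p) j)) * D (g (mu, p))
        = D (shifted n mu) * (of_int (sign p) * (\<Prod>j<n. w j (shifted n mu (p j))))"
      by (simp add: g_def)
  qed
  also have "\<dots> = (\<Sum>mu\<in>GT_below n M. D (shifted n mu) * ndet n (\<lambda>i j. w j (shifted n mu i)))"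
    unfolding ndet_leibniz' by (simp add: sum_distrib_left)
  finally show ?thesis .
qed

text \<open>Cauchy-Binet with a spectator column \<open>c\<close>: the first n columns are expanded
  multilinearly, and the choices of labels are collected by signature because the determinant
  alternates in them.\<close>

lemma cauchy_binet_border:
  "ndet (Suc n) (\<lambda>i j. if j < n then \<Sum>r<M. A i r * w j r else c i)
    = (\<Sum>mu\<in>GT_below n M. ndet (Suc n) (\<lambda>i j. if j < n then A i (shifted n mu j) else c i)
         * ndet n (\<lambda>i j. w j (shifted n mu i)))"
proof -
  \<comment> \<open>The spectator column gets the single dummy choice 0, so that one multilinear
    expansion handles all columns.\<close>
  define S where "S = (\<lambda>j. if j < n then {..<M} else {0 :: nat})"
  define D where "D = (\<lambda>m. ndet (Suc n) (\<lambda>i j. if j < n then A i (m j) else c i))"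
  have "ndet (Suc n) (\<lambda>i j. if j < n then \<Sum>r<M. A i r * w j r else c i)
      = ndet (Suc n) (\<lambda>i j. \<Sum>r\<in>S j. if j < n then w j r * A i r else c i)"
    by (intro ndet_cong) (auto simp: S_def mult.commute)
  also have "\<dots> = (\<Sum>f\<in>PiE {..<Suc n} S. ndet (Suc n) (\<lambda>i j. if j < n then w j (f j) * A i (f j) else c i))"
    by (rule ndet_sum_cols) (simp add: S_def)
  also have "\<dots> = (\<Sum>f\<in>PiE {..<Suc n} S. (\<Prod>j<n. w j (f j)) * D f)"
  proof (rule sum.cong[OF refl])
    fix f
    have "ndet (Suc n) (\<lambda>i j. if j < n then w j (f j) * A i (f j) else c i)
        = ndet (Suc n) (\<lambda>i j. (if j < n then w j (f j) else 1) * (if j < n then A i (f j) else c i))"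
      by (intro ndet_cong) auto
    then show "ndet (Suc n) (\<lambda>i j. if j < n then w j (f j) * A i (f j) else c i) = (\<Prod>j<n. w j (f j)) * D f"
      unfolding ndet_scale_cols by (simp add: D_def)
  qed
  also have "\<dots> = (\<Sum>m\<in>PiE {..<n} (\<lambda>_. {..<M}). (\<Prod>j<n. w j (m j)) * D m)"
  proof (rule sum.reindex_bij_witness[where i = "\<lambda>m. m(n := 0)" and j = "\<lambda>f. restrict f {..<n}"])
    fix f assume f: "f \<in> PiE {..<Suc n} S"
    show "(restrict f {..<n})(n := 0) = f"
      using f by (auto simp: fun_eq_iff S_def PiE_def extensional_def Pi_def)
    show "restrict f {..<n} \<in> PiE {..<n} (\<lambda>_. {..<M})"
    proof -
      have "f x < M" if "x < n" for x using PiE_mem[OF f, of x] that by (simp add: S_def)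
      then show ?thesis by auto
    qed
    have "D (restrict f {..<n}) = D f" unfolding D_def by (intro ndet_cong) auto
    then show "(\<Prod>j<n. w j (restrict f {..<n} j)) * D (restrict f {..<n}) = (\<Prod>j<n. w j (f j)) * D f"
      by simp
  next
    fix m assume m: "m \<in> PiE {..<n} (\<lambda>_. {..<M})"
    show "restrict (m(n := 0)) {..<n} = m"
      using m by (auto simp: fun_eq_iff PiE_def extensional_def)
    show "m(n := 0) \<in> PiE {..<Suc n} S"
      using m by (auto simp: S_def PiE_def Pi_def extensional_def)
  qed
  also have "\<dots> = (\<Sum>mu\<in>GT_below n M. D (shifted n mu) * ndet n (\<lambda>i j. w j (shifted n mu i)))"
    unfolding D_def by (intro sum_alternating alternating_ndet_cols) simp
  finally show ?thesis by (simp add: D_def)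
qed

text \<open>Moving one coordinate by at most one either keeps the tuple strictly decreasing or makes
  two entries collide. Since an alternating function vanishes at collisions, the sum over
  neighbouring signatures may run over all one-coordinate moves. W is left general because it is
  used for the rates and for their transpose.\<close>

lemma sum_neighbours:
  assumes D: "alternating n D" and lam: "lam \<in> GT_plus n"
    and W: "\<And>x y. W x y \<noteq> 0 \<Longrightarrow> y \<le> Suc x \<and> x \<le> Suc y"
    and F: "finite F" "F \<subseteq> GT_plus n"
      "\<And>nu k. nu \<in> GT_plus n \<Longrightarrow> k < n \<Longrightarrow> (\<And>i. i < n \<Longrightarrow> i \<noteq> k \<Longrightarrow> shifted n lam i = shifted n nu i)
         \<Longrightarrow> W (shifted n lam k) (shifted n nu k) \<noteq> 0 \<Longrightarrow> nu \<in> F"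
    and M: "\<And>k. k < n \<Longrightarrow> Suc (shifted n lam k) < M"
  shows "(\<Sum>nu\<in>F. (\<Sum>k<n. W (shifted n lam k) (shifted n nu k)
            * of_bool (\<forall>i<n. i \<noteq> k \<longrightarrow> shifted n lam i = shifted n nu i)) * D (shifted n nu))
    = (\<Sum>k<n. \<Sum>y<M. W (shifted n lam k) y * D ((shifted n lam)(k := y)))"
proof -
  let ?l = "shifted n lam"
  have *: "(\<Sum>nu\<in>F. W (?l k) (shifted n nu k) * of_bool (\<forall>i<n. i \<noteq> k \<longrightarrow> ?l i = shifted n nu i) * D (shifted n nu))
      = (\<Sum>y<M. W (?l k) y * D (?l(k := y)))" if k: "k < n" for k
  proof -
    define N where "N = {nu \<in> F. (\<forall>i<n. i \<noteq> k \<longrightarrow> ?l i = shifted n nu i) \<and> W (?l k) (shifted n nu k) \<noteq> 0}"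
    have inj: "inj_on (\<lambda>nu. shifted n nu k) N"
    proof (rule inj_onI)
      fix mu nu assume *: "mu \<in> N" "nu \<in> N" "shifted n mu k = shifted n nu k"
      then have "shifted n mu i = shifted n nu i" if "i < n" for i
        using that by (cases "i = k") (auto simp: N_def)
      then show "mu = nu" using * F(2) by (intro shifted_inject[of _ n]) (auto simp: N_def)
    qed
    have "(\<Sum>nu\<in>F. W (?l k) (shifted n nu k) * of_bool (\<forall>i<n. i \<noteq> k \<longrightarrow> ?l i = shifted n nu i) * D (shifted n nu))
       = (\<Sum>nu\<in>N. W (?l k) (shifted n nu k) * D (shifted n nu))"
      using F(1) by (intro sum.mono_neutral_cong_right) (auto simp: N_def)
    also have "\<dots> = (\<Sum>nu\<in>N. W (?l k) (shifted n nu k) * D (?l(k := shifted n nu k)))"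
      by (intro sum.cong refl arg_cong2[where f = "(*)"] alternating_cong[OF D]) (auto simp: N_def)
    also have "\<dots> = (\<Sum>y\<in>(\<lambda>nu. shifted n nu k) ` N. W (?l k) y * D (?l(k := y)))"
      by (simp add: sum.reindex[OF inj])
    also have "\<dots> = (\<Sum>y<M. W (?l k) y * D (?l(k := y)))"
    proof (rule sum.mono_neutral_left)
      show "(\<lambda>nu. shifted n nu k) ` N \<subseteq> {..<M}"
        using W M[OF k] by (fastforce simp: N_def)
      show "\<forall>y\<in>{..<M} - (\<lambda>nu. shifted n nu k) ` N. W (?l k) y * D (?l(k := y)) = 0"
      proof (rule ballI, rule ccontr)
        fix y assume y: "y \<in> {..<M} - (\<lambda>nu. shifted n nu k) ` N" and "W (?l k) y * D (?l(k := y)) \<noteq> 0"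
        then have nz: "W (?l k) y \<noteq> 0" "D (?l(k := y)) \<noteq> 0" by auto
        then have inj: "inj_on (?l(k := y)) {..<n}" using D unfolding alternating_def by blast
        have near: "y \<le> Suc (?l k)" "?l k \<le> Suc y" using W nz by auto
        \<comment> \<open>A jump of size at most one can break the strict order only by a collision,
          which injectivity excludes.\<close>
        have "(?l(k := y)) j < (?l(k := y)) i" if "i < j" "j < n" for i j
        proof -
          have "(?l(k := y)) i \<noteq> (?l(k := y)) j" using inj_onD[OF inj, of i j] that by auto
          then show ?thesis using shifted_less[OF lam that] near by (auto split: if_splits)
        qed
        then obtain nu where nu: "nu \<in> GT_plus n" "\<And>i. i < n \<Longrightarrow> shifted n nu i = (?l(k := y)) i"
          using obtain_shifted[of n "?l(k := y)"] by metis
        then have "nu \<in> F" using F(3)[OF nu(1) k] nz k by auto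
        then have "nu \<in> N" using nu nz k by (auto simp: N_def)
        moreover have "shifted n nu k = y" using nu k by simp
        ultimately show False using y by blast
      qed
    qed simp
    finally show ?thesis .
  qed
  show ?thesis
    unfolding sum_distrib_right by (subst sum.swap) (rule sum.cong[OF refl], simp only: * lessThan_iff)
qed

section \<open>The one-particle chain\<close>

locale jacobi_parameters =
  fixes a b :: real
  assumes b_le_a: "b \<le> a" and b_ge: "- 1 / 2 \<le> b"
begin

abbreviation "e \<equiv> eps a b"

lemma eps_nonneg: "0 \<le> e"
  using b_le_a b_ge by (simp add: eps_def)

definition phi :: "nat \<Rightarrow> nat \<Rightarrow> real" where
  "phi m x = (\<Prod>r<m. hat a b x - hat a b r)"

text \<open>The factor with which \<open>bd_op\<close> lowers \<open>phi m\<close> to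
  \<open>phi (m - 1)\<close>; the products of these factors are the hypergeometric denominators in
  \<open>jac\<close>.\<close>

definition theta :: "nat \<Rightarrow> real" where
  "theta m = real m * (real m + a)"

text \<open>This is \<open>hat a b m - hat a b 0\<close>; its negative is the eigenvalue of the
  Jacobi operator on the polynomial of degree m.\<close>

definition xi :: "nat \<Rightarrow> real" where
  "xi m = real m * (real m + 2 * e)"

text \<open>\<open>beta0\<close> and \<open>delta0\<close> are the factors of the rates free of u
  and u'. They are the coefficients of the three-term recurrence of the Jacobi polynomials
  normalized by the value 1 at 1 (\<open>bd_op_jac\<close>).\<close>

definition beta0 :: "nat \<Rightarrow> real" where
  "beta0 x = (if x = 0 \<and> e = 0 then a + 1
     else (real x + 2 * e) * (real x + a + 1) / (2 * (real x + e) * (2 * real x + 2 * e + 1)))"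

definition delta0 :: "nat \<Rightarrow> real" where
  "delta0 x = real x * (real x + b) / (2 * (real x + e) * (2 * real x + 2 * e - 1))"

definition bd_op :: "(nat \<Rightarrow> real) \<Rightarrow> nat \<Rightarrow> real" where
  "bd_op f x = beta0 x * (f (x + 1) - f x) + delta0 x * (f (x - 1) - f x)"

lemma beta0_pos: "0 < beta0 x"
proof (cases "x = 0 \<and> e = 0")
  case False
  then have "0 < real x + e" using eps_nonneg by (cases x) auto
  moreover from this have "0 < real x + 2 * e" using eps_nonneg by linarith
  moreover have "0 < real x + a + 1" using b_le_a b_ge by linarith
  ultimately show ?thesis using False eps_nonneg by (auto simp: beta0_def)
qed (use b_le_a b_ge in \<open>auto simp: beta0_def\<close>)

lemma delta0_pos: "0 < delta0 (Suc x)"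
proof -
  have "0 < real (Suc x) + b" "0 < 2 * real (Suc x) + 2 * e - 1" "0 < real (Suc x) + e"
    using eps_nonneg b_ge by (auto simp: add_pos_nonneg)
  then show ?thesis by (auto simp: delta0_def)
qed

lemma delta0_0 [simp]: "delta0 0 = 0"
  by (simp add: delta0_def)

text \<open>After cross-multiplication the linear factors differ by 2 (y + e) (a - b), whose sign
  comes from a \<ge> b. The inequality makes \<open>scale_step\<close> nonincreasing, hence bounded,
  which controls the kernel at infinity.\<close>

lemma delta0_le_beta0: "delta0 (Suc x) \<le> beta0 (Suc x)"
proof -
  define y where "y = real (Suc x)"
  have y: "1 \<le> y" by (simp add: y_def)
  have "y * (y + b) * (2 * y + 2 * e + 1) \<le> (y + 2 * e) * (y + a + 1) * (2 * y + 2 * e - 1)"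
  proof -
    have "(y + b) * (2 * y + 2 * e + 1) \<le> (y + a + 1) * (2 * y + 2 * e - 1)"
    proof -
      have "0 \<le> 2 * ((y + e) * (a - b))" using y eps_nonneg b_le_a by simp
      also have "\<dots> = (y + a + 1) * (2 * y + 2 * e - 1) - (y + b) * (2 * y + 2 * e + 1)"
        by (simp add: eps_def field_simps)
      finally show ?thesis by simp
    qed
    moreover have "0 \<le> (y + b) * (2 * y + 2 * e + 1)"
      using y eps_nonneg b_ge by simp
    ultimately have "y * ((y + b) * (2 * y + 2 * e + 1)) \<le> (y + 2 * e) * ((y + a + 1) * (2 * y + 2 * e - 1))"
      using y eps_nonneg
      by (intro mult_mono[of y "y + 2 * e" "(y + b) * (2 * y + 2 * e + 1)"]) linarith+
    then show ?thesis by (simp add: mult.assoc)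
  qed
  then have "y * (y + b) / (2 * (y + e) * (2 * y + 2 * e - 1))
      \<le> (y + 2 * e) * (y + a + 1) / (2 * (y + e) * (2 * y + 2 * e + 1))"
    using y eps_nonneg by (simp add: divide_simps)
  then show ?thesis by (simp add: delta0_def beta0_def y_def)
qed

section \<open>The basis \<open>phi\<close> and the action of \<open>bd_op\<close> on it\<close>

lemma phi_0 [simp]: "phi 0 x = 1" by (simp add: phi_def)

lemma phi_Suc: "phi (Suc m) x = phi m x * (hat a b x - hat a b m)" by (simp add: phi_def)

lemma hat_diff: "hat a b x - hat a b y = (real x - real y) * (real x + real y + 2 * e)"
  by (simp add: hat_def power2_eq_square algebra_simps)

lemma phi_eq_0: "x < m \<Longrightarrow> phi m x = 0"
  by (auto simp: phi_def)

lemma phi_pos: "m \<le> x \<Longrightarrow> 0 < phi m x"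
  unfolding phi_def hat_diff using eps_nonneg by (intro prod_pos mult_pos_pos) auto

lemma xi_phi: "xi x * phi m x = phi (Suc m) x + xi m * phi m x"
  by (simp add: phi_Suc hat_diff xi_def algebra_simps)

lemma theta_pos: "0 < theta (Suc m)"
  using b_le_a b_ge by (simp add: theta_def)

text \<open>The differences factor as \<open>hat x - hat r\<close> = (x - r) (x + r + 2e); shifting
  x by one shifts both chains of linear factors, so the values at x and x + 1 share all but two of
  them.\<close>

lemma phi_eq_shifted:
  "phi (Suc m) x =
     (\<Prod>r<m. (real x - real r) * (real x + 1 + real r + 2 * e)) * (real x - real m) * (real x + 2 * e)
   \<and> phi (Suc m) (x + 1) =
     (\<Prod>r<m. (real x - real r) * (real x + 1 + real r + 2 * e)) * (real x + 1) * (real x + 1 + real m + 2 * e)"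
proof (induction m)
  case (Suc m)
  define A where "A = (\<Prod>r<m. (real x - real r) * (real x + 1 + real r + 2 * e))"
  have "(\<Prod>r<Suc m. (real x - real r) * (real x + 1 + real r + 2 * e))
      = A * ((real x - real m) * (real x + 1 + real m + 2 * e))"
    by (simp add: A_def)
  with Suc show ?case
    unfolding phi_Suc[of "Suc m"] by (simp only: A_def[symmetric]) (simp add: hat_diff algebra_simps)
qed (simp add: phi_Suc hat_diff algebra_simps)

lemma phi_step: "phi (Suc m) (x + 1) - phi (Suc m) x =
   (real m + 1) * (2 * real x + 2 * e + 1) * (\<Prod>r<m. (real x - real r) * (real x + 1 + real r + 2 * e))"
proof -
  define A where "A = (\<Prod>r<m. (real x - real r) * (real x + 1 + real r + 2 * e))"
  have "A * (real x + 1) * (real x + 1 + real m + 2 * e) - A * (real x - real m) * (real x + 2 * e) =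
      (real m + 1) * (2 * real x + 2 * e + 1) * A"
    by (simp add: algebra_simps)
  then show ?thesis
    using phi_eq_shifted[of m x] by (simp add: A_def)
qed

text \<open>The increments of \<open>phi (Suc m)\<close> contain the factor 2x + 2e + 1 (upward) or
  2x + 2e - 1 (downward), which cancels against the denominators of \<open>beta0\<close> and
  \<open>delta0\<close>. The point x = 0 is separate because there x + e may vanish.\<close>

lemma bd_op_phi: "bd_op (phi (Suc m)) x = theta (Suc m) * phi m x"
proof -
  let ?A = "\<Prod>r<m. (real x - real r) * (real x + 1 + real r + 2 * e)"
  have up: "phi (Suc m) (x + 1) - phi (Suc m) x = (real m + 1) * (2 * real x + 2 * e + 1) * ?A"
    by (rule phi_step)
  show ?thesis
  proof (cases x)
    case 0
    show ?thesis
    proof (cases m)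
      case 0
      then show ?thesis using \<open>x = 0\<close> up eps_nonneg
        by (simp add: bd_op_def beta0_def theta_def)
    next
      case (Suc k)
      then show ?thesis using \<open>x = 0\<close> up by (simp add: bd_op_def phi_eq_0)
    qed
  next
    case (Suc y)
    have xp: "0 < real x + e" "2 * real x + 2 * e - 1 > 0" "real x + 2 * e > 0"
      using Suc eps_nonneg by auto
    let ?B = "\<Prod>r<m. (real y - real r) * (real y + 1 + real r + 2 * e)"
    have down: "phi (Suc m) x - phi (Suc m) y = (real m + 1) * (2 * real y + 2 * e + 1) * ?B"
      using phi_step[of m y] Suc by simp
    have A: "?A * (real x + 2 * e) = phi m x * (real x + 2 * e + real m)"
      by (cases m) (simp_all add: phi_eq_shifted[THEN conjunct1])
    have B: "?B * real x = phi m x * (real x - real m)"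
    proof (induction m)
      case (Suc m)
      have "(\<Prod>r<Suc m. (real y - real r) * (real y + 1 + real r + 2 * e)) * real x
        = (phi m x * (real x - real m)) * ((real y - real m) * (real y + 1 + real m + 2 * e))"
        using Suc by (simp add: mult_ac)
      then show ?case using \<open>x = Suc y\<close> by (simp add: phi_Suc hat_diff algebra_simps)
    qed simp
    have "beta0 x * (phi (Suc m) (x + 1) - phi (Suc m) x)
      = (real m + 1) * (?A * (real x + 2 * e)) * (real x + a + 1) / (2 * (real x + e))"
      using xp Suc unfolding up beta0_def by (simp add: divide_simps)
    then have U: "beta0 x * (phi (Suc m) (x + 1) - phi (Suc m) x)
      = (real m + 1) * (phi m x * (real x + 2 * e + real m)) * (real x + a + 1) / (2 * (real x + e))"
      unfolding A .
    have "delta0 x * (phi (Suc m) (x - 1) - phi (Suc m) x)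
      = - ((real m + 1) * (?B * real x) * (real x + b) / (2 * (real x + e)))"
    proof -
      have "phi (Suc m) (x - 1) - phi (Suc m) x = - ((real m + 1) * (2 * real x + 2 * e - 1) * ?B)"
        using down Suc by (simp add: algebra_simps)
      then show ?thesis using xp unfolding delta0_def by (simp add: divide_simps)
    qed
    then have V: "delta0 x * (phi (Suc m) (x - 1) - phi (Suc m) x)
      = - ((real m + 1) * (phi m x * (real x - real m)) * (real x + b) / (2 * (real x + e)))"
      unfolding B by simp
    have common_factor: "c * (p * u) * v - c * (p * u') * v' = c * p * (u * v - u' * v')" for c p u v u' v' :: real
      by (simp add: algebra_simps)
    have "bd_op (phi (Suc m)) x
       = (real m + 1) * (phi m x * (real x + 2 * e + real m)) * (real x + a + 1) / (2 * (real x + e))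
       - (real m + 1) * (phi m x * (real x - real m)) * (real x + b) / (2 * (real x + e))"
      unfolding bd_op_def U V by (simp flip: minus_divide_left)
    also have "\<dots> = (real m + 1) * phi m x *
       ((real x + 2 * e + real m) * (real x + a + 1) - (real x - real m) * (real x + b)) / (2 * (real x + e))"
      unfolding diff_divide_distrib[symmetric]
      by (rule arg_cong[where f = "\<lambda>y. y / _"]) (rule common_factor)
    \<comment> \<open>Since 2e = a + b + 1, the bracket is divisible by the remaining denominator 2
      (x + e).\<close>
    also have "(real x + 2 * e + real m) * (real x + a + 1) - (real x - real m) * (real x + b)
       = (2 * (real x + e)) * (real m + 1 + a)"
      by (simp add: eps_def field_simps)
    finally show ?thesis using xp by (simp add: theta_def add_ac)
  qed
qed

lemma bd_op_phi_0 [simp]: "bd_op (phi 0) x = 0"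
  by (simp add: bd_op_def)

text \<open>
  The reversible measure of the chain \<open>bd_op\<close>, the increments of its scale function, and the resulting
  Green function.
\<close>

definition stat :: "nat \<Rightarrow> real" where
  "stat k = (\<Prod>i<k. beta0 i / delta0 (Suc i))"

definition scale_step :: "nat \<Rightarrow> real" where
  "scale_step k = 1 / (stat k * beta0 k)"

definition green :: "nat \<Rightarrow> nat \<Rightarrow> real" where
  "green l m = stat m * (\<Sum>k=m..<l. scale_step k)"

definition green_op :: "(nat \<Rightarrow> real) \<Rightarrow> nat \<Rightarrow> real" where
  "green_op f l = (\<Sum>m<l. green l m * f m)"

lemma stat_pos: "0 < stat k"
  unfolding stat_def using beta0_pos delta0_pos by (intro prod_pos) auto

lemma scale_step_pos: "0 < scale_step k"
  unfolding scale_step_def using beta0_pos stat_pos by simp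

lemma scale_step_le: "scale_step k \<le> scale_step 0"
proof (induction k)
  case (Suc k)
  have "scale_step (Suc k) = scale_step k * (delta0 (Suc k) / beta0 (Suc k))"
    using beta0_pos[of k] delta0_pos[of k] by (simp add: scale_step_def stat_def)
  also have "\<dots> \<le> scale_step k"
    using delta0_le_beta0[of k] beta0_pos[of "Suc k"] delta0_pos[of k] scale_step_pos[of k]
    by (intro mult_left_le) auto
  finally show ?case using Suc by simp
qed simp

text \<open>Raising l by one adds the single term \<open>scale_step l\<close> to every inner sum of
  \<open>green\<close>; the new diagonal label m = l contributes only this term.\<close>

lemma green_op_step: "green_op f (Suc l) - green_op f l = scale_step l * (\<Sum>m\<le>l. stat m * f m)"
proof -
  have "green_op f (Suc l) = (\<Sum>m\<le>l. stat m * f m * (\<Sum>k=m..<Suc l. scale_step k))"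
    by (simp add: green_op_def green_def lessThan_Suc_atMost mult_ac)
  also have "\<dots> = (\<Sum>m\<le>l. stat m * f m * (\<Sum>k=m..<l. scale_step k) + scale_step l * (stat m * f m))"
    by (intro sum.cong) (auto simp: algebra_simps)
  also have "\<dots> = (\<Sum>m\<le>l. stat m * f m * (\<Sum>k=m..<l. scale_step k)) + scale_step l * (\<Sum>m\<le>l. stat m * f m)"
    by (simp add: sum.distrib sum_distrib_left)
  also have "(\<Sum>m\<le>l. stat m * f m * (\<Sum>k=m..<l. scale_step k)) = green_op f l"
    by (simp add: green_op_def green_def mult_ac flip: lessThan_Suc_atMost)
  finally show ?thesis by simp
qed

lemma green_op_0 [simp]: "green_op f 0 = 0"
  by (simp add: green_op_def)

lemma bd_op_green_op: "bd_op (green_op f) x = f x"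
proof (cases x)
  case 0
  have "bd_op (green_op f) 0 = beta0 0 * (green_op f (Suc 0) - green_op f 0)"
    by (simp add: bd_op_def)
  also have "\<dots> = f 0"
    using beta0_pos[of 0] by (subst green_op_step) (simp add: scale_step_def stat_def)
  finally show ?thesis using 0 by simp
next
  case (Suc y)
  have "bd_op (green_op f) x = beta0 x * (green_op f (Suc x) - green_op f x)
     - delta0 x * (green_op f (Suc y) - green_op f y)"
    by (simp add: bd_op_def Suc algebra_simps)
  also have "\<dots> = (\<Sum>m\<le>x. stat m * f m) / stat x - (\<Sum>m\<le>y. stat m * f m) / stat x"
  proof -
    have "delta0 x * scale_step y = 1 / stat x"
      using beta0_pos[of y] delta0_pos[of y] stat_pos[of y]
      by (simp add: scale_step_def Suc stat_def)
    moreover have "beta0 x * scale_step x = 1 / stat x"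
      using beta0_pos[of x] by (simp add: scale_step_def)
    ultimately show ?thesis
      unfolding green_op_step by (simp add: mult.assoc[symmetric])
  qed
  also have "\<dots> = f x"
    using stat_pos[of x] by (simp add: Suc add_divide_distrib)
  finally show ?thesis .
qed

text \<open>Because \<open>beta0\<close> is positive, the equation at y determines the value at y +
  1 from the earlier ones.\<close>

lemma bd_op_inj:
  assumes "\<And>x. bd_op f x = bd_op g x" "f 0 = g 0"
  shows "f x = g x"
proof (induction x rule: less_induct)
  case (less x)
  show ?case
  proof (cases x)
    case (Suc y)
    have "bd_op f y = bd_op g y" "f y = g y" "f (y - 1) = g (y - 1)" 
      using less Suc assms by auto
    then show ?thesis using beta0_pos[of y] Suc by (auto simp: bd_op_def)
  qed (use assms in auto)
qed

text \<open>After adding back the constant \<open>f 0\<close>, both sides have the same image under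
  \<open>bd_op\<close> and the same value at 0.\<close>

lemma green_op_bd_op: "green_op (bd_op f) x = f x - f 0"
proof -
  have "green_op (bd_op f) x + f 0 = f x"
  proof (rule bd_op_inj[where f = "\<lambda>x. green_op (bd_op f) x + f 0"])
    fix x
    have "bd_op (\<lambda>x. green_op (bd_op f) x + f 0) x = bd_op (green_op (bd_op f)) x"
      by (simp add: bd_op_def)
    then show "bd_op (\<lambda>x. green_op (bd_op f) x + f 0) x = bd_op f x"
      by (simp add: bd_op_green_op)
  qed simp
  then show ?thesis by simp
qed

lemma green_op_scale: "green_op (\<lambda>x. c * f x) l = c * green_op f l"
  by (simp add: green_op_def sum_distrib_left mult_ac)

lemma green_op_add: "green_op (\<lambda>x. f x + g x) l = green_op f l + green_op g l"
  by (simp add: green_op_def sum.distrib algebra_simps)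

lemma green_op_phi: "green_op (phi m) x = phi (Suc m) x / theta (Suc m)"
proof -
  have "theta (Suc m) * green_op (phi m) x = green_op (bd_op (phi (Suc m))) x"
    by (simp add: bd_op_phi[abs_def] green_op_scale)
  also have "\<dots> = phi (Suc m) x" by (simp add: green_op_bd_op phi_eq_0)
  finally show ?thesis using theta_pos[of m] by (simp add: field_simps)
qed

section \<open>The full rates as real functions of s = u + u' and q = u u', and their relation to
  the Green operator\<close>

definition birth :: "real \<Rightarrow> real \<Rightarrow> nat \<Rightarrow> real" where
  "birth s q x = beta0 x * ((real x)\<^sup>2 - s * real x + q)"

definition death :: "real \<Rightarrow> real \<Rightarrow> nat \<Rightarrow> real" where
  "death s q x = delta0 x * ((real x + 2 * e)\<^sup>2 + s * (real x + 2 * e) + q)"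

definition rate_op :: "real \<Rightarrow> real \<Rightarrow> (nat \<Rightarrow> real) \<Rightarrow> nat \<Rightarrow> real" where
  "rate_op s q f x = birth s q x * (f (x + 1) - f x) + death s q x * (f (x - 1) - f x)"

text \<open>The constants k and c are chosen so that the quadratic factor of the birth rate is
  \<open>xi x + c\<close> minus k times the forward increment of \<open>xi\<close>, and that of the
  death rate is \<open>xi x + c\<close> plus k times the backward increment. The increments,
  weighted by \<open>beta0\<close> and \<open>delta0\<close>, assemble into the commutator of
  \<open>bd_op\<close> with multiplication by \<open>xi\<close>.\<close>

lemma rate_op_eq:
  fixes s q defines "k \<equiv> (2 * e + s) / 2"
  defines "c \<equiv> q + k * (1 + 2 * e)"
  shows "rate_op s q f x = (xi x + c) * bd_op f x
     - k * (bd_op (\<lambda>y. xi y * f y) x - xi x * bd_op f x - (a + 1) * f x)"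
proof -
  \<comment> \<open>As \<open>phi 1\<close> equals \<open>xi\<close>, this evaluates the commutator
    on the constant function 1.\<close>
  have "bd_op (phi 1) x = a + 1"
    using bd_op_phi[of 0 x] by (simp add: theta_def)
  then have TX: "beta0 x * (2 * real x + 2 * e + 1) - delta0 x * (2 * real x + 2 * e - 1) = a + 1"
    by (cases x) (simp_all add: bd_op_def phi_Suc hat_diff algebra_simps)
  have b: "birth s q x = beta0 x * (xi x + c - k * (2 * real x + 2 * e + 1))"
    by (simp add: birth_def xi_def c_def k_def field_simps power2_eq_square)
  have d: "death s q x = delta0 x * (xi x + c + k * (2 * real x + 2 * e - 1))"
    by (simp add: death_def xi_def c_def k_def field_simps power2_eq_square)
  have x1: "xi (x + 1) = xi x + (2 * real x + 2 * e + 1)"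
    by (simp add: xi_def algebra_simps)
  have x2: "delta0 x * xi (x - 1) = delta0 x * (xi x - (2 * real x + 2 * e - 1))"
    by (cases x) (auto simp: xi_def algebra_simps)
  have x2': "delta0 x * (xi (x - 1) * f (x - 1)) = delta0 x * (xi x - (2 * real x + 2 * e - 1)) * f (x - 1)"
    using x2 by (metis mult.assoc)
  have TXf: "bd_op (\<lambda>y. xi y * f y) x = beta0 x * (xi (x+1) * f (x + 1) - xi x * f x) + delta0 x * (xi x - (2 * real x + 2 * e - 1)) * f (x - 1) 
    - delta0 x * xi x * f x"
    using x2' by (simp add: bd_op_def algebra_simps)
  then show ?thesis
    unfolding rate_op_def b d TX[symmetric] TXf unfolding bd_op_def x1
    by (simp add: algebra_simps)
qed

text \<open>\<open>bd_op\<close> lowers the basis by one and multiplication by \<open>xi\<close>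
  raises it by one, so their products in \<open>rate_op_eq\<close> leave two terms.\<close>

lemma rate_op_phi_Suc:
  fixes s q defines "k \<equiv> (2 * e + s) / 2"
  defines "c \<equiv> q + k * (1 + 2 * e)"
  shows "rate_op s q (phi (Suc m)) x = (theta (Suc m) - 2 * k * (real m + 1)) * phi (Suc m) x
     + theta (Suc m) * ((1 + k) * xi m + c - k * xi (Suc m)) * phi m x"
proof -
  have "bd_op (\<lambda>y. xi y * phi (Suc m) y) x
      = bd_op (phi (Suc (Suc m))) x + xi (Suc m) * bd_op (phi (Suc m)) x"
    unfolding xi_phi bd_op_def by (simp add: algebra_simps)
  then have 1: "bd_op (\<lambda>y. xi y * phi (Suc m) y) x
      = theta (Suc (Suc m)) * phi (Suc m) x + xi (Suc m) * (theta (Suc m) * phi m x)"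
    by (simp only: bd_op_phi)
  have 2: "theta (Suc (Suc m)) = theta (Suc m) + 2 * (real m + 1) + 1 + a"
    by (simp add: theta_def algebra_simps)
  have P: "phi (Suc m) x = xi x * phi m x - xi m * phi m x"
    using xi_phi[of x m] by simp
  show ?thesis
    unfolding rate_op_eq 1 k_def[symmetric] c_def[symmetric] bd_op_phi 2 P
    by (simp add: algebra_simps)
qed

lemma rate_op_phi_0: "rate_op s q (phi 0) x = 0"
  by (simp add: rate_op_def)

text \<open>The passage (s, q) to (s - 2, q - s + 1) is (u, u') to (u - 1, u' - 1), and it lowers k
  by 1. Comparing the coefficients of \<open>phi (Suc m)\<close> produces \<open>- (s + b)\<close>,
  while those of \<open>phi m\<close> agree. For m = 0 the shifted operator kills the constant
  \<open>phi 0\<close>, and q is left over.\<close>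

lemma rate_op_green_op_phi:
  "rate_op s q (green_op (phi m)) x
     = green_op (rate_op (s - 2) (q - s + 1) (phi m)) x - (s + b) * green_op (phi m) x + q * phi m 0"
proof -
  define k where "k = (2 * e + s) / 2"
  have s: "s = 2 * k - 2 * e" by (simp add: k_def field_simps)
  have k': "(2 * e + (s - 2)) / 2 = k - 1" by (simp add: k_def field_simps)
  have sb: "s + b = 2 * k - a - 1" by (simp add: s eps_def field_simps)
  have "rate_op s q (green_op (phi m)) x = rate_op s q (phi (Suc m)) x / theta (Suc m)"
    using theta_pos[of m] by (simp add: rate_op_def green_op_phi field_simps)
  also have "\<dots> = (1 - 2 * k * (real m + 1) / theta (Suc m)) * phi (Suc m) x
     + ((1 + k) * xi m + (q + k * (1 + 2 * e)) - k * xi (Suc m)) * phi m x"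
    using theta_pos[of m] unfolding rate_op_phi_Suc k_def[symmetric] by (simp add: field_simps)
  finally have L: "rate_op s q (green_op (phi m)) x = (1 - 2 * k * (real m + 1) / theta (Suc m)) * phi (Suc m) x
     + ((1 + k) * xi m + (q + k * (1 + 2 * e)) - k * xi (Suc m)) * phi m x" .
  show ?thesis
  proof (cases m)
    case 0
    have "theta 1 = 1 + a" by (simp add: theta_def)
    moreover have "0 < 1 + a" using b_le_a b_ge by linarith
    moreover have "(1 + a + b + s) * phi (Suc 0) x = 2 * k * phi (Suc 0) x"
      using sb by simp
    ultimately show ?thesis using 0
      unfolding L rate_op_phi_0[abs_def]
      by (simp add: rate_op_phi_0[abs_def] sb green_op_phi xi_def field_simps) (simp add: green_op_def)
  next
    case (Suc n)
    have t: "theta (Suc m) \<noteq> 0" "theta m \<noteq> 0" using theta_pos[of m] theta_pos[of n] Suc by auto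
    have "rate_op (s - 2) (q - s + 1) (phi m) = (\<lambda>y. (theta m - 2 * (k - 1) * real m) * phi m y
       + theta m * (k * xi n + (q - s + 1 + (k - 1) * (1 + 2 * e)) - (k - 1) * xi m) * phi n y)"
      unfolding Suc rate_op_phi_Suc k' by (simp add: add.commute)
    then have R: "green_op (rate_op (s - 2) (q - s + 1) (phi m)) x
       = (theta m - 2 * (k - 1) * real m) * (phi (Suc m) x / theta (Suc m))
       + (k * xi n + (q - s + 1 + (k - 1) * (1 + 2 * e)) - (k - 1) * xi m) * phi m x"
      using t by (simp add: green_op_add green_op_scale green_op_phi Suc)
    have 1: "theta (Suc m) = theta m + 2 * real m + 1 + a"
      by (simp add: theta_def algebra_simps)
    have 2: "xi n = xi m - 2 * real m + 1 - 2 * e" "xi (Suc m) = xi m + 2 * real m + 1 + 2 * e"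
      by (simp_all add: xi_def Suc algebra_simps)
    have "(1 - 2 * k * (real m + 1) / theta (Suc m)) * phi (Suc m) x
      = (theta (Suc m) - 2 * k * (real m + 1)) * (phi (Suc m) x / theta (Suc m))"
      using t by (simp add: field_simps)
    also have "\<dots> = (theta m - 2 * (k - 1) * real m) * (phi (Suc m) x / theta (Suc m))
       - (s + b) * (phi (Suc m) x / theta (Suc m))"
      unfolding left_diff_distrib[symmetric] sb
      by (rule arg_cong2[where f = "(*)"]) (simp_all add: 1 algebra_simps)
    finally have E: "(1 - 2 * k * (real m + 1) / theta (Suc m)) * phi (Suc m) x
       = (theta m - 2 * (k - 1) * real m) * (phi (Suc m) x / theta (Suc m))
       - (s + b) * (phi (Suc m) x / theta (Suc m))" .
    have F: "(1 + k) * xi m + (q + k * (1 + 2 * e)) - k * xi (Suc m)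
        = k * xi n + (q - s + 1 + (k - 1) * (1 + 2 * e)) - (k - 1) * xi m"
      unfolding 2 s by (simp add: algebra_simps)
    have "phi m 0 = 0" by (simp add: phi_eq_0 Suc)
    then show ?thesis
      unfolding L R unfolding E F green_op_phi by simp
  qed
qed

text \<open>The matrix \<open>phi m x\<close> is triangular: \<open>phi m\<close> vanishes below m
  and is positive at m.\<close>

lemma phi_span: "\<exists>c. \<forall>x\<le>M. f x = (\<Sum>m\<le>M. c m * phi m x)"
proof (induction M)
  case 0
  show ?case by (intro exI[of _ "\<lambda>_. f 0"]) simp
next
  case (Suc M)
  then obtain c where c: "\<And>x. x \<le> M \<Longrightarrow> f x = (\<Sum>m\<le>M. c m * phi m x)" by blast
  define c' where "c' = c(Suc M := (f (Suc M) - (\<Sum>m\<le>M. c m * phi m (Suc M))) / phi (Suc M) (Suc M))"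
  have "f x = (\<Sum>m\<le>Suc M. c' m * phi m x)" if "x \<le> Suc M" for x
  proof (cases "x = Suc M")
    case True
    then show ?thesis using phi_pos[of "Suc M" "Suc M"] by (simp add: c'_def)
  next
    case False
    then show ?thesis using c[of x] that by (simp add: c'_def phi_eq_0)
  qed
  then show ?case by blast
qed

text \<open>Both sides at x depend linearly on the values of f up to x + 1, where f agrees with a
  combination of the \<open>phi m\<close>.\<close>

lemma rate_op_green_op:
  "rate_op s q (green_op f) x
     = green_op (rate_op (s - 2) (q - s + 1) f) x - (s + b) * green_op f x + q * f 0"
proof -
  obtain c where c: "\<And>y. y \<le> Suc x \<Longrightarrow> f y = (\<Sum>m\<le>Suc x. c m * phi m y)"
    using phi_span[of "Suc x" f] by blast
  define g where "g = (\<lambda>y. \<Sum>m\<le>Suc x. c m * phi m y)"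
  have fg: "f y = g y" if "y \<le> Suc x" for y using c that by (simp add: g_def)
  have G: "green_op g y = (\<Sum>m\<le>Suc x. c m * green_op (phi m) y)" for y
    unfolding g_def green_op_def sum_distrib_left by (subst sum.swap) (simp add: mult_ac)
  have R: "rate_op s q (\<lambda>y. \<Sum>m\<le>Suc x. c m * h m y) y = (\<Sum>m\<le>Suc x. c m * rate_op s q (h m) y)" for s q y h
    unfolding rate_op_def 
    by (simp add: sum_distrib_left sum_subtractf sum.distrib algebra_simps del: sum.atMost_Suc)
  have GR: "green_op (rate_op (s - 2) (q - s + 1) g) x = (\<Sum>m\<le>Suc x. c m * green_op (rate_op (s - 2) (q - s + 1) (phi m)) x)"
    unfolding g_def R unfolding green_op_def sum_distrib_left by (subst sum.swap) (simp add: mult_ac)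
  have "rate_op s q (green_op f) x = rate_op s q (green_op g) x"
    unfolding rate_op_def green_op_def using fg by simp
  also have "\<dots> = (\<Sum>m\<le>Suc x. c m * rate_op s q (green_op (phi m)) x)"
    unfolding G R ..
  also have "\<dots> = green_op (rate_op (s - 2) (q - s + 1) g) x - (s + b) * green_op g x + q * g 0"
    unfolding rate_op_green_op_phi GR G unfolding g_def
    by (simp add: sum_distrib_left sum_subtractf sum.distrib algebra_simps del: sum.atMost_Suc)
  also have "green_op (rate_op (s - 2) (q - s + 1) g) x = green_op (rate_op (s - 2) (q - s + 1) f) x"
    unfolding green_op_def rate_op_def using fg by (intro sum.cong) auto
  also have "green_op g x = green_op f x" unfolding green_op_def using fg by (intro sum.cong) auto
  finally show ?thesis using fg by simp
qed

end

section \<open>Jacobi polynomials\<close>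

lemma polys_of_each_degree_span:
  fixes q :: "nat \<Rightarrow> real poly"
  assumes "\<And>k. degree (q k) = k" "\<And>k. q k \<noteq> 0" "\<And>i. n \<le> i \<Longrightarrow> coeff f i = 0"
  shows "\<exists>c. f = (\<Sum>k<n. Polynomial.smult (c k) (q k))"
  using assms(3)
proof (induction n arbitrary: f)
  case 0
  then show ?case by (simp add: poly_eq_iff)
next
  case (Suc n)
  have lc: "coeff (q n) n \<noteq> 0" using assms(1,2)[of n] leading_coeff_0_iff[of "q n"] by simp
  define d where "d = coeff f n / coeff (q n) n"
  have "coeff (f - Polynomial.smult d (q n)) i = 0" if "n \<le> i" for i
    using that Suc.prems[of i] assms(1)[of n] lc
    by (cases "i = n") (auto simp: d_def coeff_eq_0)
  then obtain c where c: "f - Polynomial.smult d (q n) = (\<Sum>k<n. Polynomial.smult (c k) (q k))" using Suc.IH by blast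
  have "f = (\<Sum>k<n. Polynomial.smult (c k) (q k)) + Polynomial.smult d (q n)" using c by (simp add: algebra_simps)
  then have "f = (\<Sum>k<Suc n. Polynomial.smult ((c(n := d)) k) (q k))" by simp
  then show ?case by blast
qed

context jacobi_parameters
begin

definition Theta :: "nat \<Rightarrow> real" where
  "Theta m = (\<Prod>r<m. theta (Suc r))"

definition half_arg :: "real poly" where
  "half_arg = [:- 1 / 2, 1 / 2:]"

text \<open>The hypergeometric form 2F1(-l, l + a + b + 1; a + 1; (1 - t) / 2) of the Jacobi
  polynomials, normalized to 1 at t = 1; the signs of the Pochhammer symbols are absorbed by
  \<open>phi\<close> and by t - 1.\<close>

definition jac :: "nat \<Rightarrow> real poly" where
  "jac l = (\<Sum>m\<le>l. Polynomial.smult (phi m l / Theta m) (half_arg ^ m))"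

lemma Theta_pos: "0 < Theta m"
  unfolding Theta_def using theta_pos by (intro prod_pos) auto

lemma Theta_Suc: "Theta (Suc m) = Theta m * theta (Suc m)"
  by (simp add: Theta_def)

lemma poly_half_arg: "poly half_arg t = (t - 1) / 2"
  by (simp add: half_arg_def field_simps)

lemma jac_eq:
  assumes "l \<le> M"
  shows "jac l = (\<Sum>m\<le>M. Polynomial.smult (phi m l / Theta m) (half_arg ^ m))"
  unfolding jac_def using assms by (intro sum.mono_neutral_left) (auto simp: phi_eq_0)

lemma poly_jac:
  assumes "l \<le> M"
  shows "poly (jac l) t = (\<Sum>m\<le>M. phi m l / Theta m * ((t - 1) / 2) ^ m)"
  by (simp add: jac_eq[OF assms] poly_sum poly_half_arg)

lemma poly_jac_1 [simp]: "poly (jac l) 1 = 1"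
proof -
  have "poly (jac l) 1 = (\<Sum>m\<le>l. if m = 0 then 1 else 0)"
    unfolding poly_jac[OF order.refl] by (intro sum.cong) (auto simp: Theta_def)
  then show ?thesis by simp
qed

lemma degree_half_arg_power: "degree (half_arg ^ m) = m"
  by (simp add: degree_power_eq half_arg_def)

lemma coeff_jac_top: "coeff (jac l) l \<noteq> 0"
proof -
  have "coeff (jac l) l = (\<Sum>m\<le>l. if m = l then phi l l / Theta l * coeff (half_arg ^ l) l else 0)"
    unfolding jac_def coeff_sum by (intro sum.cong) (auto simp: coeff_eq_0 degree_half_arg_power)
  also have "\<dots> = phi l l / Theta l * lead_coeff (half_arg ^ l)" by (simp add: degree_half_arg_power)
  also have "\<dots> \<noteq> 0"
    using phi_pos[of l l] Theta_pos[of l] by (simp add: half_arg_def)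
  finally show ?thesis .
qed

lemma degree_jac: "degree (jac l) = l"
proof (rule antisym)
  show "degree (jac l) \<le> l"
    unfolding jac_def by (intro degree_sum_le) (auto simp: degree_half_arg_power intro: order.trans[OF degree_smult_le])
  show "l \<le> degree (jac l)" by (rule le_degree) (rule coeff_jac_top)
qed

lemma jac_nonzero: "jac l \<noteq> 0"
  using coeff_jac_top[of l] by auto

text \<open>In l the polynomial is a combination of the \<open>phi m\<close>; lowering each of them
  cancels one factor of \<open>Theta\<close> and shifts the power of (t - 1) / 2 by one.\<close>

lemma bd_op_jac: "bd_op (\<lambda>l. poly (jac l) t) x = (t - 1) / 2 * poly (jac x) t"
proof -
  let ?c = "\<lambda>m. ((t - 1) / 2) ^ m / Theta m"
  have J: "poly (jac y) t = (\<Sum>m\<le>Suc x. ?c m * phi m y)" if "y \<le> Suc x" for y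
    using poly_jac[OF that, of t] by (simp add: mult_ac del: sum.atMost_Suc)
  have "bd_op (\<lambda>l. poly (jac l) t) x = (\<Sum>m\<le>Suc x. ?c m * bd_op (phi m) x)"
    unfolding bd_op_def
    by (simp add: J sum_subtractf[symmetric] sum.distrib[symmetric] sum_distrib_left del: sum.atMost_Suc)
       (intro sum.cong refl, simp add: algebra_simps add_divide_distrib diff_divide_distrib)
  also have "\<dots> = (\<Sum>m\<le>x. ?c (Suc m) * bd_op (phi (Suc m)) x)"
    by (subst sum.atMost_Suc_shift) simp
  also have "\<dots> = (\<Sum>m\<le>x. (t - 1) / 2 * (phi m x / Theta m * ((t - 1) / 2) ^ m))"
    by (intro sum.cong refl) (use theta_pos in \<open>simp add: bd_op_phi Theta_Suc less_imp_neq[symmetric]\<close>)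
  also have "\<dots> = (t - 1) / 2 * poly (jac x) t"
    by (simp only: poly_jac[OF order.refl, of x] sum_distrib_left)
  finally show ?thesis .
qed

text \<open>The Green operator inverts the recurrence \<open>bd_op_jac\<close>. This is what turns
  subtraction of a column evaluated at 1 into an application of \<open>green_op\<close>.\<close>

lemma jac_minus_1: "poly (jac l) t - 1 = (t - 1) / 2 * green_op (\<lambda>m. poly (jac m) t) l"
proof -
  have "poly (jac l) t - poly (jac 0) t = green_op (bd_op (\<lambda>m. poly (jac m) t)) l"
    by (simp add: green_op_bd_op)
  also have "bd_op (\<lambda>m. poly (jac m) t) = (\<lambda>x. (t - 1) / 2 * poly (jac x) t)"
    by (rule ext) (rule bd_op_jac)
  finally show ?thesis
    unfolding green_op_scale by (simp add: jac_def Theta_def)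
qed

section \<open>The Jacobi differential operator and its eigenpolynomials\<close>

definition jacobi_diff :: "real poly \<Rightarrow> real poly" where
  "jacobi_diff f = [:1, 0, - 1:] * pderiv (pderiv f) + [:b - a, - (a + b + 2):] * pderiv f"

lemma pderiv_half_arg_power: "pderiv (half_arg ^ Suc m) = Polynomial.smult ((real m + 1) / 2) (half_arg ^ m)"
  unfolding pderiv_power_Suc by (simp add: half_arg_def pderiv_pCons add.commute)

lemma pderiv_sum: "pderiv (sum f A) = (\<Sum>x\<in>A. pderiv (f x))"
  by (induction A rule: infinite_finite_induct) (simp_all add: pderiv_add)

lemma jacobi_diff_half_arg_power:
  "jacobi_diff (half_arg ^ Suc m)
     = - Polynomial.smult (theta (Suc m)) (half_arg ^ m) - Polynomial.smult (xi (Suc m)) (half_arg ^ Suc m)"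
proof -
  have 1: "[:1, 0, - 1:] = Polynomial.smult (- 4) half_arg + Polynomial.smult (- 4) (half_arg * half_arg)"
    by (simp add: half_arg_def)
  have 2: "[:b - a, - (a + b + 2):] = [:- 2 * (a + 1):] + Polynomial.smult (- 2 * (a + b + 2)) half_arg"
    by (simp add: half_arg_def field_simps)
  have e2: "e = (a + b + 1) / 2" by (simp add: eps_def)
  show ?thesis
  proof (rule poly_eq_poly_eq_iff[THEN iffD1], rule ext)
    fix t
    define s where "s = poly half_arg t"
    show "poly (jacobi_diff (half_arg ^ Suc m)) t
      = poly (- Polynomial.smult (theta (Suc m)) (half_arg ^ m) - Polynomial.smult (xi (Suc m)) (half_arg ^ Suc m)) t"
    proof (cases m)
      case 0
      show ?thesis
        unfolding jacobi_diff_def 1 2 pderiv_half_arg_power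
        by (simp add: 0 pderiv_half_arg_power theta_def xi_def e2 s_def[symmetric] field_simps)
    next
      case (Suc n)
      show ?thesis
        unfolding jacobi_diff_def 1 2 pderiv_half_arg_power pderiv_smult
        unfolding Suc pderiv_half_arg_power
        by (simp add: theta_def xi_def e2 s_def[symmetric] field_simps)
    qed
  qed
qed

lemma jacobi_diff_sum: "jacobi_diff (\<Sum>i\<in>A. Polynomial.smult (c i) (f i)) = (\<Sum>i\<in>A. Polynomial.smult (c i) (jacobi_diff (f i)))"
  unfolding jacobi_diff_def
  by (simp add: pderiv_sum pderiv_smult sum_distrib_left sum.distrib[symmetric] smult_add_right)

lemma jacobi_diff_jac: "jacobi_diff (jac k) = Polynomial.smult (- xi k) (jac k)"
proof (rule poly_eq_poly_eq_iff[THEN iffD1], rule ext)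
  fix t :: real
  define s where "s = (t - 1) / 2"
  define c where "c = (\<lambda>m. phi m k / Theta m)"
  have c: "c m * xi k = theta (Suc m) * c (Suc m) + xi m * c m" for m
    using xi_phi[of k m] theta_pos[of m] Theta_pos[of m]
    by (simp add: c_def Theta_Suc field_simps)
  \<comment> \<open>For m = 0 the truncated exponent \<open>m - 1\<close> is harmless because
    \<open>theta 0 = 0\<close>.\<close>
  have jd: "poly (jacobi_diff (half_arg ^ m)) t = - (theta m * s ^ (m - 1)) - xi m * s ^ m" for m
  proof (cases m)
    case 0
    then show ?thesis by (simp add: jacobi_diff_def theta_def xi_def)
  next
    case (Suc n)
    then show ?thesis
      by (simp only: jacobi_diff_half_arg_power) (simp add: poly_half_arg s_def)
  qed
  have "poly (jacobi_diff (jac k)) t = (\<Sum>m\<le>Suc k. c m * (- (theta m * s ^ (m - 1)) - xi m * s ^ m))"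
    unfolding jac_eq[OF le_SucI[OF order.refl], of k] jacobi_diff_sum poly_sum poly_smult jd c_def ..
  also have "\<dots> = - (\<Sum>m\<le>Suc k. c m * theta m * s ^ (m - 1)) - (\<Sum>m\<le>Suc k. xi m * c m * s ^ m)"
    unfolding sum_negf[symmetric] sum_subtractf[symmetric] by (intro sum.cong) (auto simp: algebra_simps)
  also have "(\<Sum>m\<le>Suc k. c m * theta m * s ^ (m - 1)) = (\<Sum>m\<le>k. theta (Suc m) * c (Suc m) * s ^ m)"
    by (subst sum.atMost_Suc_shift) (simp add: theta_def[of 0] mult_ac)
  also have "(\<Sum>m\<le>Suc k. xi m * c m * s ^ m) = (\<Sum>m\<le>k. xi m * c m * s ^ m)"
    by (simp add: c_def phi_eq_0)
  also have "- (\<Sum>m\<le>k. theta (Suc m) * c (Suc m) * s ^ m) - (\<Sum>m\<le>k. xi m * c m * s ^ m)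
     = - (\<Sum>m\<le>k. (c m * xi k) * s ^ m)"
    by (simp add: c sum.distrib distrib_right)
  also have "\<dots> = poly (Polynomial.smult (- xi k) (jac k)) t"
    by (simp add: poly_jac[OF order.refl] c_def s_def sum_distrib_left mult_ac)
  finally show "poly (jacobi_diff (jac k)) t = poly (Polynomial.smult (- xi k) (jac k)) t" .
qed

section \<open>Integration against the Jacobi weight and orthogonality\<close>

definition weight :: "real \<Rightarrow> real" where
  "weight t = (1 - t) powr a * (1 + t) powr b"

definition wint :: "real poly \<Rightarrow> real" where
  "wint f = (LINT x:{-1..1}|lborel. poly f x * weight x)"

lemma weight_nonneg: "0 \<le> weight t" by (simp add: weight_def)

lemma weight_measurable [measurable]: "weight \<in> borel_measurable borel"
  unfolding weight_def[abs_def] by measurable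

lemma poly_measurable [measurable]: "poly (f :: real poly) \<in> borel_measurable borel"
  by (intro borel_measurable_continuous_onI continuous_intros)

text \<open>The affine change of variable to [0, 1] turns the weight into a constant times the
  integrand of a Beta function with positive parameters a + 1 and b + 1.\<close>

lemma weight_integrable: "set_integrable lborel {-1..1} weight"
proof -
  have pos: "0 < a + 1" "0 < b + 1" using b_le_a b_ge by auto
  have "((\<lambda>t. t powr (b + 1 - 1) * (1 - t) powr (a + 1 - 1)) has_integral Beta (b + 1) (a + 1)) {0..1}"
    using pos by (intro has_integral_Beta_real)
  then have "((\<lambda>t. t powr b * (1 - t) powr a) has_integral Beta (b + 1) (a + 1)) (cbox 0 1)"
    by simp
  from has_integral_affinity[OF this, of "1 / 2" "1 / 2"]
  have "(\<lambda>t. ((t + 1) / 2) powr b * ((1 - t) / 2) powr a) integrable_on ((\<lambda>x. 2 * x - 1) ` {0..1})"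
    by (auto simp: integrable_on_def field_simps)
  moreover have "(\<lambda>x. 2 * x - 1) ` {0..1} = {-1..1::real}"
  proof (intro equalityI subsetI)
    fix y :: real assume "y \<in> {-1..1}"
    then show "y \<in> (\<lambda>x. 2 * x - 1) ` {0..1}" by (intro image_eqI[of _ _ "(y + 1) / 2"]) (auto simp: field_simps)
  qed auto
  ultimately have "(\<lambda>t. ((t + 1) / 2) powr b * ((1 - t) / 2) powr a) integrable_on {-1..1}" by simp
  then have "(\<lambda>t. 2 powr (a + b) * (((t + 1) / 2) powr b * ((1 - t) / 2) powr a)) integrable_on {-1..1}"
    using integrable_cmul[of _ _ "2 powr (a + b)"] by fastforce
  then have "weight integrable_on {-1..1}"
    by (rule integrable_eq)
       (auto simp: weight_def powr_divide powr_add add.commute)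
  then have "weight absolutely_integrable_on {-1..1}"
    by (intro nonnegative_absolutely_integrable_1 weight_nonneg)
  then show ?thesis
    unfolding set_integrable_def by (subst (asm) integrable_completion) auto
qed

lemma wint_integrable: "set_integrable lborel {-1..1} (\<lambda>x. poly f x * weight x)"
proof -
  have "bounded (poly f ` {-1..1})"
    by (intro compact_imp_bounded compact_continuous_image continuous_intros) auto
  then obtain B where "\<forall>y\<in>poly f ` {-1..1}. norm y \<le> B" unfolding bounded_iff by blast
  then have B: "\<bar>poly f x\<bar> \<le> B" if "x \<in> {-1..1}" for x using that by force
  have "set_integrable lborel {-1..1} (\<lambda>x. B * weight x)"
    by (intro set_integrable_mult_right weight_integrable)
  then show ?thesis
  proof (rule set_integrable_bound)
    show "set_borel_measurable lborel {-1..1} (\<lambda>x. poly f x * weight x)"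
      unfolding set_borel_measurable_def by measurable
    show "AE x in lborel. x \<in> {-1..1} \<longrightarrow> norm (poly f x * weight x) \<le> norm (B * weight x)"
    proof (intro AE_I2 impI)
      fix x :: real assume "x \<in> {-1..1}"
      then have "\<bar>poly f x\<bar> \<le> \<bar>B\<bar>" using B by force
      then show "norm (poly f x * weight x) \<le> norm (B * weight x)"
        by (simp add: abs_mult mult_right_mono)
    qed
  qed
qed

lemma wint_add: "wint (f + g) = wint f + wint g"
  unfolding wint_def by (simp add: distrib_right set_integral_add wint_integrable)

lemma wint_smult: "wint (Polynomial.smult c f) = c * wint f"
  unfolding wint_def by (simp add: mult.assoc)

lemma wint_0 [simp]: "wint 0 = 0"
  by (simp add: wint_def set_lebesgue_integral_def)

lemma wint_uminus: "wint (- f) = - wint f"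
  using wint_smult[of "- 1" f] by simp

lemma wint_diff: "wint (f - g) = wint f - wint g"
  using wint_add[of f "- g"] by (simp add: wint_uminus)

lemma wint_sum: "wint (\<Sum>i\<in>A. f i) = (\<Sum>i\<in>A. wint (f i))"
  by (induction A rule: infinite_finite_induct) (simp_all add: wint_add)

text \<open>The integrand is the derivative of \<open>F\<close>, which vanishes at both endpoints
  because a + 1 and b + 1 are positive; differentiability is asked in the open interval only, where
  the powers are smooth.\<close>

lemma wint_exact: "wint ([:1, 0, - 1:] * pderiv h + [:b - a, - (a + b + 2):] * h) = 0"
proof -
  define F where "F = (\<lambda>t. (1 - t) powr (a + 1) * (1 + t) powr (b + 1) * poly h t)"
  let ?g = "[:1, 0, - 1:] * pderiv h + [:b - a, - (a + b + 2):] * h"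
  have pos: "0 < a + 1" "0 < b + 1" using b_le_a b_ge by auto
  have "((\<lambda>t. poly ?g t * weight t) has_integral (F 1 - F (-1))) {-1..1}"
  proof (rule fundamental_theorem_of_calculus_interior)
    show "continuous_on {-1..1} F"
      unfolding F_def using pos by (intro continuous_intros continuous_on_powr') auto
    fix t :: real assume t: "t \<in> {-1<..<1}"
    have p: "(1 - t) powr (a + 1) = (1 - t) * (1 - t) powr a" "(1 + t) powr (b + 1) = (1 + t) * (1 + t) powr b"
      using t by (auto simp: powr_add)
    have "(F has_real_derivative
       (- ((a + 1) * (1 - t) powr a)) * ((1 + t) powr (b + 1) * poly h t)
       + (1 - t) powr (a + 1) * (((b + 1) * (1 + t) powr b) * poly h t + (1 + t) powr (b + 1) * poly (pderiv h) t)) (at t)"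
      unfolding F_def using t
      by (auto intro!: derivative_eq_intros simp: field_simps)
    moreover have "(- ((a + 1) * (1 - t) powr a)) * ((1 + t) powr (b + 1) * poly h t)
       + (1 - t) powr (a + 1) * (((b + 1) * (1 + t) powr b) * poly h t + (1 + t) powr (b + 1) * poly (pderiv h) t)
       = poly ?g t * weight t"
      unfolding p weight_def by (simp add: algebra_simps)
    ultimately show "(F has_vector_derivative poly ?g t * weight t) (at t)"
      by (simp add: has_real_derivative_iff_has_vector_derivative)
  qed simp
  then have "integral {-1..1} (\<lambda>t. poly ?g t * weight t) = 0"
    using pos by (simp add: F_def integral_unique)
  then show ?thesis
    unfolding wint_def using set_borel_integral_eq_integral(2)[OF wint_integrable[of ?g]] by simp
qed

text \<open>Integration by parts: both sides equal minus the weighted integral of (1 - t^2) f' g',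
  which is symmetric.\<close>

lemma wint_jacobi_diff: "wint (jacobi_diff f * g) = wint (f * jacobi_diff g)"
proof -
  have "wint (jacobi_diff f * g) = - wint ([:1, 0, - 1:] * pderiv f * pderiv g)" for f g
  proof -
    have "jacobi_diff f * g + [:1, 0, - 1:] * pderiv f * pderiv g
       = [:1, 0, - 1:] * pderiv (pderiv f * g) + [:b - a, - (a + b + 2):] * (pderiv f * g)"
      unfolding jacobi_diff_def pderiv_mult by (simp only: distrib_left distrib_right mult_ac add_ac)
    then have "wint (jacobi_diff f * g + [:1, 0, - 1:] * pderiv f * pderiv g) = 0"
      by (simp only: wint_exact)
    then show ?thesis by (simp only: wint_add)
  qed
  from this[of f g] this[of g f] show ?thesis by (simp only: mult_ac)
qed

lemma jac_orthogonal:
  assumes "j \<noteq> k"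
  shows "wint (jac j * jac k) = 0"
proof -
  have "- xi j * wint (jac j * jac k) = - xi k * wint (jac j * jac k)"
    using wint_jacobi_diff[of "jac j" "jac k"] unfolding jacobi_diff_jac
    by (simp add: wint_smult wint_uminus)
  moreover have "xi j \<noteq> xi k"
  proof -
    have "xi k - xi j = (real k - real j) * (real k + real j + 2 * e)"
      by (simp add: xi_def algebra_simps)
    moreover have "0 < real k + real j + 2 * e" using assms eps_nonneg by linarith
    ultimately show ?thesis using assms by auto
  qed
  ultimately show ?thesis by simp
qed

text \<open>The weight is positive on the open interval and a nonzero polynomial has finitely many
  roots, so otherwise (-1, 1) would be a null set.\<close>

lemma wint_square_eq_0:
  assumes "wint (r * r) = 0"
  shows "r = 0"
proof (rule ccontr)
  assume r: "r \<noteq> 0"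
  let ?f = "\<lambda>x. indicator {-1..1} x *\<^sub>R (poly (r * r) x * weight x)"
  have "integrable lborel ?f" using wint_integrable[of "r * r"] by (simp add: set_integrable_def)
  moreover have "0 \<le> ?f x" for x using weight_nonneg[of x] by (auto simp: indicator_def)
  ultimately have "AE x in lborel. ?f x = 0"
    using assms unfolding wint_def set_lebesgue_integral_def by (subst (asm) integral_nonneg_eq_0_iff_AE) auto
  then have "AE x in lborel. x \<notin> {-1<..<1} - {x. poly r x = 0}"
    by eventually_elim (auto simp: weight_def indicator_def)
  then have "{-1<..<1} - {x. poly r x = 0} \<in> null_sets lborel"
    by (subst (asm) AE_iff_null_sets[symmetric]) auto
  moreover have "{x. poly r x = 0} \<in> null_sets lborel"
    using poly_roots_finite[OF r] by (intro finite_imp_null_set_lborel)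
  ultimately have "({-1<..<1} - {x. poly r x = 0}) \<union> {x. poly r x = 0} \<in> null_sets lborel"
    by (rule null_sets.Un)
  then have "{-1<..<1::real} \<in> null_sets lborel" by (rule null_sets_subset) auto
  then show False by auto
qed

text \<open>After matching leading coefficients the remainder \<open>r\<close> has degree below k.
  It is spanned by the lower \<open>p j\<close> and also by the lower \<open>jac j\<close>, so it is
  orthogonal to both \<open>p k\<close> and \<open>jac k\<close>, hence to itself.\<close>

lemma jacobi_polynomials_eq:
  assumes p: "jacobi_polynomials a b p"
  shows "\<exists>c. c \<noteq> 0 \<and> p k = Polynomial.smult c (jac k)"
proof -
  have deg: "degree (p k) = k" "p k \<noteq> 0" for k using p by (auto simp: jacobi_polynomials_def)
  have "wint (p j * p k) = 0" if "j \<noteq> k" for j k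
    using p that by (auto simp: jacobi_polynomials_def wint_def weight_def)
  define c where "c = coeff (p k) k / coeff (jac k) k"
  define r where "r = p k - Polynomial.smult c (jac k)"
  have r: "coeff r i = 0" if "k \<le> i" for i
    using that coeff_jac_top[of k] deg[of k] degree_jac[of k]
    by (cases "i = k") (auto simp: r_def c_def coeff_eq_0)
  obtain d where d: "r = (\<Sum>j<k. Polynomial.smult (d j) (p j))"
    using polys_of_each_degree_span[OF deg r] by blast
  obtain d' where d': "r = (\<Sum>j<k. Polynomial.smult (d' j) (jac j))"
    using polys_of_each_degree_span[OF degree_jac jac_nonzero r] by blast
  have "wint (p k * r) = 0"
    unfolding d using \<open>\<And>k j. j \<noteq> k \<Longrightarrow> wint (p j * p k) = 0\<close>
    by (simp add: sum_distrib_left wint_sum wint_smult)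
  moreover have "wint (jac k * r) = 0"
    unfolding d' by (simp add: sum_distrib_left wint_sum wint_smult jac_orthogonal)
  ultimately have "wint (r * r) = 0"
    by (simp add: r_def wint_diff wint_smult left_diff_distrib)
  then have "r = 0" by (rule wint_square_eq_0)
  then have "p k = Polynomial.smult c (jac k)" by (simp add: r_def)
  moreover from this have "c \<noteq> 0" using deg[of k] by auto
  ultimately show ?thesis by blast
qed

end

section \<open>Multivariate Jacobi polynomials and the branching kernel\<close>

lemma polyfun_sum: "(\<And>i. i \<in> A \<Longrightarrow> f i \<in> polyfun N) \<Longrightarrow> (\<lambda>x. \<Sum>i\<in>A. f i x) \<in> polyfun N"
  by (induction A rule: infinite_finite_induct) (auto intro: polyfun.intros)

lemma polyfun_power: "f \<in> polyfun N \<Longrightarrow> (\<lambda>x. f x ^ k) \<in> polyfun N"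
  by (induction k) (auto intro: polyfun.intros)

lemma polyfun_cmult: "f \<in> polyfun N \<Longrightarrow> (\<lambda>x. c * f x) \<in> polyfun N"
  by (intro polyfun_mult polyfun_const)

lemma polyfun_substitute_last:
  assumes "f \<in> polyfun (Suc N)"
  shows "(\<lambda>x. f (x(N := c))) \<in> polyfun N"
  using assms
proof induction
  case (polyfun_var i)
  then show ?case by (cases "i = N") (auto intro: polyfun.intros)
qed (auto intro: polyfun.intros)

lemma polyfun_continuous_line:
  assumes "f \<in> polyfun N"
  shows "continuous_on UNIV (\<lambda>t. f (\<lambda>i. x i + t * v i))"
  using assms by induction (auto intro!: continuous_intros)

text \<open>Generic points are dense: move along a line on which all coordinates separate.\<close>

lemma polyfun_eqI_generic:
  assumes f: "f \<in> polyfun N" and g: "g \<in> polyfun N"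
    and eq: "\<And>x. inj_on x {..<N} \<Longrightarrow> (\<And>i. i < N \<Longrightarrow> x i \<noteq> 1) \<Longrightarrow> f x = g x"
  shows "f = g"
proof
  fix x
  \<comment> \<open>The speeds \<open>real i + 1\<close> are pairwise distinct and nonzero, so the
    coordinates separate from each other and from the value 1.\<close>
  define y where "y = (\<lambda>t i. x i + t * (real i + 1))"
  have root: "\<forall>\<^sub>F t in at 0. c + t * d \<noteq> 0" if "d \<noteq> 0" for c d :: real
  proof -
    have "\<forall>\<^sub>F t in at 0. t \<noteq> - c / d" by (rule eventually_neq_at_within)
    then show ?thesis
      by eventually_elim (use that in \<open>auto simp: field_simps add_eq_0_iff\<close>)
  qed
  have "\<forall>\<^sub>F t in at 0. \<forall>i\<in>{..<N}. \<forall>j\<in>{..<N}. i \<noteq> j \<longrightarrow> y t i \<noteq> y t j"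
  proof (intro eventually_ball_finite ballI)
    fix i j :: nat
    show "\<forall>\<^sub>F t in at 0. i \<noteq> j \<longrightarrow> y t i \<noteq> y t j"
    proof (cases "i = j")
      case False
      then have "\<forall>\<^sub>F t in at 0. (x i - x j) + t * (real i - real j) \<noteq> 0" by (intro root) simp
      then show ?thesis by eventually_elim (auto simp: y_def algebra_simps)
    qed simp
  qed auto
  moreover have "\<forall>\<^sub>F t in at 0. \<forall>i\<in>{..<N}. y t i \<noteq> 1"
  proof (intro eventually_ball_finite ballI)
    fix i :: nat
    have "\<forall>\<^sub>F t in at 0. (x i - 1) + t * (real i + 1) \<noteq> 0" by (intro root) linarith
    then show "\<forall>\<^sub>F t in at 0. y t i \<noteq> 1" by eventually_elim (auto simp: y_def)
  qed auto
  ultimately have ev: "\<forall>\<^sub>F t in at 0. f (y t) = g (y t)"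
    by eventually_elim (auto intro!: eq inj_onI)
  have lim: "((\<lambda>t. h (y t)) \<longlongrightarrow> h x) (at 0)" if "h \<in> polyfun N" for h
  proof -
    have "isCont (\<lambda>t. h (y t)) 0"
      using polyfun_continuous_line[OF that] unfolding y_def by (simp add: continuous_on_eq_continuous_at)
    then show ?thesis by (simp add: isCont_def y_def)
  qed
  from lim[OF f] ev have "((\<lambda>t. g (y t)) \<longlongrightarrow> f x) (at 0)"
    by (rule Lim_transform_eventually)
  then show "f x = g x" using lim[OF g] by (rule LIM_unique)
qed

section \<open>Divisibility of alternating determinants by the Vandermonde product\<close>

lemma vandermonde_nonzero: "inj_on x {..<N} \<Longrightarrow> vandermonde N x \<noteq> 0"
  by (auto simp: vandermonde_def dest: inj_onD)

lemma vandermonde_cong: "(\<And>i. i < N \<Longrightarrow> x i = y i) \<Longrightarrow> vandermonde N x = vandermonde N y"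
  unfolding vandermonde_def by (intro prod.cong refl) auto

text \<open>Subtracting the last column makes the entries of column j divisible by
  \<open>x j - x n\<close>, and Laplace expansion along the last column leaves smaller determinants
  of the same shape. The divided differences carry powers of \<open>x n\<close>, which is why the
  coefficients are polynomials in all M variables.\<close>

lemma ndet_divisible:
  assumes "n \<le> M" "\<And>i k. c i k \<in> polyfun M"
  shows "\<exists>F\<in>polyfun M. \<forall>x. F x * vandermonde n x = ndet n (\<lambda>i j. \<Sum>k<K. c i k x * x j ^ k)"
  using assms
proof (induction n arbitrary: c)
  case 0
  show ?case by (intro bexI[of _ "\<lambda>x. 1"]) (auto simp: vandermonde_def ndet_leibniz intro: polyfun.intros)
next
  case (Suc n)
  define c' where "c' = (\<lambda>i r x. \<Sum>k\<in>{r<..<K}. c i k x * x n ^ (k - Suc r))"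
  have c': "c' i r \<in> polyfun M" for i r
    unfolding c'_def using Suc.prems by (intro polyfun_sum polyfun_mult polyfun_power polyfun_var) auto
  have diff: "(\<Sum>k<K. c i k x * s ^ k) - (\<Sum>k<K. c i k x * x n ^ k) = (s - x n) * (\<Sum>r<K. c' i r x * s ^ r)" for i x s
  proof -
    have "(\<Sum>k<K. c i k x * s ^ k) - (\<Sum>k<K. c i k x * x n ^ k)
        = (\<Sum>k<K. c i k x * (s ^ k - x n ^ k))"
      by (simp add: sum_subtractf right_diff_distrib)
    also have "\<dots> = (\<Sum>k<K. \<Sum>r<K. if r < k then (s - x n) * (c i k x * x n ^ (k - Suc r) * s ^ r) else 0)"
    proof (rule sum.cong[OF refl])
      fix k assume k: "k \<in> {..<K}"
      have "c i k x * (s ^ k - x n ^ k) = (\<Sum>r<k. (s - x n) * (c i k x * x n ^ (k - Suc r) * s ^ r))"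
        by (subst power_diff_sumr2) (simp add: sum_distrib_left mult_ac)
      also have "\<dots> = (\<Sum>r<K. if r < k then (s - x n) * (c i k x * x n ^ (k - Suc r) * s ^ r) else 0)"
        using k by (intro sum.mono_neutral_cong_left) auto
      finally show "c i k x * (s ^ k - x n ^ k)
         = (\<Sum>r<K. if r < k then (s - x n) * (c i k x * x n ^ (k - Suc r) * s ^ r) else 0)" .
    qed
    also have "\<dots> = (\<Sum>r<K. \<Sum>k<K. if r < k then (s - x n) * (c i k x * x n ^ (k - Suc r) * s ^ r) else 0)"
      by (rule sum.swap)
    also have "\<dots> = (\<Sum>r<K. \<Sum>k\<in>{r<..<K}. (s - x n) * (c i k x * x n ^ (k - Suc r) * s ^ r))"
      by (intro sum.cong refl sum.mono_neutral_cong_right) auto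
    also have "\<dots> = (s - x n) * (\<Sum>r<K. c' i r x * s ^ r)"
      by (simp add: c'_def sum_distrib_left sum_distrib_right mult_ac)
    finally show ?thesis .
  qed
  have "\<exists>F\<in>polyfun M. \<forall>x. F x * vandermonde n x
      = ndet n (\<lambda>i j. \<Sum>r<K. c' (if i < k then i else Suc i) r x * x j ^ r)" for k
    using Suc.prems c' by (intro Suc.IH) auto
  then obtain F where F: "\<And>k. F k \<in> polyfun M"
    "\<And>k x. F k x * vandermonde n x = ndet n (\<lambda>i j. \<Sum>r<K. c' (if i < k then i else Suc i) r x * x j ^ r)"
    by metis
  define G where "G = (\<lambda>x. \<Sum>k<Suc n. (\<Sum>l<K. c k l x * x n ^ l) * ((- 1) ^ (k + n) * F k x))"
  have "G \<in> polyfun M"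
    unfolding G_def using Suc.prems F(1)
    by (intro polyfun_sum polyfun_mult polyfun_power polyfun_var polyfun_const) auto
  moreover have "G x * vandermonde (Suc n) x = ndet (Suc n) (\<lambda>i j. \<Sum>k<K. c i k x * x j ^ k)" for x
  proof -
    let ?A = "\<lambda>i j. \<Sum>k<K. c i k x * x j ^ k"
    have "ndet (Suc n) ?A = ndet (Suc n) (\<lambda>i j. if j < n then ?A i j + (- 1) * ?A i n else ?A i n)"
      by (rule ndet_add_last_col[symmetric])
    also have "\<dots> = ndet (Suc n) (\<lambda>i j. (if j < n then x j - x n else 1) *
        (if j < n then \<Sum>r<K. c' i r x * x j ^ r else ?A i n))"
      by (intro ndet_cong) (use diff in simp)
    also have "\<dots> = (\<Prod>j<n. x j - x n) * ndet (Suc n) (\<lambda>i j. if j < n then \<Sum>r<K. c' i r x * x j ^ r else ?A i n)"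
      unfolding ndet_scale_cols by simp
    also have "ndet (Suc n) (\<lambda>i j. if j < n then \<Sum>r<K. c' i r x * x j ^ r else ?A i n)
       = (\<Sum>k<Suc n. ?A k n * ((- 1) ^ (k + n) * ndet n (\<lambda>i j. \<Sum>r<K. c' (if i < k then i else Suc i) r x * x j ^ r)))"
      unfolding ndet_laplace_last_col
      by (intro sum.cong refl arg_cong2[where f = "(*)"] ndet_cong) auto
    also have "\<dots> = G x * vandermonde n x"
      unfolding F(2)[symmetric] G_def sum_distrib_right by (intro sum.cong refl) (simp add: mult_ac)
    finally show ?thesis by (simp add: vandermonde_Suc mult_ac)
  qed
  ultimately show ?case by blast
qed

lemma ndet_poly_divisible:
  "\<exists>F\<in>polyfun n. \<forall>x. F x * vandermonde n x = ndet n (\<lambda>i j. poly (f i) (x j))"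
proof -
  define K where "K = Suc (\<Sum>i<n. degree (f i))"
  have "poly (f i) t = (\<Sum>k<K. coeff (f i) k * t ^ k)" if "i < n" for i t
  proof -
    have "degree (f i) \<le> (\<Sum>i<n. degree (f i))" using that by (intro member_le_sum) auto
    then show ?thesis
      unfolding poly_altdef K_def lessThan_Suc_atMost
      by (intro sum.mono_neutral_left) (auto simp: coeff_eq_0)
  qed
  then have "ndet n (\<lambda>i j. poly (f i) (x j)) = ndet n (\<lambda>i j. \<Sum>k<K. coeff (f i) k * x j ^ k)" for x
    by (intro ndet_cong) auto
  then show ?thesis
    using ndet_divisible[of n n "\<lambda>i k x. coeff (f i) k" K] by (auto intro: polyfun.intros)
qed

lemma Jacobi_multi_eqI:
  assumes "F \<in> polyfun N" "\<And>x. F x * vandermonde N x = ndet N (\<lambda>i j. poly (q (shifted N lam i)) (x j))"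
  shows "Jacobi_multi q N lam = F"
  unfolding Jacobi_multi_def ndet_def[symmetric]
proof (rule the_equality)
  fix G assume G: "G \<in> polyfun N \<and> (\<forall>x. G x * vandermonde N x = ndet N (\<lambda>i j. poly (q (shifted N lam i)) (x j)))"
  show "G = F"
  proof (rule polyfun_eqI_generic)
    fix x :: "nat \<Rightarrow> real" assume "inj_on x {..<N}"
    then have "vandermonde N x \<noteq> 0" by (rule vandermonde_nonzero)
    moreover have "G x * vandermonde N x = F x * vandermonde N x" using G assms(2) by simp
    ultimately show "G x = F x" by simp
  qed (use G assms in auto)
qed (use assms in auto)

lemma Jacobi_multi:
  "Jacobi_multi q N lam \<in> polyfun N"
  "Jacobi_multi q N lam x * vandermonde N x = ndet N (\<lambda>i j. poly (q (shifted N lam i)) (x j))"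
proof -
  obtain F where F: "F \<in> polyfun N" "\<And>x. F x * vandermonde N x = ndet N (\<lambda>i j. poly (q (shifted N lam i)) (x j))"
    using ndet_poly_divisible[of N "\<lambda>i. q (shifted N lam i)"] by auto
  then have "Jacobi_multi q N lam = F" by (rule Jacobi_multi_eqI)
  then show "Jacobi_multi q N lam \<in> polyfun N"
    "Jacobi_multi q N lam x * vandermonde N x = ndet N (\<lambda>i j. poly (q (shifted N lam i)) (x j))"
    using F by auto
qed

lemma Jacobi_norm_rescale:
  assumes "\<And>k. c k \<noteq> 0" "\<And>k. p k = Polynomial.smult (c k) (q k)"
  shows "Jacobi_norm p N = Jacobi_norm q N"
proof (intro ext)
  fix lam x
  let ?c = "\<Prod>i<N. c (shifted N lam i)"
  have "Jacobi_multi p N lam = (\<lambda>x. ?c * Jacobi_multi q N lam x)"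
  proof (rule Jacobi_multi_eqI)
    fix x
    have "ndet N (\<lambda>i j. poly (p (shifted N lam i)) (x j))
       = ndet N (\<lambda>i j. c (shifted N lam i) * poly (q (shifted N lam i)) (x j))"
      by (simp add: assms(2))
    then show "?c * Jacobi_multi q N lam x * vandermonde N x = ndet N (\<lambda>i j. poly (p (shifted N lam i)) (x j))"
      by (simp add: ndet_scale_rows mult.assoc Jacobi_multi(2))
  qed (intro polyfun_cmult Jacobi_multi)
  then show "Jacobi_norm p N lam x = Jacobi_norm q N lam x"
    using assms(1) by (simp add: Jacobi_norm_def)
qed

lemma lagrange_interpolation:
  "\<exists>l. \<forall>f::real poly. degree f < M \<longrightarrow> f = (\<Sum>r<M. Polynomial.smult (poly f (real r)) (l r))"
proof (intro exI allI impI)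
  define l where "l = (\<lambda>r. Polynomial.smult (inverse (\<Prod>s\<in>{..<M} - {r}. real r - real s)) (\<Prod>s\<in>{..<M} - {r}. [:- real s, 1:]))"
  fix f :: "real poly" assume f: "degree f < M"
  have l: "poly (l r) (real s) = of_bool (r = s)" if "r < M" "s < M" for r s
    using that by (auto simp: l_def poly_prod)
  have dl: "degree (l r) < M" if "r < M" for r
  proof -
    have "degree (l r) \<le> degree (\<Prod>s\<in>{..<M} - {r}. [:- real s, 1:])" unfolding l_def by (rule degree_smult_le)
    also have "\<dots> = (\<Sum>s\<in>{..<M} - {r}. degree [:- real s, 1:])" by (rule degree_prod_eq_sum_degree) simp
    also have "\<dots> = M - 1" using that by simp
    finally show ?thesis using that by linarith
  qed
  show "f = (\<Sum>r<M. Polynomial.smult (poly f (real r)) (l r))"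
  proof (rule poly_eqI_degree[where A = "real ` {..<M}"])
    fix t assume "t \<in> real ` {..<M}"
    then obtain s where s: "s < M" "t = real s" by auto
    have "poly (\<Sum>r<M. Polynomial.smult (poly f (real r)) (l r)) t
        = (\<Sum>r<M. if r = s then poly f (real r) else 0)"
      unfolding poly_sum s(2) by (intro sum.cong) (auto simp: l s)
    then show "poly f t = poly (\<Sum>r<M. Polynomial.smult (poly f (real r)) (l r)) t"
      using s by simp
  next
    have M: "card (real ` {..<M}) = M" by (simp add: card_image inj_on_def)
    show "degree f < card (real ` {..<M})" using f M by simp
    show "degree (\<Sum>r<M. Polynomial.smult (poly f (real r)) (l r)) < card (real ` {..<M})"
      unfolding M using f dl by (intro degree_sum_less) (auto intro: le_less_trans[OF degree_smult_le])
  qed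
qed

lemma vandermonde_hat_pos:
  assumes "jacobi_parameters a b" "lam \<in> GT_plus N"
  shows "0 < vandermonde N (\<lambda>i. hat a b (shifted N lam i))"
proof -
  interpret jacobi_parameters a b by fact
  have "0 < hat a b (shifted N lam i) - hat a b (shifted N lam j)" if "i < j" "j < N" for i j
    using shifted_less[OF assms(2) that] eps_nonneg unfolding hat_diff by (intro mult_pos_pos) auto
  then show ?thesis unfolding vandermonde_def by (intro prod_pos) auto
qed

context jacobi_parameters
begin

section \<open>Branching of multivariate Jacobi polynomials and their values at (1, ..., 1)\<close>

definition green_det :: "nat \<Rightarrow> (nat \<Rightarrow> nat) \<Rightarrow> (nat \<Rightarrow> nat) \<Rightarrow> real" where
  "green_det N l m = ndet (Suc N) (\<lambda>i j. if j < N then green (l i) (m j) else 1)"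

lemma green_eq_0: "l \<le> m \<Longrightarrow> green l m = 0"
  by (simp add: green_def)

lemma green_op_eq: "l \<le> M \<Longrightarrow> green_op f l = (\<Sum>m<M. green l m * f m)"
  unfolding green_op_def by (intro sum.mono_neutral_left) (auto simp: green_eq_0)

lemma green_cauchy_binet:
  assumes "\<And>i. i \<le> N \<Longrightarrow> l i \<le> M"
  shows "ndet (Suc N) (\<lambda>i j. if j < N then green_op (w j) (l i) else 1)
    = (\<Sum>mu\<in>GT_below N M. green_det N l (shifted N mu) * ndet N (\<lambda>i j. w j (shifted N mu i)))"
proof -
  have "ndet (Suc N) (\<lambda>i j. if j < N then green_op (w j) (l i) else 1)
      = ndet (Suc N) (\<lambda>i j. if j < N then \<Sum>r<M. green (l i) r * w j r else 1)"
    using assms by (intro ndet_cong) (auto simp: green_op_eq)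
  then show ?thesis
    by (simp only: cauchy_binet_border[where A = "\<lambda>i r. green (l i) r" and c = "\<lambda>_. 1"] green_det_def)
qed

text \<open>The last column consists of ones. Once it is subtracted, \<open>jac_minus_1\<close>
  writes column j as (x j - 1) / 2 times a Green operator applied to Jacobi values, to which
  Cauchy-Binet applies. The product of the x j - 1 is the extra factor of the larger Vandermonde
  product and cancels at generic points.\<close>

lemma Jacobi_multi_branching:
  assumes "\<And>i. i \<le> N \<Longrightarrow> shifted (Suc N) lam i \<le> M"
  shows "Jacobi_multi jac (Suc N) lam (x(N := 1))
    = (1 / 2) ^ N * (\<Sum>mu\<in>GT_below N M. green_det N (shifted (Suc N) lam) (shifted N mu) * Jacobi_multi jac N mu x)"
proof -
  let ?l = "shifted (Suc N) lam"
  have "(\<lambda>x. Jacobi_multi jac (Suc N) lam (x(N := 1)))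
     = (\<lambda>x. (1 / 2) ^ N * (\<Sum>mu\<in>GT_below N M. green_det N ?l (shifted N mu) * Jacobi_multi jac N mu x))"
  proof (rule polyfun_eqI_generic)
    show "(\<lambda>x. Jacobi_multi jac (Suc N) lam (x(N := 1))) \<in> polyfun N"
      by (intro polyfun_substitute_last Jacobi_multi)
    show "(\<lambda>x. (1 / 2) ^ N * (\<Sum>mu\<in>GT_below N M. green_det N ?l (shifted N mu) * Jacobi_multi jac N mu x)) \<in> polyfun N"
      by (intro polyfun_cmult polyfun_sum Jacobi_multi)
    fix x :: "nat \<Rightarrow> real" assume x: "inj_on x {..<N}" "\<And>i. i < N \<Longrightarrow> x i \<noteq> 1"
    have V: "vandermonde (Suc N) (x(N := 1)) = vandermonde N x * (\<Prod>i<N. x i - 1)"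
      unfolding vandermonde_Suc by (intro arg_cong2[where f = "(*)"] vandermonde_cong prod.cong) auto
    have nz: "vandermonde N x * (\<Prod>i<N. x i - 1) \<noteq> 0"
      using x vandermonde_nonzero[of x N] by auto
    have half: "(\<Prod>j<N. (x j - 1) / 2) = (1 / 2) ^ N * (\<Prod>j<N. x j - 1)"
      by (simp add: prod_dividef power_one_over field_simps)
    have "Jacobi_multi jac (Suc N) lam (x(N := 1)) * (vandermonde N x * (\<Prod>i<N. x i - 1))
       = ndet (Suc N) (\<lambda>i j. poly (jac (?l i)) ((x(N := 1)) j))"
      using Jacobi_multi(2)[of jac "Suc N" lam "x(N := 1)"] by (simp only: V)
    also have "\<dots> = ndet (Suc N) (\<lambda>i j. if j < N then poly (jac (?l i)) ((x(N := 1)) j) + (- 1) * poly (jac (?l i)) ((x(N := 1)) N)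
         else poly (jac (?l i)) ((x(N := 1)) N))"
      by (rule ndet_add_last_col[symmetric])
    also have "\<dots> = ndet (Suc N) (\<lambda>i j. (if j < N then (x j - 1) / 2 else 1) *
         (if j < N then green_op (\<lambda>m. poly (jac m) (x j)) (?l i) else 1))"
      by (intro ndet_cong) (auto simp: jac_minus_1 less_Suc_eq)
    also have "\<dots> = (\<Prod>j<N. (x j - 1) / 2) * ndet (Suc N) (\<lambda>i j. if j < N then green_op (\<lambda>m. poly (jac m) (x j)) (?l i) else 1)"
      unfolding ndet_scale_cols by simp
    also have "\<dots> = (\<Prod>j<N. (x j - 1) / 2) *
       (\<Sum>mu\<in>GT_below N M. green_det N ?l (shifted N mu) * (Jacobi_multi jac N mu x * vandermonde N x))"
      unfolding Jacobi_multi(2) by (subst green_cauchy_binet) (use assms in auto)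
    also have "\<dots> = (1 / 2) ^ N * (\<Sum>mu\<in>GT_below N M. green_det N ?l (shifted N mu) * Jacobi_multi jac N mu x)
        * (vandermonde N x * (\<Prod>i<N. x i - 1))"
      unfolding half by (simp add: sum_distrib_left sum_distrib_right mult_ac)
    finally show "Jacobi_multi jac (Suc N) lam (x(N := 1))
       = (1 / 2) ^ N * (\<Sum>mu\<in>GT_below N M. green_det N ?l (shifted N mu) * Jacobi_multi jac N mu x)"
      using nz by simp
  qed
  then show ?thesis by (rule fun_cong)
qed

text \<open>\<open>phi m\<close> is a monic polynomial of degree m in
  \<open>hat a b x\<close>.\<close>

lemma ndet_phi: "ndet n (\<lambda>i j. phi (n - 1 - j) (l i)) = vandermonde n (\<lambda>i. hat a b (l i))"
proof -
  define f where "f = (\<lambda>m. \<Prod>r<m. [:- hat a b r, 1:])"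
  have "degree (f k) = k \<and> lead_coeff (f k) = 1" for k
  proof
    show "degree (f k) = k" unfolding f_def by (subst degree_prod_eq_sum_degree) auto
    have "lead_coeff (f k) = (\<Prod>r<k. lead_coeff [:- hat a b r, 1:])"
      unfolding f_def by (rule lead_coeff_prod)
    then show "lead_coeff (f k) = 1" by simp
  qed
  then have "ndet n (\<lambda>i j. poly (f (n - 1 - j)) (hat a b (l i))) = vandermonde n (\<lambda>i. hat a b (l i))"
    by (intro ndet_monic_poly)
  moreover have "poly (f m) (hat a b x) = phi m x" for m x
    by (simp add: f_def phi_def poly_prod)
  ultimately show ?thesis by (simp only:)
qed

lemma GT_below_bounded:
  assumes "lam \<in> GT_plus N" "\<And>i. i < N \<Longrightarrow> shifted N lam i \<le> M"
  shows "lam \<in> GT_below N (Suc M)"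
  using assms by (auto simp: GT_below_def less_Suc_eq_le)

lemma shifted_le_first:
  assumes "lam \<in> GT_plus N" "i < N"
  shows "shifted N lam i \<le> shifted N lam 0"
  using shifted_less[OF assms(1), of 0 i] assms(2) by (cases "i = 0") auto

text \<open>By the induction hypothesis, branching at (1, ..., 1) becomes a Cauchy-Binet sum for the
  functions \<open>phi\<close>. Since \<open>green_op\<close> raises \<open>phi m\<close> to a
  multiple of \<open>phi (Suc m)\<close>, the result is again a Vandermonde product, one size
  larger. K collects the factors 1 / 2 and 1 / \<open>theta\<close>.\<close>

lemma Jacobi_multi_at_1:
  "\<exists>K>0. \<forall>lam\<in>GT_plus N. Jacobi_multi jac N lam (\<lambda>_. 1)
      = K * vandermonde N (\<lambda>i. hat a b (shifted N lam i))"
proof (induction N)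
  case 0
  have "Jacobi_multi jac 0 lam = (\<lambda>x. 1)" for lam
    by (rule Jacobi_multi_eqI) (auto simp: vandermonde_def ndet_leibniz intro: polyfun.intros)
  then show ?case by (intro exI[of _ 1]) (simp add: vandermonde_def)
next
  case (Suc N)
  then obtain K where K: "0 < K" "\<And>mu. mu \<in> GT_plus N \<Longrightarrow> Jacobi_multi jac N mu (\<lambda>_. 1)
      = K * vandermonde N (\<lambda>i. hat a b (shifted N mu i))" by blast
  define K' where "K' = (1 / 2) ^ N * K * (\<Prod>j<N. 1 / theta (N - j))"
  have "0 < theta (N - j)" if "j < N" for j using theta_pos[of "N - j - 1"] that by (simp add: Suc_diff_Suc)
  then have "0 < K'" unfolding K'_def using K(1) by (intro mult_pos_pos prod_pos) auto
  moreover have "Jacobi_multi jac (Suc N) lam (\<lambda>_. 1) = K' * vandermonde (Suc N) (\<lambda>i. hat a b (shifted (Suc N) lam i))"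
    if lam: "lam \<in> GT_plus (Suc N)" for lam
  proof -
    let ?l = "shifted (Suc N) lam"
    have le: "?l i \<le> ?l 0" if "i \<le> N" for i using shifted_le_first[OF lam, of i] that by simp
    have upd: "(\<lambda>_. 1)(N := 1) = (\<lambda>_. 1 :: real)" by auto
    have "Jacobi_multi jac (Suc N) lam (\<lambda>_. 1)
      = (1 / 2) ^ N * (\<Sum>mu\<in>GT_below N (?l 0). green_det N ?l (shifted N mu) * Jacobi_multi jac N mu (\<lambda>_. 1))"
      using Jacobi_multi_branching[of N lam "?l 0" "\<lambda>_. 1", OF le] unfolding upd .
    also have "\<dots> = (1 / 2) ^ N * (\<Sum>mu\<in>GT_below N (?l 0). K * (green_det N ?l (shifted N mu)
        * ndet N (\<lambda>i j. phi (N - 1 - j) (shifted N mu i))))"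
    proof -
      have "green_det N ?l (shifted N mu) * Jacobi_multi jac N mu (\<lambda>_. 1) = K * (green_det N ?l (shifted N mu)
          * ndet N (\<lambda>i j. phi (N - 1 - j) (shifted N mu i)))" if "mu \<in> GT_below N (?l 0)" for mu
        using that unfolding ndet_phi by (simp add: K(2) GT_below_def)
      then show ?thesis by (intro arg_cong[where f = "(*) ((1 / 2) ^ N)"] sum.cong[OF refl])
    qed
    also have "\<dots> = (1 / 2) ^ N * K * ndet (Suc N) (\<lambda>i j. if j < N then green_op (phi (N - 1 - j)) (?l i) else 1)"
      by (subst green_cauchy_binet[of N ?l "?l 0"]) (use le in \<open>auto simp: sum_distrib_left mult_ac\<close>)
    also have "ndet (Suc N) (\<lambda>i j. if j < N then green_op (phi (N - 1 - j)) (?l i) else 1)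
       = ndet (Suc N) (\<lambda>i j. (if j < N then 1 / theta (N - j) else 1) * phi (Suc N - 1 - j) (?l i))"
      by (intro ndet_cong) (auto simp: green_op_phi Suc_diff_Suc less_Suc_eq)
    also have "\<dots> = (\<Prod>j<N. 1 / theta (N - j)) * vandermonde (Suc N) (\<lambda>i. hat a b (?l i))"
      unfolding ndet_scale_cols ndet_phi by simp
    finally show ?thesis by (simp add: K'_def mult_ac)
  qed
  ultimately show ?case by blast
qed

lemma Jacobi_multi_at_1_pos:
  "lam \<in> GT_plus N \<Longrightarrow> 0 < Jacobi_multi jac N lam (\<lambda>_. 1)"
  using Jacobi_multi_at_1[of N] vandermonde_hat_pos[OF jacobi_parameters_axioms, of lam N] by auto

text \<open>The functional "coefficient at \<open>jac k\<close>" is the weighted inner product with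
  \<open>jac k\<close> divided by its square norm; on degrees below M, Lagrange interpolation
  expresses it through the values at 0, ..., M - 1.\<close>

lemma jac_dual_weights:
  "\<exists>w. \<forall>k<M. \<forall>m<M. (\<Sum>r<M. w k r * poly (jac m) (real r)) = of_bool (k = m)"
proof (cases "M = 0")
  case False
  obtain l where l: "\<And>f::real poly. degree f < M \<Longrightarrow> f = (\<Sum>r<M. Polynomial.smult (poly f (real r)) (l r))"
    using lagrange_interpolation[of M] by blast
  define w where "w = (\<lambda>k r. wint (l r * jac k) / wint (jac k * jac k))"
  have "(\<Sum>r<M. w k r * poly (jac m) (real r)) = of_bool (k = m)" if "k < M" "m < M" for k m
  proof -
    have "jac m = (\<Sum>r<M. Polynomial.smult (poly (jac m) (real r)) (l r))"
      using that by (intro l) (simp add: degree_jac)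
    then have "wint (jac m * jac k) = wint ((\<Sum>r<M. Polynomial.smult (poly (jac m) (real r)) (l r)) * jac k)"
      by (rule arg_cong)
    also have "\<dots> = (\<Sum>r<M. poly (jac m) (real r) * wint (l r * jac k))"
      by (simp add: sum_distrib_right wint_sum wint_smult)
    finally have "(\<Sum>r<M. w k r * poly (jac m) (real r)) = wint (jac m * jac k) / wint (jac k * jac k)"
      by (simp add: w_def sum_divide_distrib mult.commute)
    then show ?thesis
      using jac_orthogonal[of m k] wint_square_eq_0[of "jac k"] jac_nonzero[of k] by auto
  qed
  then show ?thesis by blast
qed simp

text \<open>The tensor product of the functionals from \<open>jac_dual_weights\<close>, applied
  after multiplication by the Vandermonde product, sends the function of \<open>mu\<close> to a
  determinant of Kronecker deltas: 1 for \<open>mu = nu\<close>, and 0 otherwise.\<close>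

lemma Jacobi_multi_independent:
  assumes S: "finite S" "S \<subseteq> GT_plus N" and zero: "\<And>x. (\<Sum>mu\<in>S. d mu * Jacobi_multi jac N mu x) = 0"
    and nu: "nu \<in> S"
  shows "d nu = 0"
proof -
  define M where "M = Suc (\<Sum>mu\<in>S. \<Sum>i<N. shifted N mu i)"
  have M: "shifted N mu i < M" if "mu \<in> S" "i < N" for mu i
  proof -
    have "shifted N mu i \<le> (\<Sum>i<N. shifted N mu i)" using that by (intro member_le_sum) auto
    also have "\<dots> \<le> (\<Sum>mu\<in>S. \<Sum>i<N. shifted N mu i)" using that S by (intro member_le_sum) auto
    finally show ?thesis by (simp add: M_def)
  qed
  obtain w where w: "\<And>k m. k < M \<Longrightarrow> m < M \<Longrightarrow> (\<Sum>r<M. w k r * poly (jac m) (real r)) = of_bool (k = m)"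
    using jac_dual_weights[of M] by blast
  define W where "W = (\<lambda>f. \<Prod>j<N. w (shifted N nu j) (f j))"
  have dual: "(\<Sum>f\<in>PiE {..<N} (\<lambda>_. {..<M}). W f * ndet N (\<lambda>i j. poly (jac (shifted N mu i)) (real (f j))))
      = of_bool (mu = nu)" if mu: "mu \<in> S" for mu
  proof -
    have "(\<Sum>f\<in>PiE {..<N} (\<lambda>_. {..<M}). W f * ndet N (\<lambda>i j. poly (jac (shifted N mu i)) (real (f j))))
       = (\<Sum>f\<in>PiE {..<N} (\<lambda>_. {..<M}). ndet N (\<lambda>i j. w (shifted N nu j) (f j) * poly (jac (shifted N mu i)) (real (f j))))"
      unfolding W_def ndet_scale_cols ..
    also have "\<dots> = ndet N (\<lambda>i j. \<Sum>r<M. w (shifted N nu j) r * poly (jac (shifted N mu i)) (real r))"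
      by (rule ndet_sum_cols[symmetric]) simp
    also have "\<dots> = ndet N (\<lambda>i j. of_bool (shifted N nu j = shifted N mu i))"
      using M[OF mu] M[OF nu] by (intro ndet_cong) (simp add: w)
    also have "\<dots> = of_bool (mu = nu)"
    proof (cases "mu = nu")
      case True
      have "Matrix.mat N N (\<lambda>(i, j). of_bool (shifted N nu j = shifted N nu i)) = (1\<^sub>m N :: real mat)"
        using inj_on_shifted[of nu N] nu S by (intro eq_matI) (auto simp: inj_on_def)
      then show ?thesis by (simp add: True ndet_def)
    next
      case False
      then have ne: "shifted N mu ` {..<N} \<noteq> shifted N nu ` {..<N}"
        using shifted_image_inject[of mu N nu] mu nu S by auto
      have "card (shifted N mu ` {..<N}) = card (shifted N nu ` {..<N})"
        using mu nu S inj_on_shifted by (auto simp: card_image subset_iff)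
      then have "\<not> shifted N mu ` {..<N} \<subseteq> shifted N nu ` {..<N}"
        using ne card_subset_eq[of "shifted N nu ` {..<N}" "shifted N mu ` {..<N}"] by auto
      then obtain i where "i < N" "\<And>j. j < N \<Longrightarrow> shifted N mu i \<noteq> shifted N nu j" by auto
      then have "ndet N (\<lambda>i j. of_bool (shifted N nu j = shifted N mu i)) = 0"
        by (intro ndet_zero_row[of i]) (auto simp: eq_commute)
      then show ?thesis using False by simp
    qed
    finally show ?thesis .
  qed
  have "0 = (\<Sum>f\<in>PiE {..<N} (\<lambda>_. {..<M}). W f * ((\<Sum>mu\<in>S. d mu * Jacobi_multi jac N mu (\<lambda>j. real (f j)))
      * vandermonde N (\<lambda>j. real (f j))))"
    by (simp add: zero)
  also have "\<dots> = (\<Sum>f\<in>PiE {..<N} (\<lambda>_. {..<M}). \<Sum>mu\<in>S.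
      d mu * (W f * ndet N (\<lambda>i j. poly (jac (shifted N mu i)) (real (f j)))))"
  proof -
    have "ndet N (\<lambda>i j. poly (jac (shifted N mu i)) (real (f j)))
        = Jacobi_multi jac N mu (\<lambda>j. real (f j)) * vandermonde N (\<lambda>j. real (f j))" for mu f
      by (simp add: Jacobi_multi(2))
    then show ?thesis by (simp add: sum_distrib_left sum_distrib_right mult_ac)
  qed
  also have "\<dots> = (\<Sum>mu\<in>S. d mu * of_bool (mu = nu))"
    by (subst sum.swap) (simp add: sum_distrib_left[symmetric] dual)
  also have "\<dots> = d nu" using nu S by (simp add: of_bool_def if_distrib cong: if_cong)
  finally show ?thesis by simp
qed

text \<open>The branching coefficients renormalized at (1, ..., 1). They are set to 0 off
  \<open>GT_plus N\<close> because the rows of \<open>Lambda_kernel\<close> are functions on all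
  lists.\<close>

definition kernel :: "nat \<Rightarrow> nat list \<Rightarrow> nat list \<Rightarrow> real" where
  "kernel N lam mu = (if mu \<in> GT_plus N
     then (1 / 2) ^ N * green_det N (shifted (Suc N) lam) (shifted N mu)
        * Jacobi_multi jac N mu (\<lambda>_. 1) / Jacobi_multi jac (Suc N) lam (\<lambda>_. 1) else 0)"

section \<open>Positivity, support and row sums of the kernel; identification with
  \<open>Lambda_kernel\<close>\<close>

lemma green_det_eq_consecutive:
  "green_det N l m = ndet N (\<lambda>i j. green (l i) (m j) - green (l (Suc i)) (m j))"
  unfolding green_det_def by (rule ndet_border_consecutive)

lemma green_diff:
  assumes "k \<le> l"
  shows "green l m - green k m = stat m * (\<Sum>r=k..<l. scale_step r * of_bool (m \<le> r))"
proof -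
  have "(\<Sum>r=m..<l. scale_step r) - (\<Sum>r=m..<k. scale_step r) = (\<Sum>r=k..<l. scale_step r * of_bool (m \<le> r))"
  proof -
    have "(\<Sum>r=m..<l. scale_step r) = (\<Sum>r<l. scale_step r * of_bool (m \<le> r))" for l
      by (intro sum.mono_neutral_cong_left) auto
    moreover have "(\<Sum>r<l. scale_step r * of_bool (m \<le> r)) = (\<Sum>r<k. scale_step r * of_bool (m \<le> r)) + (\<Sum>r=k..<l. scale_step r * of_bool (m \<le> r))"
      using sum.atLeastLessThan_concat[of 0 k l "\<lambda>r. scale_step r * of_bool (m \<le> r)"] assms by (simp add: lessThan_atLeast0)
    ultimately show ?thesis by simp
  qed
  then show ?thesis by (simp add: green_def right_diff_distrib[symmetric])
qed

text \<open>Consecutive rows differ by positive combinations of step functions with jump points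
  between \<open>l (Suc i)\<close> and \<open>l i\<close>. Multilinearity reduces to step
  determinants, and points chosen in successive intervals are automatically decreasing.\<close>

lemma green_det_nonneg:
  assumes l: "\<And>i. i < N \<Longrightarrow> l (Suc i) \<le> l i" and m: "\<And>i. Suc i < N \<Longrightarrow> m (Suc i) \<le> m i"
  shows "0 \<le> green_det N l m"
proof -
  define S where "S = (\<lambda>i. {l (Suc i)..<l i})"
  have "green_det N l m = ndet N (\<lambda>i j. stat (m j) * (\<Sum>r\<in>S i. scale_step r * of_bool (m j \<le> r)))"
    unfolding green_det_eq_consecutive S_def by (intro ndet_cong) (simp add: green_diff l)
  also have "\<dots> = (\<Prod>j<N. stat (m j)) * ndet N (\<lambda>i j. \<Sum>r\<in>S i. scale_step r * of_bool (m j \<le> r))"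
    by (rule ndet_scale_cols)
  also have "ndet N (\<lambda>i j. \<Sum>r\<in>S i. scale_step r * of_bool (m j \<le> r))
     = (\<Sum>f\<in>PiE {..<N} S. ndet N (\<lambda>i j. scale_step (f i) * of_bool (m j \<le> f i)))"
    by (rule ndet_sum_rows) (simp add: S_def)
  also have "\<dots> = (\<Sum>f\<in>PiE {..<N} S. (\<Prod>i<N. scale_step (f i)) * ndet N (\<lambda>i j. of_bool (m j \<le> f i)))"
    by (simp only: ndet_scale_rows)
  also have "(\<Prod>j<N. stat (m j)) * \<dots> \<ge> 0"
  proof (intro mult_nonneg_nonneg sum_nonneg prod_nonneg ndet_step_nonneg)
    fix f i assume f: "f \<in> PiE {..<N} S" and i: "Suc i < N"
    have "f i \<in> S i" "f (Suc i) \<in> S (Suc i)" using PiE_mem[OF f, of i] PiE_mem[OF f, of "Suc i"] i by simp_all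
    then show "f (Suc i) \<le> f i" by (auto simp: S_def)
  qed (use m stat_pos scale_step_pos in \<open>auto intro: less_imp_le\<close>)
  finally show ?thesis .
qed

lemma kernel_nonneg:
  assumes "lam \<in> GT_plus (Suc N)"
  shows "0 \<le> kernel N lam mu"
proof (cases "mu \<in> GT_plus N")
  case True
  have "0 \<le> green_det N (shifted (Suc N) lam) (shifted N mu)"
    using shifted_less[OF assms] shifted_less[OF True] by (intro green_det_nonneg less_imp_le) auto
  then show ?thesis
    using Jacobi_multi_at_1_pos[OF assms] Jacobi_multi_at_1_pos[OF True] True
    by (simp add: kernel_def)
qed (simp add: kernel_def)

text \<open>A label of \<open>mu\<close> that is at least every \<open>l i\<close> has a vanishing
  column of Green functions.\<close>

lemma green_det_support:
  assumes "mu \<in> GT_plus N" "\<And>i. i \<le> N \<Longrightarrow> l i \<le> M" "green_det N l (shifted N mu) \<noteq> 0"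
  shows "mu \<in> GT_below N M"
proof (rule ccontr)
  assume "mu \<notin> GT_below N M"
  then obtain i where "i < N" "M \<le> shifted N mu i" using assms(1) by (auto simp: GT_below_def not_less)
  moreover have "green (l k) (shifted N mu i) = 0" if "k < Suc N" for k
    using assms(2)[of k] \<open>M \<le> shifted N mu i\<close> that by (intro green_eq_0) auto
  ultimately have "green_det N l (shifted N mu) = 0"
    unfolding green_det_def by (intro ndet_zero_col[of i]) auto
  then show False using assms(3) by simp
qed

lemma kernel_support:
  assumes "lam \<in> GT_plus (Suc N)" "kernel N lam mu \<noteq> 0"
  shows "mu \<in> GT_below N (shifted (Suc N) lam 0)"
proof (rule green_det_support)
  show "mu \<in> GT_plus N" "green_det N (shifted (Suc N) lam) (shifted N mu) \<noteq> 0"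
    using assms(2) by (auto simp: kernel_def split: if_splits)
  show "shifted (Suc N) lam i \<le> shifted (Suc N) lam 0" if "i \<le> N" for i
    using shifted_le_first[OF assms(1)] that by simp
qed

lemma kernel_finite:
  assumes "lam \<in> GT_plus (Suc N)"
  shows "finite {mu. kernel N lam mu \<noteq> 0}" "{mu. kernel N lam mu \<noteq> 0} \<subseteq> GT_plus N"
proof -
  have "{mu. kernel N lam mu \<noteq> 0} \<subseteq> GT_below N (shifted (Suc N) lam 0)"
    using kernel_support[OF assms] by blast
  then show "finite {mu. kernel N lam mu \<noteq> 0}" by (rule finite_subset) (rule finite_GT_below)
  show "{mu. kernel N lam mu \<noteq> 0} \<subseteq> GT_plus N" by (auto simp: kernel_def)
qed

lemma kernel_expansion:
  assumes lam: "lam \<in> GT_plus (Suc N)"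
  shows "Jacobi_norm jac (Suc N) lam (x(N := 1))
    = (\<Sum>mu | kernel N lam mu \<noteq> 0. kernel N lam mu * Jacobi_norm jac N mu x)"
proof -
  let ?l = "shifted (Suc N) lam"
  have le: "?l i \<le> ?l 0" if "i \<le> N" for i using shifted_le_first[OF lam, of i] that by simp
  have "Jacobi_norm jac (Suc N) lam (x(N := 1)) = (1 / 2) ^ N * (\<Sum>mu\<in>GT_below N (?l 0).
      green_det N ?l (shifted N mu) * Jacobi_multi jac N mu x) / Jacobi_multi jac (Suc N) lam (\<lambda>_. 1)"
    unfolding Jacobi_norm_def using Jacobi_multi_branching[of N lam "?l 0" x, OF le] by simp
  also have "\<dots> = (\<Sum>mu\<in>GT_below N (?l 0). kernel N lam mu * Jacobi_norm jac N mu x)"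
    unfolding sum_distrib_left sum_divide_distrib
  proof (intro sum.cong refl)
    fix mu assume "mu \<in> GT_below N (?l 0)"
    then have mu: "mu \<in> GT_plus N" by (simp add: GT_below_def)
    then show "(1 / 2) ^ N * (green_det N ?l (shifted N mu) * Jacobi_multi jac N mu x) / Jacobi_multi jac (Suc N) lam (\<lambda>_. 1)
        = kernel N lam mu * Jacobi_norm jac N mu x"
      using Jacobi_multi_at_1_pos[OF mu] by (simp add: kernel_def Jacobi_norm_def)
  qed
  also have "\<dots> = (\<Sum>mu | kernel N lam mu \<noteq> 0. kernel N lam mu * Jacobi_norm jac N mu x)"
    using kernel_support[OF lam] by (intro sum.mono_neutral_right finite_GT_below) auto
  finally show ?thesis .
qed

text \<open>Uniqueness in the definite description: two finitely supported expansions differ by a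
  vanishing combination of linearly independent polynomials.\<close>

lemma Lambda_kernel_jac:
  assumes lam: "lam \<in> GT_plus (Suc N)"
  shows "Lambda_kernel jac N lam = kernel N lam"
  unfolding Lambda_kernel_def Suc_eq_plus1[symmetric]
proof (rule the_equality, goal_cases)
  case 1
  show ?case using kernel_finite[OF lam] kernel_expansion[OF lam] by blast
next
  case (2 c)
  define S where "S = {mu. c mu \<noteq> 0} \<union> {mu. kernel N lam mu \<noteq> 0}"
  have S: "finite S" "S \<subseteq> GT_plus N"
    using 2 kernel_finite[OF lam] by (auto simp: S_def)
  have "(\<Sum>mu\<in>S. (c mu - kernel N lam mu) / Jacobi_multi jac N mu (\<lambda>_. 1) * Jacobi_multi jac N mu x) = 0" for x
  proof -
    have "(\<Sum>mu\<in>S. c mu * Jacobi_norm jac N mu x) = (\<Sum>mu | c mu \<noteq> 0. c mu * Jacobi_norm jac N mu x)"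
      using S by (intro sum.mono_neutral_right) (auto simp: S_def)
    also have "\<dots> = (\<Sum>mu | kernel N lam mu \<noteq> 0. kernel N lam mu * Jacobi_norm jac N mu x)"
      using 2 kernel_expansion[OF lam] by simp
    also have "\<dots> = (\<Sum>mu\<in>S. kernel N lam mu * Jacobi_norm jac N mu x)"
      using S by (intro sum.mono_neutral_left) (auto simp: S_def)
    finally show ?thesis
      by (simp add: Jacobi_norm_def left_diff_distrib diff_divide_distrib sum_subtractf)
  qed
  then have "(c mu - kernel N lam mu) / Jacobi_multi jac N mu (\<lambda>_. 1) = 0" if "mu \<in> S" for mu
    using Jacobi_multi_independent[OF S, of "\<lambda>mu. (c mu - kernel N lam mu) / Jacobi_multi jac N mu (\<lambda>_. 1)" mu] that by simp
  then have "c mu = kernel N lam mu" if "mu \<in> S" for mu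
    using Jacobi_multi_at_1_pos[of mu N] that S by force
  then have "c mu = kernel N lam mu" for mu by (cases "mu \<in> S") (auto simp: S_def)
  then show ?case by (rule ext)
qed

text \<open>Evaluate the expansion at (1, ..., 1), where all normalized polynomials are 1.\<close>

lemma kernel_sum:
  assumes lam: "lam \<in> GT_plus (Suc N)"
  shows "(\<Sum>mu | kernel N lam mu \<noteq> 0. kernel N lam mu) = 1"
proof -
  have upd: "(\<lambda>_. 1)(N := 1) = (\<lambda>_. 1 :: real)" by auto
  have one: "Jacobi_norm jac K mu (\<lambda>_. 1) = 1" if "mu \<in> GT_plus K" for mu K
    using Jacobi_multi_at_1_pos[OF that] by (simp add: Jacobi_norm_def)
  have "1 = (\<Sum>mu | kernel N lam mu \<noteq> 0. kernel N lam mu * Jacobi_norm jac N mu (\<lambda>_. 1))"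
    using kernel_expansion[OF lam, of "\<lambda>_. 1"] one[OF lam] unfolding upd by simp
  also have "\<dots> = (\<Sum>mu | kernel N lam mu \<noteq> 0. kernel N lam mu)"
    by (intro sum.cong refl) (auto simp: kernel_def one split: if_splits)
  finally show ?thesis by simp
qed

end

section \<open>Feller semigroups with a conservative \<open>q\<close>-matrix\<close>

lemma C0_bounded:
  assumes "f \<in> C0 E"
  obtains C where "C > 0" "\<And>x. x \<in> E \<Longrightarrow> \<bar>f x\<bar> \<le> C"
proof
  let ?S = "{x\<in>E. \<bar>f x\<bar> \<ge> 1}"
  have fin: "finite ?S" using assms by (auto simp: C0_def)
  show "0 < 1 + (\<Sum>x\<in>?S. \<bar>f x\<bar>)" by (simp add: add_pos_nonneg sum_nonneg)
  fix x assume "x \<in> E"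
  show "\<bar>f x\<bar> \<le> 1 + (\<Sum>x\<in>?S. \<bar>f x\<bar>)"
  proof (cases "\<bar>f x\<bar> \<ge> 1")
    case True
    then have "\<bar>f x\<bar> \<le> (\<Sum>x\<in>?S. \<bar>f x\<bar>)"
      using fin \<open>x \<in> E\<close> by (intro member_le_sum) auto
    then show ?thesis by simp
  next
    case False
    moreover have "0 \<le> (\<Sum>x\<in>?S. \<bar>f x\<bar>)" by (simp add: sum_nonneg)
    ultimately show ?thesis by linarith
  qed
qed

lemma C0_0 [simp]: "(\<lambda>x. 0) \<in> C0 E"
  by (simp add: C0_def)

lemma C0_add:
  assumes "f \<in> C0 E" "g \<in> C0 E"
  shows "(\<lambda>x. f x + g x) \<in> C0 E"
  unfolding C0_def
proof (clarify)
  fix e :: real assume "0 < e"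
  have "finite ({x\<in>E. \<bar>f x\<bar> \<ge> e / 2} \<union> {x\<in>E. \<bar>g x\<bar> \<ge> e / 2})"
    using assms half_gt_zero[OF \<open>0 < e\<close>] unfolding C0_def by blast
  then show "finite {x\<in>E. \<bar>f x + g x\<bar> \<ge> e}"
    by (rule rev_finite_subset) (auto simp: abs_le_iff)
qed

lemma C0_cmult:
  assumes "f \<in> C0 E"
  shows "(\<lambda>x. c * f x) \<in> C0 E"
  unfolding C0_def
proof (clarify)
  fix e :: real assume "0 < e"
  then have "finite {x\<in>E. \<bar>f x\<bar> \<ge> e / (\<bar>c\<bar> + 1)}" using assms by (simp add: C0_def)
  moreover have "\<bar>f x\<bar> \<ge> e / (\<bar>c\<bar> + 1)" if "\<bar>c * f x\<bar> \<ge> e" for x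
  proof -
    have "e \<le> \<bar>f x\<bar> * (\<bar>c\<bar> + 1)" using that by (simp add: abs_mult algebra_simps)
    then show ?thesis by (simp add: pos_divide_le_eq)
  qed
  ultimately show "finite {x\<in>E. \<bar>c * f x\<bar> \<ge> e}"
    by (elim rev_finite_subset) auto
qed

lemma C0_diff: "f \<in> C0 E \<Longrightarrow> g \<in> C0 E \<Longrightarrow> (\<lambda>x. f x - g x) \<in> C0 E"
  using C0_add[of f E "\<lambda>x. - 1 * g x"] C0_cmult[of g E "- 1"] by simp

lemma C0_sum: "(\<And>i. i \<in> I \<Longrightarrow> f i \<in> C0 E) \<Longrightarrow> (\<lambda>x. \<Sum>i\<in>I. f i x) \<in> C0 E"
  by (induction I rule: infinite_finite_induct) (simp_all add: C0_add)

text \<open>At a positive maximum of \<open>d s y - eta * s\<close> the left quotient of d is at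
  least eta, whereas a row of Q with nonnegative off-diagonal entries and sum 0 yields at most 0.
  The maximum exists although E may be infinite, because only the finitely many states in
  \<open>K\<close> ever reach the threshold e. Left quotients are used since the maximum may sit at
  the final time.\<close>

lemma maximum_principle:
  fixes d :: "real \<Rightarrow> 'a \<Rightarrow> real" and Q :: "'a \<Rightarrow> 'a \<Rightarrow> real"
  assumes C0: "\<And>t. 0 \<le> t \<Longrightarrow> d t \<in> C0 E"
    and cont: "\<And>e. 0 < e \<Longrightarrow> \<exists>r>0. \<forall>s\<ge>0. \<forall>t\<ge>0. \<bar>s - t\<bar> < r \<longrightarrow> (\<forall>x\<in>E. \<bar>d s x - d t x\<bar> \<le> e)"
    and init: "\<And>x. x \<in> E \<Longrightarrow> d 0 x = 0"
    and deriv: "\<And>t x. 0 < t \<Longrightarrow> x \<in> E \<Longrightarrow>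
      ((\<lambda>h. (d t x - d (t - h) x) / h) \<longlongrightarrow> (\<Sum>y | y \<in> E \<and> Q x y \<noteq> 0. Q x y * d t y)) (at_right 0)"
    and Q: "\<And>x y. x \<in> E \<Longrightarrow> y \<in> E \<Longrightarrow> x \<noteq> y \<Longrightarrow> 0 \<le> Q x y"
      "\<And>x. x \<in> E \<Longrightarrow> (\<Sum>y | y \<in> E \<and> Q x y \<noteq> 0. Q x y) = 0"
    and t: "0 \<le> t" and x: "x \<in> E"
  shows "d t x \<le> 0"
proof (rule ccontr)
  assume "\<not> d t x \<le> 0"
  then have pos: "0 < d t x" by simp
  then have "0 < t" using init[OF x] t by (cases "t = 0") auto
  \<comment> \<open>Half of \<open>d t x\<close> is the threshold e, and the penalty
    \<open>eta * s\<close> uses up at most the other half on [0, t], so that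
    \<open>m t x = e\<close>.\<close>
  define eta where "eta = d t x / (2 * t)"
  define e where "e = d t x / 2"
  have "0 < e" "0 < eta" and eta_t: "eta * t = e" using pos \<open>0 < t\<close> by (auto simp: e_def eta_def)
  define m where "m = (\<lambda>s y. d s y - eta * s)"
  define K where "K = {y\<in>E. \<exists>s\<in>{0..t}. e \<le> d s y}"
  obtain r where r: "0 < r" "\<And>s s' y. 0 \<le> s \<Longrightarrow> 0 \<le> s' \<Longrightarrow> \<bar>s - s'\<bar> < r \<Longrightarrow> y \<in> E \<Longrightarrow> \<bar>d s y - d s' y\<bar> \<le> e / 2"
    using cont[of "e / 2"] \<open>0 < e\<close> by fastforce
  have "finite K"
  proof -
    obtain n :: nat where n: "t / r < real n" using reals_Archimedean2 by blast
    have "0 \<le> t / r" using \<open>0 < t\<close> r(1) by simp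
    then have n0: "0 < n" using n by (cases n) auto
    have tn: "t / real n < r" using n r(1) n0 by (simp add: field_simps)
    \<comment> \<open>The grid has mesh t / n < r: a state reaching e at some time is still at least
      e / 2 at the preceding grid time.\<close>
    have "K \<subseteq> (\<Union>k\<le>n. {y\<in>E. \<bar>d (real k * (t / n)) y\<bar> \<ge> e / 2})"
    proof
      fix y assume "y \<in> K"
      then obtain s where s: "y \<in> E" "0 \<le> s" "s \<le> t" "e \<le> d s y" by (auto simp: K_def)
      define k where "k = nat \<lfloor>s / (t / n)\<rfloor>"
      have q: "0 \<le> s / (t / n)" using s \<open>0 < t\<close> by simp
      then have k: "real k \<le> s / (t / n)" "s / (t / n) < real k + 1"
        unfolding k_def by linarith+
      have "s / (t / n) \<le> n" using s \<open>0 < t\<close> n0 by (simp add: field_simps)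
      then have "k \<le> n" using k by linarith
      have "real k * (t / n) \<le> s" "s < (real k + 1) * (t / n)"
        using k \<open>0 < t\<close> n0 by (auto simp: field_simps)
      moreover have "(real k + 1) * (t / n) = real k * (t / n) + t / n" by (simp only: distrib_right mult_1)
      ultimately have "\<bar>s - real k * (t / n)\<bar> < r" using tn by linarith
      then have "\<bar>d s y - d (real k * (t / n)) y\<bar> \<le> e / 2"
        using s \<open>0 < t\<close> by (intro r(2)) auto
      then have "\<bar>d (real k * (t / n)) y\<bar> \<ge> e / 2" using s by linarith
      then show "y \<in> (\<Union>k\<le>n. {y\<in>E. \<bar>d (real k * (t / n)) y\<bar> \<ge> e / 2})"
        using s \<open>k \<le> n\<close> by blast
    qed
    moreover have "finite (\<Union>k\<le>n. {y\<in>E. \<bar>d (real k * (t / n)) y\<bar> \<ge> e / 2})"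
    proof (rule finite_UN_I)
      fix k
      have "d (real k * (t / n)) \<in> C0 E" using C0 \<open>0 < t\<close> by simp
      then show "finite {y\<in>E. \<bar>d (real k * (t / n)) y\<bar> \<ge> e / 2}"
        using half_gt_zero[OF \<open>0 < e\<close>] unfolding C0_def by blast
    qed simp
    ultimately show ?thesis by (rule finite_subset)
  qed
  have "x \<in> K" using x t pos by (auto simp: K_def e_def intro!: bexI[of _ t])
  have cont_m: "continuous_on {0..t} (\<lambda>s. m s y)" if "y \<in> E" for y
  proof -
    have "continuous_on {0..t} (\<lambda>s. d s y)"
      unfolding continuous_on_iff
    proof (intro ballI allI impI)
      fix s \<epsilon> :: real assume "s \<in> {0..t}" "0 < \<epsilon>"
      obtain r where "0 < r" "\<And>s s'. 0 \<le> s \<Longrightarrow> 0 \<le> s' \<Longrightarrow> \<bar>s - s'\<bar> < r \<Longrightarrow> \<bar>d s y - d s' y\<bar> \<le> \<epsilon> / 2"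
        using cont[of "\<epsilon> / 2"] \<open>0 < \<epsilon>\<close> \<open>y \<in> E\<close> by fastforce
      then show "\<exists>r>0. \<forall>s'\<in>{0..t}. dist s' s < r \<longrightarrow> dist (d s' y) (d s y) < \<epsilon>"
        using \<open>s \<in> {0..t}\<close> \<open>0 < \<epsilon>\<close> by (intro exI[of _ r]) (fastforce simp: dist_real_def)
    qed
    then show ?thesis unfolding m_def by (intro continuous_intros)
  qed
  have "\<exists>s\<in>{0..t}. \<forall>s'\<in>{0..t}. m s' y \<le> m s y" if "y \<in> K" for y
    using that \<open>0 < t\<close> by (intro continuous_attains_sup cont_m) (auto simp: K_def)
  then obtain \<tau> where \<tau>: "\<And>y. y \<in> K \<Longrightarrow> \<tau> y \<in> {0..t}" "\<And>y s. y \<in> K \<Longrightarrow> s \<in> {0..t} \<Longrightarrow> m s y \<le> m (\<tau> y) y"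
    by metis
  have "Max ((\<lambda>z. m (\<tau> z) z) ` K) \<in> (\<lambda>z. m (\<tau> z) z) ` K"
    using \<open>finite K\<close> \<open>x \<in> K\<close> by (intro Max_in) auto
  then obtain y where "y \<in> K" "Max ((\<lambda>z. m (\<tau> z) z) ` K) = m (\<tau> y) y" by blast
  then have y: "y \<in> K" "\<And>z. z \<in> K \<Longrightarrow> m (\<tau> z) z \<le> m (\<tau> y) y"
    using Max_ge[of "(\<lambda>z. m (\<tau> z) z) ` K"] \<open>finite K\<close> by auto
  have yE: "y \<in> E" using y by (simp add: K_def)
  have "e = m t x" using eta_t by (simp add: m_def e_def)
  also have "\<dots> \<le> m (\<tau> y) y" using \<tau>(2)[OF \<open>x \<in> K\<close>, of t] y(2)[OF \<open>x \<in> K\<close>] t by auto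
  finally have M: "e \<le> m (\<tau> y) y" .
  have max: "m s z \<le> m (\<tau> y) y" if "s \<in> {0..t}" "z \<in> E" for s z
  proof (cases "z \<in> K")
    case True
    then show ?thesis using \<tau>(2)[OF True that(1)] y(2)[OF True] by simp
  next
    case False
    then have "d s z < e" using that by (auto simp: K_def not_le)
    moreover have "0 \<le> eta * s" using that \<open>0 < eta\<close> by simp
    ultimately show ?thesis using M by (simp add: m_def)
  qed
  have \<tau>0: "0 < \<tau> y"
    using M \<tau>(1)[OF y(1)] init[OF yE] \<open>0 < e\<close> by (cases "\<tau> y = 0") (auto simp: m_def)
  have "(\<Sum>z | z \<in> E \<and> Q y z \<noteq> 0. Q y z * d (\<tau> y) z)
     = (\<Sum>z | z \<in> E \<and> Q y z \<noteq> 0. Q y z * (d (\<tau> y) z - d (\<tau> y) y))"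
    by (simp add: right_diff_distrib sum_subtractf sum_distrib_right[symmetric] Q(2)[OF yE])
  also have "\<dots> \<le> 0"
  proof (rule sum_nonpos)
    fix z assume z: "z \<in> {z. z \<in> E \<and> Q y z \<noteq> 0}"
    then have "d (\<tau> y) z \<le> d (\<tau> y) y" using max[OF \<tau>(1)[OF y(1)], of z] by (simp add: m_def)
    then show "Q y z * (d (\<tau> y) z - d (\<tau> y) y) \<le> 0"
      using Q(1)[OF yE, of z] z by (cases "z = y") (auto simp: mult_nonneg_nonpos)
  qed
  finally have "(\<Sum>z | z \<in> E \<and> Q y z \<noteq> 0. Q y z * d (\<tau> y) z) \<le> 0" .
  moreover have "eta \<le> (\<Sum>z | z \<in> E \<and> Q y z \<noteq> 0. Q y z * d (\<tau> y) z)"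
  proof (rule tendsto_lowerbound[OF deriv[OF \<tau>0 yE]])
    have "eta \<le> (d (\<tau> y) y - d (\<tau> y - h) y) / h" if "0 < h" "h < \<tau> y" for h
    proof -
      have "m (\<tau> y - h) y \<le> m (\<tau> y) y" using that \<tau>(1)[OF y(1)] yE by (intro max) auto
      then show ?thesis using that by (simp add: m_def field_simps)
    qed
    then show "\<forall>\<^sub>F h in at_right 0. eta \<le> (d (\<tau> y) y - d (\<tau> y - h) y) / h"
      using \<tau>0 by (auto simp: eventually_at_right_field)
  qed simp
  ultimately show False using \<open>0 < eta\<close> by simp
qed

section \<open>Action of the semigroup on functions and the pointwise backward equation\<close>

locale feller_q_process =
  fixes E :: "'a set" and P :: "real \<Rightarrow> 'a \<Rightarrow> 'a \<Rightarrow> real" and Q :: "'a \<Rightarrow> 'a \<Rightarrow> real"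
  assumes feller: "feller_semigroup E P"
    and q_matrix: "\<And>x y. x \<in> E \<Longrightarrow> y \<in> E \<Longrightarrow>
      ((\<lambda>h. (P h x y - of_bool (x = y)) / h) \<longlongrightarrow> Q x y) (at_right 0)"
    and finite_row: "\<And>x. x \<in> E \<Longrightarrow> finite {y\<in>E. Q x y \<noteq> 0}"
    and row_sum: "\<And>x. x \<in> E \<Longrightarrow> (\<Sum>y | y \<in> E \<and> Q x y \<noteq> 0. Q x y) = 0"
begin

lemma P_nonneg: "0 \<le> t \<Longrightarrow> x \<in> E \<Longrightarrow> y \<in> E \<Longrightarrow> 0 \<le> P t x y"
  using feller by (auto simp: feller_semigroup_def markov_semigroup_def stochastic_matrix_def)

lemma P_sum: "0 \<le> t \<Longrightarrow> x \<in> E \<Longrightarrow> (P t x has_sum 1) E"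
  using feller by (auto simp: feller_semigroup_def markov_semigroup_def stochastic_matrix_def)

lemma P_0: "x \<in> E \<Longrightarrow> y \<in> E \<Longrightarrow> P 0 x y = of_bool (x = y)"
  using feller by (auto simp: feller_semigroup_def markov_semigroup_def)

lemma Q_nonneg:
  assumes "x \<in> E" "y \<in> E" "x \<noteq> y"
  shows "0 \<le> Q x y"
proof (rule tendsto_lowerbound[OF q_matrix[OF assms(1,2)]])
  have "0 \<le> (P h x y - of_bool (x = y)) / h" if "0 < h" for h
    using that P_nonneg[of h x y] assms by simp
  then show "\<forall>\<^sub>F h in at_right 0. 0 \<le> (P h x y - of_bool (x = y)) / h"
    by (auto simp: eventually_at_right_field intro: exI[of _ 1])
qed simp

lemma P_mult_summable:
  assumes "0 \<le> t" "x \<in> E" "\<And>y. y \<in> E \<Longrightarrow> \<bar>f y\<bar> \<le> C" "A \<subseteq> E"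
  shows "(\<lambda>y. P t x y * f y) summable_on A"
proof -
  have "(\<lambda>y. P t x y * C) summable_on E"
    using P_sum[OF assms(1,2)] by (intro summable_on_cmult_left) (auto simp: summable_on_def)
  then have "(\<lambda>y. P t x y * C) summable_on A"
    using assms(4) by (rule summable_on_subset_banach)
  then have "(\<lambda>y. norm (P t x y * f y)) summable_on A"
  proof (rule Infinite_Sum.abs_summable_on_comparison_test')
    fix y assume "y \<in> A"
    then have "y \<in> E" using assms(4) by auto
    then show "norm (P t x y * f y) \<le> P t x y * C"
      using assms(3)[of y] P_nonneg[of t x y] assms(1,2) by (auto simp: abs_mult intro!: mult_left_mono)
  qed
  then show ?thesis by (rule Infinite_Sum.abs_summable_summable)
qed

lemma P_mult_bound:
  assumes "0 \<le> t" "x \<in> E" "\<And>y. y \<in> E \<Longrightarrow> \<bar>f y\<bar> \<le> C" "A \<subseteq> E"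
  shows "\<bar>\<Sum>\<^sub>\<infinity>y\<in>A. P t x y * f y\<bar> \<le> C * (\<Sum>\<^sub>\<infinity>y\<in>A. P t x y)"
proof -
  have PA: "P t x summable_on A"
    using P_sum[OF assms(1,2)] assms(4) by (metis summable_on_def summable_on_subset_banach)
  have "norm (\<Sum>\<^sub>\<infinity>y\<in>A. P t x y * f y) \<le> (\<Sum>\<^sub>\<infinity>y\<in>A. P t x y) * C"
  proof (rule norm_infsum_le)
    show "((\<lambda>y. P t x y * f y) has_sum (\<Sum>\<^sub>\<infinity>y\<in>A. P t x y * f y)) A"
      using P_mult_summable[of t x f C A] assms by (intro has_sum_infsum) auto
    show "((\<lambda>y. P t x y * C) has_sum ((\<Sum>\<^sub>\<infinity>y\<in>A. P t x y) * C)) A"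
      using PA by (intro has_sum_cmult_left has_sum_infsum)
    show "norm (P t x y * f y) \<le> P t x y * C" if "y \<in> A" for y
    proof -
      have "y \<in> E" using that assms(4) by auto
      then show ?thesis
        using assms(3)[of y] P_nonneg[of t x y] assms(1,2) by (auto simp: abs_mult intro!: mult_left_mono)
    qed
  qed
  then show ?thesis by (simp add: mult.commute)
qed

abbreviation "ap \<equiv> semigroup_apply E P"

lemma ap_bound:
  assumes "0 \<le> t" "x \<in> E" "\<And>y. y \<in> E \<Longrightarrow> \<bar>f y\<bar> \<le> C"
  shows "\<bar>ap t f x\<bar> \<le> C"
  using P_mult_bound[OF assms order.refl] P_sum[OF assms(1,2)]
  by (simp add: semigroup_apply_def infsumI)

lemma ap_diff:
  assumes "0 \<le> t" "x \<in> E" "\<And>y. y \<in> E \<Longrightarrow> \<bar>f y\<bar> \<le> C" "\<And>y. y \<in> E \<Longrightarrow> \<bar>g y\<bar> \<le> C"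
  shows "ap t (\<lambda>y. f y - g y) x = ap t f x - ap t g x"
proof -
  have "(\<Sum>\<^sub>\<infinity>y\<in>E. P t x y * f y + - (P t x y * g y)) = (\<Sum>\<^sub>\<infinity>y\<in>E. P t x y * f y) + (\<Sum>\<^sub>\<infinity>y\<in>E. - (P t x y * g y))"
    using P_mult_summable[OF assms(1,2,3) order.refl] P_mult_summable[OF assms(1,2,4) order.refl]
    by (intro infsum_add) (auto simp: summable_on_uminus)
  then show ?thesis by (simp add: semigroup_apply_def right_diff_distrib infsum_uminus)
qed

text \<open>Fubini for the sum over pairs (w, y), absolutely summable because f is bounded and the
  rows are stochastic.\<close>

lemma ap_semigroup:
  assumes "0 \<le> s" "0 \<le> t" "x \<in> E" "\<And>y. y \<in> E \<Longrightarrow> \<bar>f y\<bar> \<le> C"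
  shows "ap (s + t) f x = ap s (ap t f) x"
proof -
  have sum: "(\<lambda>p. norm (case p of (w, y) \<Rightarrow> P s x w * P t w y * f y)) summable_on E \<times> E"
    unfolding Infinite_Sum.abs_summable_on_Sigma_iff
  proof (intro conjI ballI)
    fix w assume w: "w \<in> E"
    have "(\<lambda>y. P t w y * (P s x w * \<bar>f y\<bar>)) summable_on E"
      using assms w P_nonneg[of s x w]
      by (intro P_mult_summable[where C = "P s x w * C"]) (auto simp: abs_mult intro!: mult_left_mono)
    then show "(\<lambda>y. norm (case (w, y) of (w, y) \<Rightarrow> P s x w * P t w y * f y)) summable_on E"
      by (rule summable_on_cong[THEN iffD1, rotated]) (use assms w P_nonneg in \<open>simp add: abs_mult\<close>)
  next
    have eq: "infsum (\<lambda>y. norm (case (w, y) of (w, y) \<Rightarrow> P s x w * P t w y * f y)) E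
        = P s x w * ap t (\<lambda>y. \<bar>f y\<bar>) w" if "w \<in> E" for w
    proof -
      have "infsum (\<lambda>y. norm (case (w, y) of (w, y) \<Rightarrow> P s x w * P t w y * f y)) E
          = infsum (\<lambda>y. P s x w * (P t w y * \<bar>f y\<bar>)) E"
        using assms that P_nonneg by (intro infsum_cong) (simp add: abs_mult)
      then show ?thesis by (simp add: infsum_cmult_right' semigroup_apply_def)
    qed
    have "(\<lambda>w. P s x w * ap t (\<lambda>y. \<bar>f y\<bar>) w) summable_on E"
      using assms by (intro P_mult_summable[where C = C] ap_bound) auto
    then have "(\<lambda>w. norm (P s x w * ap t (\<lambda>y. \<bar>f y\<bar>) w)) summable_on E"
      by (simp only: summable_on_iff_abs_summable_on_real[symmetric])
    then show "(\<lambda>w. norm (infsum (\<lambda>y. norm (case (w, y) of (w, y) \<Rightarrow> P s x w * P t w y * f y)) E)) summable_on E"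
      by (rule summable_on_cong[THEN iffD1, rotated]) (simp only: eq)
  qed
  have "ap (s + t) f x = (\<Sum>\<^sub>\<infinity>y\<in>E. (\<Sum>\<^sub>\<infinity>w\<in>E. P s x w * P t w y) * f y)"
    unfolding semigroup_apply_def
    using feller assms by (intro infsum_cong) (auto simp: feller_semigroup_def markov_semigroup_def matrix_prod_def)
  also have "\<dots> = (\<Sum>\<^sub>\<infinity>y\<in>E. \<Sum>\<^sub>\<infinity>w\<in>E. P s x w * P t w y * f y)"
    by (simp add: infsum_cmult_left')
  also have "\<dots> = (\<Sum>\<^sub>\<infinity>w\<in>E. \<Sum>\<^sub>\<infinity>y\<in>E. P s x w * P t w y * f y)"
    by (rule infsum_swap_banach[symmetric]) (rule Infinite_Sum.abs_summable_summable[OF sum])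
  also have "\<dots> = ap s (ap t f) x"
    by (simp add: semigroup_apply_def mult.assoc infsum_cmult_right')
  finally show ?thesis .
qed

lemma ap_C0: "0 \<le> t \<Longrightarrow> f \<in> C0 E \<Longrightarrow> ap t f \<in> C0 E"
  using feller by (auto simp: feller_semigroup_def)

lemma ap_0: "x \<in> E \<Longrightarrow> ap 0 f x = f x"
proof -
  assume x: "x \<in> E"
  have "(\<Sum>\<^sub>\<infinity>y\<in>E. P 0 x y * f y) = (\<Sum>\<^sub>\<infinity>y\<in>{x}. f y)"
    using x by (intro infsum_cong_neutral) (auto simp: P_0)
  then show ?thesis by (simp add: semigroup_apply_def)
qed

text \<open>Contraction reduces to continuity at time 0: for s \<le> t the difference is, up to
  sign, \<open>ap s\<close> applied to \<open>ap (t - s) f - f\<close>.\<close>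

lemma ap_uniformly_continuous:
  assumes "f \<in> C0 E" "0 < e"
  shows "\<exists>r>0. \<forall>s\<ge>0. \<forall>t\<ge>0. \<bar>s - t\<bar> < r \<longrightarrow> (\<forall>x\<in>E. \<bar>ap s f x - ap t f x\<bar> \<le> e)"
proof -
  obtain C where C: "\<And>x. x \<in> E \<Longrightarrow> \<bar>f x\<bar> \<le> C" using C0_bounded[OF assms(1)] by metis
  have "uniform_limit E (\<lambda>t. ap t f) f (at_right 0)"
    using feller assms by (auto simp: feller_semigroup_def)
  then have "\<forall>\<^sub>F h in at_right 0. \<forall>x\<in>E. dist (ap h f x) (f x) < e"
    using assms(2) by (rule uniform_limitD)
  then obtain r where r: "0 < r" "\<And>h x. 0 < h \<Longrightarrow> h < r \<Longrightarrow> x \<in> E \<Longrightarrow> \<bar>ap h f x - f x\<bar> < e"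
    by (auto simp: eventually_at_right_field dist_real_def)
  have step: "\<bar>ap (s + h) f x - ap s f x\<bar> \<le> e" if "0 \<le> s" "0 \<le> h" "h < r" "x \<in> E" for s h x
  proof (cases "h = 0")
    case False
    have "ap (s + h) f x - ap s f x = ap s (\<lambda>y. ap h f y - f y) x"
      using that C by (simp add: ap_semigroup[OF _ _ _ C] ap_diff[OF _ _ ap_bound[OF _ _ C] C])
    then show ?thesis
      using that False ap_bound[of s x "\<lambda>y. ap h f y - f y" e] r(2)[of h] by (simp add: less_imp_le)
  qed (use assms in simp)
  show ?thesis
  proof (intro exI[of _ r] conjI allI impI ballI)
    fix s t x assume "0 \<le> s" "0 \<le> t" "\<bar>s - t\<bar> < r" "x \<in> E"
    then show "\<bar>ap s f x - ap t f x\<bar> \<le> e"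
      using step[of s "t - s" x] step[of t "s - t" x] by (cases "s \<le> t") auto
  qed (rule r(1))
qed

text \<open>Conservativity makes the difference quotients of the rows converge in \<open>l\<^sup>1\<close>.\<close>

lemma quotient_l1:
  assumes x: "x \<in> E"
  shows "\<exists>\<eta>. (\<eta> \<longlongrightarrow> 0) (at_right 0) \<and>
    (\<forall>h>0. \<forall>f C. (\<forall>y\<in>E. \<bar>f y\<bar> \<le> C) \<longrightarrow>
       \<bar>(ap h f x - f x) / h - (\<Sum>y | y \<in> E \<and> Q x y \<noteq> 0. Q x y * f y)\<bar> \<le> C * \<eta> h)"
proof (intro exI conjI allI impI)
  define F where "F = insert x {y\<in>E. Q x y \<noteq> 0}"
  define q where "q = (\<lambda>h y. (P h x y - of_bool (x = y)) / h)"
  \<comment> \<open>As the rows of \<open>P h\<close> sum to 1, the mass outside F divided by h is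
    minus the sum of \<open>q h\<close> over F. It tends to minus the row sum of Q, which is
    0.\<close>
  define \<eta> where "\<eta> = (\<lambda>h. (\<Sum>y\<in>F. \<bar>q h y - Q x y\<bar>) - (\<Sum>y\<in>F. q h y))"
  have F: "finite F" "F \<subseteq> E" "x \<in> F" using x finite_row by (auto simp: F_def)
  have QF: "(\<Sum>y | y \<in> E \<and> Q x y \<noteq> 0. Q x y * f y) = (\<Sum>y\<in>F. Q x y * f y)" for f
    using F by (intro sum.mono_neutral_left) (auto simp: F_def)
  have Q0: "(\<Sum>y\<in>F. Q x y) = 0" using QF[of "\<lambda>_. 1"] row_sum[OF x] by simp
  have lim: "((\<lambda>h. q h y) \<longlongrightarrow> Q x y) (at_right 0)" if "y \<in> F" for y
    unfolding q_def using q_matrix[OF x, of y] that F by auto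
  have "(\<eta> \<longlongrightarrow> (\<Sum>y\<in>F. \<bar>Q x y - Q x y\<bar>) - (\<Sum>y\<in>F. Q x y)) (at_right 0)"
    unfolding \<eta>_def by (intro tendsto_intros lim)
  then show "(\<eta> \<longlongrightarrow> 0) (at_right 0)" using Q0 by simp
  fix h C :: real and f assume h: "0 < h" and "\<forall>y\<in>E. \<bar>f y\<bar> \<le> C"
  then have C: "\<bar>f y\<bar> \<le> C" if "y \<in> E" for y using that by blast
  have "ap h f x = (\<Sum>\<^sub>\<infinity>y\<in>F \<union> (E - F). P h x y * f y)"
    unfolding semigroup_apply_def using F by (simp add: Un_absorb1)
  also have "\<dots> = (\<Sum>\<^sub>\<infinity>y\<in>F. P h x y * f y) + (\<Sum>\<^sub>\<infinity>y\<in>E - F. P h x y * f y)"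
    using F h x C by (intro infsum_Un_disjoint P_mult_summable[where C = C]) auto
  finally have split: "ap h f x = (\<Sum>y\<in>F. P h x y * f y) + (\<Sum>\<^sub>\<infinity>y\<in>E - F. P h x y * f y)"
    using F by simp
  have Psum: "P h x summable_on A" if "A \<subseteq> E" for A
    using P_sum[of h x] h x that by (metis less_imp_le summable_on_def summable_on_subset_banach)
  have "1 = (\<Sum>\<^sub>\<infinity>y\<in>F \<union> (E - F). P h x y)"
    using P_sum[of h x] h x F by (simp add: Un_absorb1 infsumI)
  also have "\<dots> = (\<Sum>\<^sub>\<infinity>y\<in>F. P h x y) + (\<Sum>\<^sub>\<infinity>y\<in>E - F. P h x y)"
    using F by (intro infsum_Un_disjoint Psum) auto
  finally have rest: "(\<Sum>\<^sub>\<infinity>y\<in>E - F. P h x y) = 1 - (\<Sum>y\<in>F. P h x y)" using F by simp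
  have qF: "(\<Sum>y\<in>F. q h y * g y) = ((\<Sum>y\<in>F. P h x y * g y) - g x) / h" for g
  proof -
    have "(\<Sum>y\<in>F. (P h x y - of_bool (x = y)) * g y) = (\<Sum>y\<in>F. P h x y * g y) - (\<Sum>y\<in>F. if x = y then g y else 0)"
      by (simp add: left_diff_distrib sum_subtractf if_distrib cong: if_cong)
         (intro sum.cong refl, auto)
    then show ?thesis using F by (simp add: q_def sum_divide_distrib[symmetric])
  qed
  have C0: "0 \<le> C" using C[OF x] by linarith
  have "(ap h f x - f x) / h - (\<Sum>y\<in>F. Q x y * f y)
      = (\<Sum>y\<in>F. (q h y - Q x y) * f y) + (\<Sum>\<^sub>\<infinity>y\<in>E - F. P h x y * f y) / h"
    unfolding left_diff_distrib sum_subtractf qF split by (simp add: add_divide_distrib diff_divide_distrib)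
  moreover have "\<bar>\<Sum>y\<in>F. (q h y - Q x y) * f y\<bar> \<le> C * (\<Sum>y\<in>F. \<bar>q h y - Q x y\<bar>)"
  proof -
    have "\<bar>\<Sum>y\<in>F. (q h y - Q x y) * f y\<bar> \<le> (\<Sum>y\<in>F. \<bar>(q h y - Q x y) * f y\<bar>)" by (rule sum_abs)
    also have "\<dots> \<le> (\<Sum>y\<in>F. C * \<bar>q h y - Q x y\<bar>)"
      using C F by (intro sum_mono) (auto simp: abs_mult mult.commute intro!: mult_right_mono)
    finally show ?thesis by (simp add: sum_distrib_left)
  qed
  moreover have "\<bar>(\<Sum>\<^sub>\<infinity>y\<in>E - F. P h x y * f y) / h\<bar> \<le> C * (- (\<Sum>y\<in>F. q h y))"
  proof -
    have "\<bar>\<Sum>\<^sub>\<infinity>y\<in>E - F. P h x y * f y\<bar> \<le> C * (1 - (\<Sum>y\<in>F. P h x y))"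
      using P_mult_bound[of h x f C "E - F"] h x C by (simp add: rest)
    then have "\<bar>(\<Sum>\<^sub>\<infinity>y\<in>E - F. P h x y * f y) / h\<bar> \<le> C * (1 - (\<Sum>y\<in>F. P h x y)) / h"
      using h by (simp add: divide_right_mono)
    also have "\<dots> = C * (- (\<Sum>y\<in>F. q h y))"
    proof -
      have "(\<Sum>y\<in>F. q h y) = ((\<Sum>y\<in>F. P h x y) - 1) / h" using qF[of "\<lambda>_. 1"] by simp
      then have "- (\<Sum>y\<in>F. q h y) = (1 - (\<Sum>y\<in>F. P h x y)) / h"
        by (metis minus_diff_eq minus_divide_left)
      then show ?thesis by simp
    qed
    finally show ?thesis .
  qed
  ultimately show "\<bar>(ap h f x - f x) / h - (\<Sum>y | y \<in> E \<and> Q x y \<noteq> 0. Q x y * f y)\<bar> \<le> C * \<eta> h"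
    unfolding QF \<eta>_def right_diff_distrib by linarith
qed

text \<open>Write \<open>ap t f = ap h (ap (t - h) f)\<close>: the inner functions share the bound
  of f, so the l^1 convergence of the rows is uniform over them. Continuity in time then replaces t
  - h by t in the finite sum.\<close>

lemma backward_equation:
  assumes x: "x \<in> E" and t: "0 < t" and f: "f \<in> C0 E"
  shows "((\<lambda>h. (ap t f x - ap (t - h) f x) / h) \<longlongrightarrow> (\<Sum>y | y \<in> E \<and> Q x y \<noteq> 0. Q x y * ap t f y)) (at_right 0)"
proof -
  obtain C where C: "\<And>x. x \<in> E \<Longrightarrow> \<bar>f x\<bar> \<le> C" using C0_bounded[OF f] by metis
  obtain \<eta> where \<eta>: "(\<eta> \<longlongrightarrow> 0) (at_right 0)"
    "\<And>h f C. 0 < h \<Longrightarrow> \<forall>y\<in>E. \<bar>f y\<bar> \<le> C \<Longrightarrow>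
       \<bar>(ap h f x - f x) / h - (\<Sum>y | y \<in> E \<and> Q x y \<noteq> 0. Q x y * f y)\<bar> \<le> C * \<eta> h"
    using quotient_l1[OF x] by blast
  let ?S = "\<lambda>s. \<Sum>y | y \<in> E \<and> Q x y \<noteq> 0. Q x y * ap s f y"
  have cont: "((\<lambda>h. ap (t - h) f y) \<longlongrightarrow> ap t f y) (at_right 0)" if y: "y \<in> E" for y
  proof (rule tendstoI)
    fix e :: real assume "0 < e"
    obtain r where r: "0 < r" "\<And>s s'. 0 \<le> s \<Longrightarrow> 0 \<le> s' \<Longrightarrow> \<bar>s - s'\<bar> < r \<Longrightarrow> \<bar>ap s f y - ap s' f y\<bar> \<le> e / 2"
      using ap_uniformly_continuous[OF f half_gt_zero[OF \<open>0 < e\<close>]] y by metis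
    have "dist (ap (t - h) f y) (ap t f y) < e" if "0 < h" "h < min r t" for h
      using r(2)[of "t - h" t] that t \<open>0 < e\<close> by (simp add: dist_real_def)
    then show "\<forall>\<^sub>F h in at_right 0. dist (ap (t - h) f y) (ap t f y) < e"
      unfolding eventually_at_right_field using r(1) t by (intro exI[of _ "min r t"]) auto
  qed
  have 1: "((\<lambda>h. ?S (t - h)) \<longlongrightarrow> ?S t) (at_right 0)"
    by (intro tendsto_intros cont) auto
  have "((\<lambda>h. (ap t f x - ap (t - h) f x) / h - ?S (t - h)) \<longlongrightarrow> 0) (at_right 0)"
  proof (rule tendsto_0_le[where K = C, OF \<eta>(1)])
    have "norm ((ap t f x - ap (t - h) f x) / h - ?S (t - h)) \<le> norm (\<eta> h) * C" if h: "0 < h" "h < t" for h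
    proof -
      have "ap t f x = ap h (ap (t - h) f) x"
        using ap_semigroup[of h "t - h" x f C] h x C by simp
      moreover have "\<bar>ap (t - h) f y\<bar> \<le> C" if "y \<in> E" for y
        using that h C by (intro ap_bound) auto
      ultimately have "\<bar>(ap t f x - ap (t - h) f x) / h - ?S (t - h)\<bar> \<le> C * \<eta> h"
        using \<eta>(2)[of h "ap (t - h) f" C] h by simp
      also have "\<dots> \<le> C * \<bar>\<eta> h\<bar>" using C[OF x] by (intro mult_left_mono) auto
      finally show ?thesis by (simp add: mult.commute)
    qed
    then show "\<forall>\<^sub>F h in at_right 0. norm ((ap t f x - ap (t - h) f x) / h - ?S (t - h)) \<le> norm (\<eta> h) * C"
      unfolding eventually_at_right_field using t by blast
  qed
  from tendsto_add[OF this 1] show ?thesis by simp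
qed

end

text \<open>
  Both sides of the intertwining relation, applied to an indicator function, solve the backward
  equation of the larger process; their difference vanishes by the maximum principle.
\<close>

lemma intertwining:
  assumes "feller_q_process E P Q" "feller_q_process E' P' Q'"
    and L: "\<And>x y. x \<in> E \<Longrightarrow> y \<in> E' \<Longrightarrow> 0 \<le> L x y"
      "\<And>x. x \<in> E \<Longrightarrow> finite {y\<in>E'. L x y \<noteq> 0}"
      "\<And>x. x \<in> E \<Longrightarrow> (\<Sum>y | y \<in> E' \<and> L x y \<noteq> 0. L x y) = 1"
      "\<And>y. y \<in> E' \<Longrightarrow> (\<lambda>x. L x y) \<in> C0 E"
    and comm: "\<And>x y. x \<in> E \<Longrightarrow> y \<in> E' \<Longrightarrow>
      (\<Sum>z | z \<in> E \<and> Q x z \<noteq> 0. Q x z * L z y) = (\<Sum>z | z \<in> E' \<and> L x z \<noteq> 0. L x z * Q' z y)"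
    and t: "0 \<le> t" and x: "x \<in> E" and y: "y \<in> E'"
  shows "matrix_prod E (P t) L x y = matrix_prod E' L (P' t) x y"
proof -
  interpret A: feller_q_process E P Q by fact
  interpret B: feller_q_process E' P' Q' by fact
  define f where "f = (\<lambda>x. L x y)"
  define g where "g = (\<lambda>z. of_bool (z = y) :: real)"
  have f: "f \<in> C0 E" unfolding f_def by (rule L(4)[OF y])
  have "{z \<in> E'. e \<le> \<bar>g z\<bar>} \<subseteq> {y}" if "0 < e" for e using that by (auto simp: g_def)
  then have g: "g \<in> C0 E'" unfolding C0_def by (auto intro: finite_subset)
  define S where "S = (\<lambda>x. {z\<in>E'. L x z \<noteq> 0})"
  define v where "v = (\<lambda>t. A.ap t f)"
  define w where "w = (\<lambda>t x. \<Sum>z\<in>S x. L x z * B.ap t g z)"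
  have S: "finite (S x)" "S x \<subseteq> E'" "(\<Sum>z\<in>S x. L x z) = 1" if "x \<in> E" for x
    using L(2,3)[OF that] by (auto simp: S_def)
  have w_bound: "\<bar>\<Sum>z\<in>S x. L x z * h z\<bar> \<le> c" if "x \<in> E" "\<And>z. z \<in> E' \<Longrightarrow> \<bar>h z\<bar> \<le> c" for x h c
  proof -
    have "\<bar>\<Sum>z\<in>S x. L x z * h z\<bar> \<le> (\<Sum>z\<in>S x. \<bar>L x z * h z\<bar>)" by (rule sum_abs)
    also have "\<dots> \<le> (\<Sum>z\<in>S x. L x z * c)"
    proof (rule sum_mono)
      fix z assume "z \<in> S x"
      then have "z \<in> E'" using S(2)[OF that(1)] by auto
      then show "\<bar>L x z * h z\<bar> \<le> L x z * c"
        using L(1)[OF that(1), of z] that(2)[of z] by (auto simp: abs_mult intro!: mult_left_mono)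
    qed
    also have "\<dots> = c" using S(3)[OF that(1)] by (simp add: sum_distrib_right[symmetric])
    finally show ?thesis .
  qed
  have w_C0: "w s \<in> C0 E" if "0 \<le> s" for s
    unfolding C0_def
  proof (clarify)
    fix e :: real assume "0 < e"
    \<comment> \<open>Off the finite set T the function h is small and, the rows of L having sum 1,
      contributes at most e / 2; on T there remains a finite combination of columns of L, which lie
      in \<open>C0\<close>.\<close>
    define h where "h = B.ap s g"
    define T where "T = {z\<in>E'. e / 2 \<le> \<bar>h z\<bar>}"
    have T: "finite T" "T \<subseteq> E'"
      using B.ap_C0[OF that g] half_gt_zero[OF \<open>0 < e\<close>] unfolding T_def h_def C0_def by blast+
    have "(\<lambda>x. \<Sum>z\<in>T. h z * L x z) \<in> C0 E"
      using T by (intro C0_sum C0_cmult L(4)) auto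
    then have "finite {x\<in>E. e / 2 \<le> \<bar>\<Sum>z\<in>T. h z * L x z\<bar>}"
      using half_gt_zero[OF \<open>0 < e\<close>] unfolding C0_def by blast
    moreover have "e / 2 \<le> \<bar>\<Sum>z\<in>T. h z * L x z\<bar>" if "x \<in> E" "e \<le> \<bar>w s x\<bar>" for x
    proof -
      have "w s x = (\<Sum>z\<in>S x. L x z * (if z \<in> T then h z else 0)) + (\<Sum>z\<in>S x. L x z * (if z \<in> T then 0 else h z))"
        unfolding w_def h_def sum.distrib[symmetric] by (intro sum.cong) auto
      moreover have "(\<Sum>z\<in>S x. L x z * (if z \<in> T then h z else 0)) = (\<Sum>z\<in>T. h z * L x z)"
        using T S[OF that(1)]
        by (intro sum.mono_neutral_cong) (auto simp: S_def)
      moreover have "\<bar>\<Sum>z\<in>S x. L x z * (if z \<in> T then 0 else h z)\<bar> \<le> e / 2"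
        using that(1) \<open>0 < e\<close> by (intro w_bound) (auto simp: T_def not_le intro: less_imp_le)
      ultimately show ?thesis using that(2) by linarith
    qed
    ultimately show "finite {x\<in>E. e \<le> \<bar>w s x\<bar>}"
      by (elim rev_finite_subset) auto
  qed
  have w_cont: "\<exists>r>0. \<forall>s\<ge>0. \<forall>t\<ge>0. \<bar>s - t\<bar> < r \<longrightarrow> (\<forall>x\<in>E. \<bar>w s x - w t x\<bar> \<le> e)" if e: "0 < e" for e
  proof -
    obtain r where r: "0 < r" "\<And>s t x. 0 \<le> s \<Longrightarrow> 0 \<le> t \<Longrightarrow> \<bar>s - t\<bar> < r \<Longrightarrow> x \<in> E' \<Longrightarrow> \<bar>B.ap s g x - B.ap t g x\<bar> \<le> e"
      using B.ap_uniformly_continuous[OF g e] by blast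
    have "\<bar>w s x - w t x\<bar> \<le> e" if "0 \<le> s" "0 \<le> t" "\<bar>s - t\<bar> < r" "x \<in> E" for s t x
    proof -
      have "w s x - w t x = (\<Sum>z\<in>S x. L x z * (B.ap s g z - B.ap t g z))"
        by (simp add: w_def right_diff_distrib sum_subtractf)
      then show ?thesis using w_bound[OF that(4), of "\<lambda>z. B.ap s g z - B.ap t g z" e] r(2)[OF that(1-3)] by simp
    qed
    then show ?thesis using r(1) by blast
  qed
  have Q_w: "(\<Sum>z\<in>S x. L x z * (\<Sum>u | u \<in> E' \<and> Q' z u \<noteq> 0. Q' z u * h u))
      = (\<Sum>z | z \<in> E \<and> Q x z \<noteq> 0. Q x z * (\<Sum>u\<in>S z. L z u * h u))" if x: "x \<in> E" for x h
  proof -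
    define N where "N = {z \<in> E. Q x z \<noteq> 0}"
    define N' where "N' = (\<lambda>z. {u \<in> E'. Q' z u \<noteq> 0})"
    \<comment> \<open>A finite set carrying all the inner sums, on which \<open>comm\<close>, stated
      entry by entry, extends linearly to arbitrary h.\<close>
    define Y where "Y = (\<Union>z\<in>N. S z) \<union> (\<Union>z\<in>S x. N' z)"
    have N: "finite N" "N \<subseteq> E" and N': "\<And>z. z \<in> E' \<Longrightarrow> finite (N' z)" "\<And>z. N' z \<subseteq> E'"
      using A.finite_row[OF x] B.finite_row by (auto simp: N_def N'_def)
    have fin: "finite (S z)" "S z \<subseteq> E'" if "z \<in> insert x N" for z
      using that S(1,2)[of z] N(2) x by auto
    have Y: "finite Y"
      unfolding Y_def using N(1) fin N'(1) by (intro finite_UnI finite_UN_I) auto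
    have "Y \<subseteq> E'" unfolding Y_def using fin(2) N'(2) by blast
    note Y = Y this
    have "(\<Sum>z\<in>S x. L x z * (\<Sum>u\<in>N' z. Q' z u * h u)) = (\<Sum>z\<in>S x. L x z * (\<Sum>u\<in>Y. Q' z u * h u))"
      using Y by (intro sum.cong refl arg_cong2[where f = "(*)"] sum.mono_neutral_left) (auto simp: Y_def N'_def)
    also have "\<dots> = (\<Sum>u\<in>Y. (\<Sum>z\<in>S x. L x z * Q' z u) * h u)"
      unfolding sum_distrib_left sum_distrib_right by (subst sum.swap) (simp add: mult_ac)
    also have "\<dots> = (\<Sum>u\<in>Y. (\<Sum>z\<in>N. Q x z * L z u) * h u)"
      using Y comm[OF x] by (intro sum.cong refl) (auto simp: N_def S_def)
    also have "\<dots> = (\<Sum>z\<in>N. Q x z * (\<Sum>u\<in>Y. L z u * h u))"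
      unfolding sum_distrib_left sum_distrib_right by (subst sum.swap) (simp add: mult_ac)
    also have "\<dots> = (\<Sum>z\<in>N. Q x z * (\<Sum>u\<in>S z. L z u * h u))"
      using Y by (intro sum.cong refl arg_cong2[where f = "(*)"] sum.mono_neutral_right) (auto simp: Y_def S_def)
    finally show ?thesis by (simp add: N_def N'_def)
  qed
  have w_deriv: "((\<lambda>h. (w t x - w (t - h) x) / h) \<longlongrightarrow> (\<Sum>y | y \<in> E \<and> Q x y \<noteq> 0. Q x y * w t y)) (at_right 0)"
    if "0 < t" "x \<in> E" for t x
  proof -
    have "((\<lambda>h. \<Sum>z\<in>S x. L x z * ((B.ap t g z - B.ap (t - h) g z) / h)) \<longlongrightarrow>
       (\<Sum>z\<in>S x. L x z * (\<Sum>u | u \<in> E' \<and> Q' z u \<noteq> 0. Q' z u * B.ap t g u))) (at_right 0)"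
      using that g by (intro tendsto_intros B.backward_equation) (auto simp: S_def)
    moreover have "(\<Sum>z\<in>S x. L x z * ((B.ap t g z - B.ap (t - h) g z) / h)) = (w t x - w (t - h) x) / h" for h
      by (simp add: w_def sum_subtractf[symmetric] sum_divide_distrib right_diff_distrib)
    ultimately show ?thesis unfolding Q_w[OF that(2)] by (simp add: w_def)
  qed
  have cont2: "\<exists>r>0. \<forall>s\<ge>0. \<forall>t\<ge>0. \<bar>s - t\<bar> < r \<longrightarrow> (\<forall>x\<in>E. \<bar>(c * (v s x - w s x)) - (c * (v t x - w t x))\<bar> \<le> e)"
    if e: "0 < e" and "\<bar>c\<bar> = 1" for e c :: real
  proof -
    obtain r where r: "0 < r" "\<And>s t x. 0 \<le> s \<Longrightarrow> 0 \<le> t \<Longrightarrow> \<bar>s - t\<bar> < r \<Longrightarrow> x \<in> E \<Longrightarrow> \<bar>v s x - v t x\<bar> \<le> e / 2"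
      using A.ap_uniformly_continuous[OF f, of "e / 2"] half_gt_zero[OF e] unfolding v_def by metis
    obtain r' where r': "0 < r'" "\<And>s t x. 0 \<le> s \<Longrightarrow> 0 \<le> t \<Longrightarrow> \<bar>s - t\<bar> < r' \<Longrightarrow> x \<in> E \<Longrightarrow> \<bar>w s x - w t x\<bar> \<le> e / 2"
      using w_cont[of "e / 2"] half_gt_zero[OF e] by metis
    have "\<bar>(c * (v s x - w s x)) - (c * (v t x - w t x))\<bar> \<le> e"
      if "0 \<le> s" "0 \<le> t" "\<bar>s - t\<bar> < min r r'" "x \<in> E" for s t x
    proof -
      have "\<bar>(c * (v s x - w s x)) - (c * (v t x - w t x))\<bar> = \<bar>(v s x - v t x) - (w s x - w t x)\<bar>"
        using \<open>\<bar>c\<bar> = 1\<close> by (simp add: right_diff_distrib[symmetric] abs_mult)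
      then show ?thesis using r(2)[of s t x] r'(2)[of s t x] that by linarith
    qed
    then show ?thesis using r(1) r'(1) by (intro exI[of _ "min r r'"]) auto
  qed
  have init: "v 0 x = w 0 x" if x: "x \<in> E" for x
  proof -
    have "w 0 x = (\<Sum>z\<in>S x. L x z * g z)"
      unfolding w_def using S[OF x] by (intro sum.cong) (auto simp: B.ap_0)
    also have "\<dots> = L x y"
      using S(1)[OF x] y by (simp add: g_def S_def of_bool_def if_distrib cong: if_cong)
    finally show ?thesis using x by (simp add: v_def A.ap_0 f_def)
  qed
  \<comment> \<open>The signs c = 1 and c = -1 bound the difference from both sides.\<close>
  have "c * (v t x - w t x) \<le> 0" if c: "\<bar>c\<bar> = 1" for c :: real
  proof (rule maximum_principle[where d = "\<lambda>t x. c * (v t x - w t x)" and E = E and Q = Q])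
    show "(\<lambda>x. c * (v t x - w t x)) \<in> C0 E" if "0 \<le> t" for t
      unfolding v_def using that by (intro C0_cmult C0_diff w_C0 A.ap_C0 f)
    show "((\<lambda>h. (c * (v t x - w t x) - c * (v (t - h) x - w (t - h) x)) / h) \<longlongrightarrow>
        (\<Sum>y | y \<in> E \<and> Q x y \<noteq> 0. Q x y * (c * (v t y - w t y)))) (at_right 0)"
      if "0 < t" "x \<in> E" for t x
    proof -
      have "((\<lambda>h. c * ((v t x - v (t - h) x) / h - (w t x - w (t - h) x) / h)) \<longlongrightarrow>
        c * ((\<Sum>y | y \<in> E \<and> Q x y \<noteq> 0. Q x y * v t y) - (\<Sum>y | y \<in> E \<and> Q x y \<noteq> 0. Q x y * w t y))) (at_right 0)"
        unfolding v_def using that f by (intro tendsto_intros w_deriv A.backward_equation)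
      moreover have "c * ((v t x - v (t - h) x) / h - (w t x - w (t - h) x) / h)
          = (c * (v t x - w t x) - c * (v (t - h) x - w (t - h) x)) / h" for h
        by (simp add: diff_divide_distrib[symmetric] algebra_simps)
      moreover have "c * ((\<Sum>y | y \<in> E \<and> Q x y \<noteq> 0. Q x y * v t y) - (\<Sum>y | y \<in> E \<and> Q x y \<noteq> 0. Q x y * w t y))
          = (\<Sum>y | y \<in> E \<and> Q x y \<noteq> 0. Q x y * (c * (v t y - w t y)))"
        by (simp add: sum_subtractf[symmetric] sum_distrib_left right_diff_distrib mult_ac)
      ultimately show ?thesis by simp
    qed
  qed (use cont2 c init A.Q_nonneg A.row_sum t x in auto)
  from this[of 1] this[of "- 1"] have "v t x = w t x" by simp
  moreover have "matrix_prod E (P t) L x y = v t x"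
    by (simp add: matrix_prod_def v_def f_def semigroup_apply_def)
  moreover have "matrix_prod E' L (P' t) x y = w t x"
  proof -
    have "B.ap t g z = P' t z y" for z
    proof -
      have "(\<Sum>\<^sub>\<infinity>u\<in>E'. P' t z u * g u) = (\<Sum>\<^sub>\<infinity>u\<in>{y}. P' t z u)"
        using y by (intro infsum_cong_neutral) (auto simp: g_def)
      then show ?thesis by (simp add: semigroup_apply_def)
    qed
    then have "w t x = (\<Sum>\<^sub>\<infinity>z\<in>S x. L x z * P' t z y)" using S[OF x] by (simp add: w_def)
    also have "\<dots> = (\<Sum>\<^sub>\<infinity>z\<in>E'. L x z * P' t z y)"
      by (intro infsum_cong_neutral) (auto simp: S_def)
    finally show ?thesis by (simp add: matrix_prod_def)
  qed
  ultimately show ?thesis by simp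
qed

section \<open>Commutation of the generators with the kernel\<close>

context jacobi_parameters
begin

text \<open>For neighbours, the difference of the \<open>hat\<close> values is the gap times a sum
  of the two entries. That sum is kept for the pair (0, 1), where it is at least \<open>l 0\<close>;
  everything else is bounded below by the gaps or by 1. The extra factor \<open>l 0\<close> gives
  the decay of the kernel.\<close>

lemma vandermonde_hat_ge:
  assumes "lam \<in> GT_plus (Suc N)" "1 \<le> N"
  defines "l \<equiv> shifted (Suc N) lam"
  shows "real (l 0) * (\<Prod>i<N. real (l i) - real (l (Suc i))) \<le> vandermonde (Suc N) (\<lambda>i. hat a b (l i))"
proof -
  have less: "l j < l i" if "i < j" "j < Suc N" for i j
    using shifted_less[OF assms(1) that] by (simp add: l_def)
  have ge1: "1 \<le> hat a b (l i) - hat a b (l j)" if "i < j" "j < Suc N" for i j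
  proof -
    have "1 * 1 \<le> (real (l i) - real (l j)) * (real (l i) + real (l j) + 2 * e)"
      using less[OF that] eps_nonneg by (intro mult_mono) auto
    then show ?thesis by (simp add: hat_diff)
  qed
  define w :: "nat \<Rightarrow> real" where "w = (\<lambda>i. if i = 0 then real (l 0) else 1)"
  have "(\<Prod>i<N. (real (l i) - real (l (Suc i))) * w i) \<le> (\<Prod>i<N. \<Prod>j\<in>{i<..<Suc N}. hat a b (l i) - hat a b (l j))"
  proof (rule prod_mono)
    fix i assume "i \<in> {..<N}"
    then have i: "i < N" by simp
    have pos: "0 < real (l i) - real (l (Suc i))" using less[of i "Suc i"] i by simp
    have w: "0 \<le> w i" "w i \<le> real (l i) + real (l (Suc i)) + 2 * e"
      using less[of i "Suc i"] i eps_nonneg by (auto simp: w_def)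
    have "(real (l i) - real (l (Suc i))) * w i \<le> hat a b (l i) - hat a b (l (Suc i))"
      unfolding hat_diff using pos w by (intro mult_left_mono) auto
    also have "\<dots> \<le> (hat a b (l i) - hat a b (l (Suc i))) * (\<Prod>j\<in>{Suc i<..<Suc N}. hat a b (l i) - hat a b (l j))"
    proof -
      have "1 \<le> (\<Prod>j\<in>{Suc i<..<Suc N}. hat a b (l i) - hat a b (l j))"
        using ge1 by (intro prod_ge_1) auto
      then show ?thesis using ge1[of i "Suc i"] i by (simp add: mult_le_cancel_left1)
    qed
    also have "\<dots> = (\<Prod>j\<in>insert (Suc i) {Suc i<..<Suc N}. hat a b (l i) - hat a b (l j))"
      by (subst prod.insert) auto
    also have "insert (Suc i) {Suc i<..<Suc N} = {i<..<Suc N}" using i by auto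
    finally show "0 \<le> (real (l i) - real (l (Suc i))) * w i \<and>
        (real (l i) - real (l (Suc i))) * w i \<le> (\<Prod>j\<in>{i<..<Suc N}. hat a b (l i) - hat a b (l j))"
      using pos w by simp
  qed
  moreover have "(\<Prod>i<N. w i) = real (l 0)"
    using assms(2) by (cases N) (simp_all add: w_def prod.lessThan_Suc_shift del: prod.lessThan_Suc)
  moreover have "{N<..<Suc N} = {}" by auto
  ultimately show ?thesis
    by (simp add: vandermonde_def prod.distrib mult.commute)
qed

text \<open>The kernel is a transform of \<open>green_det\<close> by Vandermonde products. The same
  products conjugate the generators, which is why they cancel in \<open>gen_kernel\<close>.\<close>

lemma kernel_eq:
  "\<exists>c>0. \<forall>lam\<in>GT_plus (Suc N). \<forall>mu\<in>GT_plus N. kernel N lam mu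
     = c * (green_det N (shifted (Suc N) lam) (shifted N mu)
         * (vandermonde N (\<lambda>i. hat a b (shifted N mu i)) / vandermonde (Suc N) (\<lambda>i. hat a b (shifted (Suc N) lam i))))"
proof -
  obtain K where K: "0 < K" "\<And>mu. mu \<in> GT_plus N \<Longrightarrow> Jacobi_multi jac N mu (\<lambda>_. 1)
      = K * vandermonde N (\<lambda>i. hat a b (shifted N mu i))" using Jacobi_multi_at_1[of N] by blast
  obtain K' where K': "0 < K'" "\<And>mu. mu \<in> GT_plus (Suc N) \<Longrightarrow> Jacobi_multi jac (Suc N) mu (\<lambda>_. 1)
      = K' * vandermonde (Suc N) (\<lambda>i. hat a b (shifted (Suc N) mu i))" using Jacobi_multi_at_1[of "Suc N"] by blast
  show ?thesis
    using K(1) K'(1) by (intro exI[of _ "(1 / 2) ^ N * K / K'"]) (simp add: kernel_def K(2) K'(2))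
qed

text \<open>In the form with consecutive rows, row i of the determinant is bounded by a constant
  times the gap \<open>l i - l (Suc i)\<close>. By \<open>vandermonde_hat_ge\<close> the denominator
  beats the product of gaps by a factor \<open>l 0\<close>, so large kernel entries force
  \<open>l 0\<close> into a bounded range, which leaves finitely many signatures.\<close>

lemma kernel_C0:
  assumes N: "1 \<le> N"
  shows "(\<lambda>lam. kernel N lam mu) \<in> C0 (GT_plus (Suc N))"
proof (cases "mu \<in> GT_plus N")
  case False
  then show ?thesis by (simp add: kernel_def)
next
  case mu: True
  obtain c where c: "0 < c" "\<And>lam. lam \<in> GT_plus (Suc N) \<Longrightarrow> kernel N lam mu
     = c * (green_det N (shifted (Suc N) lam) (shifted N mu)
         * (vandermonde N (\<lambda>i. hat a b (shifted N mu i)) / vandermonde (Suc N) (\<lambda>i. hat a b (shifted (Suc N) lam i))))"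
    using kernel_eq[of N] mu by blast
  let ?m = "shifted N mu"
  define B where "B = scale_step 0 * (\<Sum>j<N. stat (?m j))"
  define V where "V = vandermonde N (\<lambda>i. hat a b (?m i))"
  define C where "C = c * (fact N * B ^ N * V)"
  have B: "0 \<le> B" unfolding B_def using scale_step_pos stat_pos by (intro mult_nonneg_nonneg sum_nonneg) (auto intro: less_imp_le)
  have V: "0 < V" unfolding V_def by (rule vandermonde_hat_pos[OF jacobi_parameters_axioms mu])
  have bound: "\<bar>kernel N lam mu\<bar> * real (shifted (Suc N) lam 0) \<le> C" if lam: "lam \<in> GT_plus (Suc N)" for lam
  proof -
    let ?l = "shifted (Suc N) lam"
    define p where "p = (\<Prod>i<N. real (?l i) - real (?l (Suc i)))"
    define W where "W = vandermonde (Suc N) (\<lambda>i. hat a b (?l i))"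
    have less: "?l (Suc i) < ?l i" if "i < N" for i using shifted_less[OF lam, of i "Suc i"] that by simp
    have W: "0 < W" unfolding W_def by (rule vandermonde_hat_pos[OF jacobi_parameters_axioms lam])
    have "\<bar>green_det N ?l ?m\<bar> \<le> fact N * (\<Prod>i<N. B * (real (?l i) - real (?l (Suc i))))"
      unfolding green_det_eq_consecutive
    proof (rule ndet_abs_le)
      fix i j assume ij: "i < N" "j < N"
      let ?S = "\<Sum>r=?l (Suc i)..<?l i. scale_step r * of_bool (?m j \<le> r)"
      have "?S \<le> (\<Sum>r=?l (Suc i)..<?l i. scale_step 0)"
        using scale_step_le scale_step_pos[THEN less_imp_le] by (intro sum_mono) (auto simp: of_bool_def)
      then have "?S \<le> (real (?l i) - real (?l (Suc i))) * scale_step 0" using less[OF ij(1)] by (simp add: of_nat_diff)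
      moreover have "0 \<le> ?S" using scale_step_pos[THEN less_imp_le] by (intro sum_nonneg) auto
      moreover have "stat (?m j) \<le> (\<Sum>j<N. stat (?m j))"
        using ij stat_pos[THEN less_imp_le] by (intro member_le_sum) auto
      ultimately have "stat (?m j) * ?S \<le> (\<Sum>j<N. stat (?m j)) * ((real (?l i) - real (?l (Suc i))) * scale_step 0)"
        using stat_pos[THEN less_imp_le] \<open>0 \<le> ?S\<close> by (intro mult_mono) (auto intro: sum_nonneg)
      moreover have "0 \<le> stat (?m j) * ?S"
        using \<open>0 \<le> ?S\<close> stat_pos[of "?m j"] by simp
      ultimately show "\<bar>green (?l i) (?m j) - green (?l (Suc i)) (?m j)\<bar> \<le> B * (real (?l i) - real (?l (Suc i)))"
        using less[OF ij(1)] by (simp add: green_diff B_def mult_ac)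
    qed
    also have "\<dots> = fact N * B ^ N * p" by (simp add: p_def prod.distrib)
    finally have G: "\<bar>green_det N ?l ?m\<bar> \<le> fact N * B ^ N * p" .
    have "real (?l 0) * p \<le> W" unfolding p_def W_def by (rule vandermonde_hat_ge[OF lam N])
    have "\<bar>green_det N ?l ?m\<bar> * real (?l 0) \<le> fact N * B ^ N * p * real (?l 0)"
      using G by (intro mult_right_mono) auto
    also have "\<dots> \<le> fact N * B ^ N * W"
      using mult_left_mono[OF \<open>real (?l 0) * p \<le> W\<close>, of "fact N * B ^ N"] B by (simp add: mult_ac)
    finally have "\<bar>green_det N ?l ?m\<bar> * real (?l 0) / W \<le> fact N * B ^ N"
      using W by (simp add: pos_divide_le_eq)
    then have "c * V * (\<bar>green_det N ?l ?m\<bar> * real (?l 0) / W) \<le> c * V * (fact N * B ^ N)"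
      using c(1) V by (intro mult_left_mono) auto
    moreover have "\<bar>kernel N lam mu\<bar> * real (?l 0) = c * V * (\<bar>green_det N ?l ?m\<bar> * real (?l 0) / W)"
      unfolding c(2)[OF lam] V_def[symmetric] W_def[symmetric] using c(1) V W by (simp add: abs_mult)
    ultimately show ?thesis by (simp add: C_def mult_ac)
  qed
  show ?thesis
    unfolding C0_def
  proof clarify
    fix x :: real assume x: "0 < x"
    have "{lam \<in> GT_plus (Suc N). x \<le> \<bar>kernel N lam mu\<bar>} \<subseteq> GT_below (Suc N) (Suc (nat \<lfloor>C / x\<rfloor>))"
    proof clarify
      fix lam assume lam: "lam \<in> GT_plus (Suc N)" "x \<le> \<bar>kernel N lam mu\<bar>"
      have "x * real (shifted (Suc N) lam 0) \<le> \<bar>kernel N lam mu\<bar> * real (shifted (Suc N) lam 0)"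
        using lam(2) by (intro mult_right_mono) auto
      then have "real (shifted (Suc N) lam 0) \<le> C / x"
        using bound[OF lam(1)] x by (simp add: pos_le_divide_eq mult.commute)
      then have "shifted (Suc N) lam 0 \<le> nat \<lfloor>C / x\<rfloor>" by (simp add: le_nat_floor)
      then show "lam \<in> GT_below (Suc N) (Suc (nat \<lfloor>C / x\<rfloor>))"
        using shifted_le_first[OF lam(1)] lam(1) by (intro GT_below_bounded) (auto intro: order.trans)
    qed
    then show "finite {lam \<in> GT_plus (Suc N). x \<le> \<bar>kernel N lam mu\<bar>}"
      by (rule finite_subset) (rule finite_GT_below)
  qed
qed

section \<open>The N-particle generators with real parameters, their commutation with the kernel,
  and conservativity\<close>

definition rate :: "real \<Rightarrow> real \<Rightarrow> nat \<Rightarrow> nat \<Rightarrow> real" where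
  "rate s q x y = (if y = x + 1 then birth s q x else if x = y + 1 then death s q x
     else if x = y then - birth s q x - death s q x else 0)"

lemma rate_near: "rate s q x y \<noteq> 0 \<Longrightarrow> y \<le> Suc x \<and> x \<le> Suc y"
  by (auto simp: rate_def split: if_splits)

lemma rate_op_eq_sum:
  assumes "Suc x < M"
  shows "rate_op s q f x = (\<Sum>y<M. rate s q x y * f y)"
proof (cases x)
  case 0
  have "(\<Sum>y<M. rate s q x y * f y) = (\<Sum>y\<in>{0, 1}. rate s q x y * f y)"
    using assms rate_near[of s q x] 0 by (intro sum.mono_neutral_right) (auto, fastforce)
  then show ?thesis by (simp add: 0 rate_def rate_op_def death_def algebra_simps)
next
  case (Suc z)
  have "(\<Sum>y<M. rate s q x y * f y) = (\<Sum>y\<in>{z, Suc z, Suc (Suc z)}. rate s q x y * f y)"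
    using assms rate_near[of s q x] Suc by (intro sum.mono_neutral_right) (auto, fastforce)
  then show ?thesis by (simp add: Suc rate_def rate_op_def algebra_simps)
qed

definition gen_const :: "nat \<Rightarrow> real \<Rightarrow> real" where
  "gen_const N s = real N * (real N - 1) * (real N - 2) / 3 - real N * (real N - 1) / 2 * (s + b)"

definition gen_sum :: "nat \<Rightarrow> real \<Rightarrow> real \<Rightarrow> nat list \<Rightarrow> nat list \<Rightarrow> real" where
  "gen_sum N s q lam nu = (\<Sum>k<N. rate s q (shifted N lam k) (shifted N nu k)
      * of_bool (\<forall>i<N. i \<noteq> k \<longrightarrow> shifted N lam i = shifted N nu i))"

definition gen :: "nat \<Rightarrow> real \<Rightarrow> real \<Rightarrow> nat list \<Rightarrow> nat list \<Rightarrow> real" where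
  "gen N s q lam nu =
     vandermonde N (\<lambda>i. hat a b (shifted N nu i)) / vandermonde N (\<lambda>i. hat a b (shifted N lam i))
       * gen_sum N s q lam nu - gen_const N s * of_bool (lam = nu)"

lemma gen_support:
  assumes "lam \<in> GT_plus N" "nu \<in> GT_plus N" "gen N s q lam nu \<noteq> 0" "i < N"
  shows "shifted N nu i \<le> Suc (shifted N lam i)" "shifted N lam i \<le> Suc (shifted N nu i)"
proof -
  have "lam = nu \<or> (\<exists>k<N. rate s q (shifted N lam k) (shifted N nu k) \<noteq> 0 \<and>
      (\<forall>i<N. i \<noteq> k \<longrightarrow> shifted N lam i = shifted N nu i))"
  proof (rule ccontr)
    assume "\<not> ?thesis"
    then have "gen_sum N s q lam nu = 0" "lam \<noteq> nu"
      unfolding gen_sum_def by (auto intro!: sum.neutral)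
    then show False using assms(3) by (simp add: gen_def)
  qed
  then have "shifted N nu i \<le> Suc (shifted N lam i) \<and> shifted N lam i \<le> Suc (shifted N nu i)"
    using rate_near assms(4) by (metis le_Suc_eq order_refl)
  then show "shifted N nu i \<le> Suc (shifted N lam i)" "shifted N lam i \<le> Suc (shifted N nu i)" by auto
qed

lemma gen_row_below:
  assumes "lam \<in> GT_plus N" "nu \<in> GT_plus N" "gen N s q lam nu \<noteq> 0"
    "\<And>i. i < N \<Longrightarrow> Suc (shifted N lam i) < M"
  shows "nu \<in> GT_below N M"
  using gen_support(1)[OF assms(1-3)] assms(2,4) by (fastforce simp: GT_below_def)

lemma gen_col_below:
  assumes "lam \<in> GT_plus N" "nu \<in> GT_plus N" "gen N s q nu lam \<noteq> 0"
    "\<And>i. i < N \<Longrightarrow> Suc (shifted N lam i) < M"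
  shows "nu \<in> GT_below N M"
  using gen_support(2)[OF assms(2,1,3)] assms(2,4) by (fastforce simp: GT_below_def)

lemma alternating_green_det_left: "alternating (Suc N) (\<lambda>l. green_det N l m)"
  using alternating_ndet_rows[of "Suc N" "\<lambda>x j. if j < N then green x (m j) else 1"] by (simp add: green_det_def)

lemma alternating_green_det_right: "alternating N (\<lambda>m. green_det N l m)"
  using alternating_ndet_cols[of N "Suc N" "\<lambda>i x. green (l i) x" "\<lambda>i j. 1"] by (simp add: green_det_def)

text \<open>
  The generator acts on the rows of the determinant; transferred to the columns it is governed by
  the one-particle relation, whose constant term is absorbed by the column of ones.
\<close>

lemma green_det_intertwining:
  assumes "\<And>i. i \<le> N \<Longrightarrow> Suc (l i) < M" "\<And>j. j < N \<Longrightarrow> Suc (m j) < M"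
  shows "(\<Sum>k<Suc N. \<Sum>y<M. rate s q (l k) y * green_det N (l(k := y)) m)
     = (\<Sum>k<N. \<Sum>y<M. rate (s - 2) (q - s + 1) y (m k) * green_det N l (m(k := y)))
       - real N * (s + b) * green_det N l m"
proof -
  define A where "A = (\<lambda>i j. if j < N then green (l i) (m j) else 1)"
  define B where "B = (\<lambda>i j. if j < N then rate_op s q (\<lambda>y. green y (m j)) (l i) else 0)"
  have row: "(\<Sum>y<M. rate s q (l k) y * green_det N (l(k := y)) m) = ndet (Suc N) (\<lambda>i j. if i = k then B i j else A i j)"
    if k: "k < Suc N" for k
  proof -
    have "green_det N (l(k := y)) m = ndet (Suc N) (\<lambda>i j. if i = k then (if j < N then green y (m j) else 1) else A i j)" for y
      unfolding green_det_def A_def by (intro ndet_cong) auto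
    then have "(\<Sum>y<M. rate s q (l k) y * green_det N (l(k := y)) m)
      = ndet (Suc N) (\<lambda>i j. if i = k then \<Sum>y<M. rate s q (l k) y * (if j < N then green y (m j) else 1) else A i j)"
      by (simp only: ndet_row_sum[OF k])
    also have "\<dots> = ndet (Suc N) (\<lambda>i j. if i = k then B i j else A i j)"
    proof (intro ndet_cong if_cong refl)
      fix i j assume "i = k"
      have "(\<Sum>y<M. rate s q (l k) y * (if j < N then green y (m j) else 1))
         = rate_op s q (\<lambda>y. if j < N then green y (m j) else 1) (l k)"
        using assms(1)[of k] k by (subst rate_op_eq_sum[of _ M]) auto
      then show "(\<Sum>y<M. rate s q (l k) y * (if j < N then green y (m j) else 1)) = B i j"
        using \<open>i = k\<close> by (auto simp: B_def rate_op_def)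
    qed
    finally show ?thesis .
  qed
  have col: "ndet (Suc N) (\<lambda>i j. if j = k then B i j else A i j)
     = (\<Sum>y<M. rate (s - 2) (q - s + 1) y (m k) * green_det N l (m(k := y))) - (s + b) * green_det N l m"
    if k: "k < N" for k
  proof -
    \<comment> \<open>For this indicator \<open>green_op f\<close> is the Green column labelled
      \<open>m k\<close>, so the one-particle relation can be read off column by column.\<close>
    define f where "f = (\<lambda>y. of_bool (y = m k) :: real)"
    have fg: "green_op f x = green x (m k)" for x
    proof -
      have "green_op f x = (\<Sum>y<x. if y = m k then green x y else 0)"
        unfolding green_op_def by (intro sum.cong) (auto simp: f_def)
      then show ?thesis by (simp add: green_eq_0 not_less)
    qed
    have rf: "rate_op (s - 2) (q - s + 1) f y = rate (s - 2) (q - s + 1) y (m k)" for y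
    proof -
      have "rate_op (s - 2) (q - s + 1) f y = (\<Sum>z<Suc (Suc (y + m k)). if z = m k then rate (s - 2) (q - s + 1) y z else 0)"
        by (subst rate_op_eq_sum[of _ "Suc (Suc (y + m k))"]) (auto simp: f_def intro!: sum.cong)
      then show ?thesis by (simp del: sum.lessThan_Suc)
    qed
    have B: "B i k = (\<Sum>y<M. rate (s - 2) (q - s + 1) y (m k) * green (l i) y) + - (s + b) * green (l i) (m k) + q * f 0 * 1"
      if "i < Suc N" for i
    proof -
      have "B i k = rate_op s q (green_op f) (l i)" using k by (simp add: B_def fg[abs_def])
      also have "\<dots> = green_op (rate_op (s - 2) (q - s + 1) f) (l i) - (s + b) * green_op f (l i) + q * f 0"
        by (rule rate_op_green_op)
      also have "green_op (rate_op (s - 2) (q - s + 1) f) (l i) = (\<Sum>y<M. rate (s - 2) (q - s + 1) y (m k) * green (l i) y)"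
        using assms(1)[of i] that by (subst green_op_eq[of _ M]) (auto simp: rf mult.commute)
      finally show ?thesis by (simp add: fg algebra_simps)
    qed
    have "ndet (Suc N) (\<lambda>i j. if j = k then B i j else A i j) = ndet (Suc N) (\<lambda>i j. if j = k then
       (\<Sum>y<M. rate (s - 2) (q - s + 1) y (m k) * green (l i) y) + - (s + b) * green (l i) (m k) + q * f 0 * 1 else A i j)"
      by (intro ndet_cong) (simp add: B)
    also have "\<dots> = ndet (Suc N) (\<lambda>i j. if j = k then \<Sum>y<M. rate (s - 2) (q - s + 1) y (m k) * green (l i) y else A i j)
       + - (s + b) * ndet (Suc N) (\<lambda>i j. if j = k then green (l i) (m k) else A i j)
       + q * f 0 * ndet (Suc N) (\<lambda>i j. if j = k then 1 else A i j)"
      using k by (intro ndet_col_add3) simp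
    also have "ndet (Suc N) (\<lambda>i j. if j = k then 1 else A i j) = 0"
      using k by (intro ndet_equal_cols[of k _ N]) (auto simp: A_def)
    also have "ndet (Suc N) (\<lambda>i j. if j = k then green (l i) (m k) else A i j) = green_det N l m"
      unfolding green_det_def using k by (intro ndet_cong) (auto simp: A_def)
    also have "ndet (Suc N) (\<lambda>i j. if j = k then \<Sum>y<M. rate (s - 2) (q - s + 1) y (m k) * green (l i) y else A i j)
       = (\<Sum>y<M. rate (s - 2) (q - s + 1) y (m k) * green_det N l (m(k := y)))"
    proof -
      have "green_det N l (m(k := y)) = ndet (Suc N) (\<lambda>i j. if j = k then green (l i) y else A i j)" for y
        unfolding green_det_def A_def using k by (intro ndet_cong) auto
      then show ?thesis using k by (simp only: ndet_col_sum[of k "Suc N"] less_SucI)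
    qed
    finally show ?thesis by (simp add: algebra_simps)
  qed
  \<comment> \<open>The rates annihilate constants, so replacing the column of ones gives a zero
    column.\<close>
  have last: "ndet (Suc N) (\<lambda>i j. if j = N then B i j else A i j) = 0"
    by (intro ndet_zero_col[of N]) (auto simp: B_def)
  have "(\<Sum>k<Suc N. \<Sum>y<M. rate s q (l k) y * green_det N (l(k := y)) m)
     = (\<Sum>k<Suc N. ndet (Suc N) (\<lambda>i j. if i = k then B i j else A i j))"
    by (intro sum.cong refl row) simp
  also have "\<dots> = (\<Sum>k<Suc N. ndet (Suc N) (\<lambda>i j. if j = k then B i j else A i j))"
    by (rule sum_ndet_replace_row_eq_col)
  also have "\<dots> = (\<Sum>k<N. ndet (Suc N) (\<lambda>i j. if j = k then B i j else A i j))"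
    using last by simp
  also have "\<dots> = (\<Sum>k<N. (\<Sum>y<M. rate (s - 2) (q - s + 1) y (m k) * green_det N l (m(k := y))) - (s + b) * green_det N l m)"
    by (intro sum.cong refl col) simp
  finally show ?thesis by (simp add: sum_subtractf mult.assoc)
qed

text \<open>The Vandermonde ratios telescope to a common factor C, after which
  \<open>green_det_intertwining\<close> applies. What remains is the identity N (s + b) + c_{N+1}(s)
  = c_N(s - 2) between the diagonal constants.\<close>

lemma gen_kernel:
  assumes lam: "lam \<in> GT_plus (Suc N)" and mu: "mu \<in> GT_plus N"
    and M: "\<And>i. i \<le> N \<Longrightarrow> Suc (shifted (Suc N) lam i) < M" "\<And>j. j < N \<Longrightarrow> Suc (shifted N mu j) < M"
  shows "(\<Sum>nu\<in>GT_below (Suc N) M. gen (Suc N) s q lam nu * kernel N nu mu)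
    = (\<Sum>ka\<in>GT_below N M. kernel N lam ka * gen N (s - 2) (q - s + 1) ka mu)"
proof -
  let ?l = "shifted (Suc N) lam" and ?m = "shifted N mu"
  let ?V = "\<lambda>N lam. vandermonde N (\<lambda>i. hat a b (shifted N lam i))"
  let ?s = "s - 2" and ?q = "q - s + 1"
  obtain c where c: "0 < c" "\<And>lam mu. lam \<in> GT_plus (Suc N) \<Longrightarrow> mu \<in> GT_plus N \<Longrightarrow> kernel N lam mu
     = c * (green_det N (shifted (Suc N) lam) (shifted N mu) * (?V N mu / ?V (Suc N) lam))"
    using kernel_eq[of N] by blast
  have V: "?V n ka \<noteq> 0" if "ka \<in> GT_plus n" for n ka
    using vandermonde_hat_pos[OF jacobi_parameters_axioms that] by simp
  have sub: "GT_below n M \<subseteq> GT_plus n" for n by (auto simp: GT_below_def)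
  have lamM: "lam \<in> GT_below (Suc N) M" using lam M(1) by (auto simp: GT_below_def less_Suc_eq_le dest!: Suc_lessD)
  have muM: "mu \<in> GT_below N M" using mu M(2) by (auto simp: GT_below_def dest!: Suc_lessD)
  define C where "C = c * (?V N mu / ?V (Suc N) lam)"
  have "(\<Sum>nu\<in>GT_below (Suc N) M. gen (Suc N) s q lam nu * kernel N nu mu)
     = (\<Sum>nu\<in>GT_below (Suc N) M. C * (gen_sum (Suc N) s q lam nu * green_det N (shifted (Suc N) nu) ?m)
         - C * (gen_const (Suc N) s * (if nu = lam then green_det N ?l ?m else 0)))"
  proof (rule sum.cong[OF refl])
    fix nu assume "nu \<in> GT_below (Suc N) M"
    then have nu: "nu \<in> GT_plus (Suc N)" using sub by auto
    show "gen (Suc N) s q lam nu * kernel N nu mu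
       = C * (gen_sum (Suc N) s q lam nu * green_det N (shifted (Suc N) nu) ?m)
         - C * (gen_const (Suc N) s * (if nu = lam then green_det N ?l ?m else 0))"
      using V[OF nu] V[OF lam] by (auto simp: gen_def c(2)[OF nu mu] C_def field_simps)
  qed
  also have "\<dots> = C * ((\<Sum>nu\<in>GT_below (Suc N) M. gen_sum (Suc N) s q lam nu * green_det N (shifted (Suc N) nu) ?m)
      - gen_const (Suc N) s * green_det N ?l ?m)"
    using lamM finite_GT_below
    by (simp add: sum_subtractf sum_distrib_left[symmetric] right_diff_distrib)
  also have "(\<Sum>nu\<in>GT_below (Suc N) M. gen_sum (Suc N) s q lam nu * green_det N (shifted (Suc N) nu) ?m)
     = (\<Sum>k<Suc N. \<Sum>y<M. rate s q (?l k) y * green_det N (?l(k := y)) ?m)"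
    unfolding gen_sum_def
  proof (rule sum_neighbours[OF alternating_green_det_left lam rate_near finite_GT_below sub])
    fix nu k assume nu: "nu \<in> GT_plus (Suc N)" "k < Suc N" "rate s q (?l k) (shifted (Suc N) nu k) \<noteq> 0"
      "\<And>i. i < Suc N \<Longrightarrow> i \<noteq> k \<Longrightarrow> ?l i = shifted (Suc N) nu i"
    have "shifted (Suc N) nu i < M" if "i < Suc N" for i
      using nu(4)[OF that] M(1)[of i] M(1)[of k] rate_near[OF nu(3)] nu(2) that by (cases "i = k") auto
    then show "nu \<in> GT_below (Suc N) M" using nu(1) by (simp add: GT_below_def)
  qed (use M(1) in auto)
  also have "\<dots> = (\<Sum>k<N. \<Sum>y<M. rate ?s ?q y (?m k) * green_det N ?l (?m(k := y)))
       - real N * (s + b) * green_det N ?l ?m"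
    by (rule green_det_intertwining) (use M in auto)
  also have "(\<Sum>k<N. \<Sum>y<M. rate ?s ?q y (?m k) * green_det N ?l (?m(k := y)))
     = (\<Sum>ka\<in>GT_below N M. gen_sum N ?s ?q ka mu * green_det N ?l (shifted N ka))"
  proof -
    have "(\<Sum>ka\<in>GT_below N M. (\<Sum>k<N. rate ?s ?q (shifted N ka k) (?m k)
        * of_bool (\<forall>i<N. i \<noteq> k \<longrightarrow> ?m i = shifted N ka i)) * green_det N ?l (shifted N ka))
      = (\<Sum>k<N. \<Sum>y<M. rate ?s ?q y (?m k) * green_det N ?l (?m(k := y)))"
    proof (rule sum_neighbours[OF alternating_green_det_right mu _ finite_GT_below sub, where W = "\<lambda>x y. rate ?s ?q y x"])
      show "y \<le> Suc x \<and> x \<le> Suc y" if "rate ?s ?q y x \<noteq> 0" for x y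
        using rate_near[OF that] by simp
    next
      fix nu k assume nu: "nu \<in> GT_plus N" "k < N" "rate ?s ?q (shifted N nu k) (?m k) \<noteq> 0"
        "\<And>i. i < N \<Longrightarrow> i \<noteq> k \<Longrightarrow> ?m i = shifted N nu i"
      have "shifted N nu i < M" if "i < N" for i
        using nu(4)[OF that] M(2)[of i] M(2)[of k] rate_near[OF nu(3)] nu(2) that by (cases "i = k") auto
      then show "nu \<in> GT_below N M" using nu(1) by (simp add: GT_below_def)
    qed (use M(2) in auto)
    then show ?thesis
      by (simp only: gen_sum_def eq_commute[of "?m _"])
  qed
  finally have 1: "(\<Sum>nu\<in>GT_below (Suc N) M. gen (Suc N) s q lam nu * kernel N nu mu)
     = C * ((\<Sum>ka\<in>GT_below N M. gen_sum N ?s ?q ka mu * green_det N ?l (shifted N ka))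
       - real N * (s + b) * green_det N ?l ?m - gen_const (Suc N) s * green_det N ?l ?m)" .
  have "(\<Sum>ka\<in>GT_below N M. kernel N lam ka * gen N ?s ?q ka mu)
     = (\<Sum>ka\<in>GT_below N M. C * (gen_sum N ?s ?q ka mu * green_det N ?l (shifted N ka))
         - C * (gen_const N ?s * (if ka = mu then green_det N ?l ?m else 0)))"
  proof (rule sum.cong[OF refl])
    fix ka assume "ka \<in> GT_below N M"
    then have ka: "ka \<in> GT_plus N" using sub by auto
    show "kernel N lam ka * gen N ?s ?q ka mu
       = C * (gen_sum N ?s ?q ka mu * green_det N ?l (shifted N ka))
         - C * (gen_const N ?s * (if ka = mu then green_det N ?l ?m else 0))"
      using V[OF ka] V[OF lam] by (auto simp: gen_def c(2)[OF lam ka] C_def field_simps)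
  qed
  also have "\<dots> = C * ((\<Sum>ka\<in>GT_below N M. gen_sum N ?s ?q ka mu * green_det N ?l (shifted N ka))
      - gen_const N ?s * green_det N ?l ?m)"
    using muM finite_GT_below
    by (simp add: sum_subtractf sum_distrib_left[symmetric] right_diff_distrib)
  finally have 2: "(\<Sum>ka\<in>GT_below N M. kernel N lam ka * gen N ?s ?q ka mu)
     = C * ((\<Sum>ka\<in>GT_below N M. gen_sum N ?s ?q ka mu * green_det N ?l (shifted N ka))
      - gen_const N ?s * green_det N ?l ?m)" .
  have "real N * (s + b) + gen_const (Suc N) s = gen_const N ?s"
    by (simp add: gen_const_def field_simps)
  then have "real N * (s + b) * green_det N ?l ?m + gen_const (Suc N) s * green_det N ?l ?m = gen_const N ?s * green_det N ?l ?m"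
    by (simp add: distrib_right[symmetric])
  then show ?thesis unfolding 1 2 by (simp add: diff_diff_eq)
qed

text \<open>Induction on N: inserting the row sums 1 of the kernel and commuting moves the generator
  down one level, where its row sums vanish by hypothesis; at N = 0 the generator itself is
  0.\<close>

lemma gen_row_sum:
  assumes "lam \<in> GT_plus N" "\<And>i. i < N \<Longrightarrow> Suc (shifted N lam i) < M"
  shows "(\<Sum>nu\<in>GT_below N M. gen N s q lam nu) = 0"
  using assms
proof (induction N arbitrary: lam s q M)
  case 0
  then show ?case by (simp add: gen_def gen_sum_def gen_const_def)
next
  case (Suc N)
  have sub: "GT_below n M \<subseteq> GT_plus n" for n M by (auto simp: GT_below_def)
  \<comment> \<open>Entries of \<open>mu\<close> run up to M - 1, whereas \<open>gen_kernel\<close>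
    asks for their successors to lie below its cutoff.\<close>
  define M' where "M' = Suc (Suc M)"
  have le: "GT_below n M \<subseteq> GT_below n M'" for n by (auto simp: GT_below_def M'_def)
  have lamM: "Suc (shifted (Suc N) lam i) < M" if "i \<le> N" for i using Suc.prems(2)[of i] that by simp
  have kM: "(\<Sum>mu\<in>GT_below N M. kernel N nu mu) = 1" if nu: "nu \<in> GT_below (Suc N) M" for nu
  proof -
    have "nu \<in> GT_plus (Suc N)" using nu sub by auto
    moreover have "GT_below N (shifted (Suc N) nu 0) \<subseteq> GT_below N M"
      using nu by (force simp: GT_below_def)
    ultimately have "(\<Sum>mu\<in>GT_below N M. kernel N nu mu) = (\<Sum>mu | kernel N nu mu \<noteq> 0. kernel N nu mu)"
      using kernel_support[of nu N] finite_GT_below by (intro sum.mono_neutral_right) auto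
    then show ?thesis using kernel_sum[OF \<open>nu \<in> GT_plus (Suc N)\<close>] by simp
  qed
  have "(\<Sum>nu\<in>GT_below (Suc N) M. gen (Suc N) s q lam nu)
      = (\<Sum>nu\<in>GT_below (Suc N) M. gen (Suc N) s q lam nu * (\<Sum>mu\<in>GT_below N M. kernel N nu mu))"
    by (simp add: kM)
  also have "\<dots> = (\<Sum>mu\<in>GT_below N M. \<Sum>nu\<in>GT_below (Suc N) M. gen (Suc N) s q lam nu * kernel N nu mu)"
    unfolding sum_distrib_left by (rule sum.swap)
  also have "\<dots> = (\<Sum>mu\<in>GT_below N M. \<Sum>nu\<in>GT_below (Suc N) M'. gen (Suc N) s q lam nu * kernel N nu mu)"
  proof (rule sum.cong[OF refl], rule sum.mono_neutral_left[OF finite_GT_below le], rule ballI)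
    fix mu nu assume nu: "nu \<in> GT_below (Suc N) M' - GT_below (Suc N) M"
    then have "nu \<in> GT_plus (Suc N)" "nu \<notin> GT_below (Suc N) M" using sub by auto
    then have "gen (Suc N) s q lam nu = 0" using gen_row_below[OF Suc.prems(1) _ _ Suc.prems(2)] by blast
    then show "gen (Suc N) s q lam nu * kernel N nu mu = 0" by simp
  qed
  also have "\<dots> = (\<Sum>mu\<in>GT_below N M. \<Sum>ka\<in>GT_below N M'. kernel N lam ka * gen N (s - 2) (q - s + 1) ka mu)"
  proof (rule sum.cong[OF refl])
    fix mu assume "mu \<in> GT_below N M"
    then have "Suc (shifted N mu j) < M'" if "j < N" for j
      using that by (auto simp: GT_below_def M'_def)
    moreover have "mu \<in> GT_plus N" using \<open>mu \<in> GT_below N M\<close> sub by auto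
    moreover have "Suc (shifted (Suc N) lam i) < M'" if "i \<le> N" for i
      using lamM[OF that] by (simp add: M'_def)
    ultimately show "(\<Sum>nu\<in>GT_below (Suc N) M'. gen (Suc N) s q lam nu * kernel N nu mu)
        = (\<Sum>ka\<in>GT_below N M'. kernel N lam ka * gen N (s - 2) (q - s + 1) ka mu)"
      using Suc.prems(1) by (intro gen_kernel)
  qed
  also have "\<dots> = (\<Sum>ka\<in>GT_below N M'. kernel N lam ka * (\<Sum>mu\<in>GT_below N M. gen N (s - 2) (q - s + 1) ka mu))"
    unfolding sum_distrib_left by (rule sum.swap)
  also have "\<dots> = 0"
  proof (rule sum.neutral, rule ballI)
    fix ka assume "ka \<in> GT_below N M'"
    show "kernel N lam ka * (\<Sum>mu\<in>GT_below N M. gen N (s - 2) (q - s + 1) ka mu) = 0"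
    proof (cases "kernel N lam ka = 0")
      case False
      then have "ka \<in> GT_below N (shifted (Suc N) lam 0)" by (rule kernel_support[OF Suc.prems(1)])
      then have ka: "ka \<in> GT_plus N" "\<And>i. i < N \<Longrightarrow> Suc (shifted N ka i) < M"
        using lamM[of 0] by (force simp: GT_below_def)+
      show ?thesis using Suc.IH[OF ka] by simp
    qed simp
  qed
  finally show ?case .
qed

section \<open>From the complex rates and arbitrarily scaled Jacobi polynomials to the real objects
  above\<close>

lemma birth_rate_eq:
  assumes "u + u' = of_real s" "u * u' = of_real q"
  shows "birth_rate a b u u' n = of_real (birth s q n)"
proof -
  have "(of_nat n - u) * (of_nat n - u') = (of_nat n)\<^sup>2 - (u + u') * of_nat n + u * u'"
    by (simp add: algebra_simps power2_eq_square)
  also have "\<dots> = of_real ((real n)\<^sup>2 - s * real n + q)"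
    unfolding assms by simp
  finally have P: "(of_nat n - u) * (of_nat n - u') = of_real ((real n)\<^sup>2 - s * real n + q)" .
  show ?thesis
  proof (cases "n = 0 \<and> e = 0")
    case True
    then have "birth_rate a b u u' n = (of_real a + 1) * (u * u')"
      by (simp add: birth_rate_def Let_def mult.assoc)
    then show ?thesis using True assms(2) by (simp add: birth_def beta0_def)
  next
    case False
    then have "birth_rate a b u u' n = (of_nat n + 2 * of_real e) * (of_nat n + of_real a + 1)
        * ((of_nat n - u) * (of_nat n - u')) / (2 * (of_nat n + of_real e) * (2 * of_nat n + 2 * of_real e + 1))"
      by (auto simp: birth_rate_def Let_def mult.assoc)
    then show ?thesis using False unfolding P by (auto simp: birth_def beta0_def)
  qed
qed

lemma death_rate_eq:
  assumes "u + u' = of_real s" "u * u' = of_real q"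
  shows "death_rate a b u u' n = of_real (death s q n)"
proof -
  have "(of_nat n + u + 2 * of_real e) * (of_nat n + u' + 2 * of_real e)
      = (of_nat n + 2 * of_real e)\<^sup>2 + (u + u') * (of_nat n + 2 * of_real e) + u * u'"
    by (simp add: algebra_simps power2_eq_square)
  also have "\<dots> = of_real ((real n + 2 * e)\<^sup>2 + s * (real n + 2 * e) + q)"
    unfolding assms by simp
  finally have P: "(of_nat n + u + 2 * of_real e) * (of_nat n + u' + 2 * of_real e)
      = of_real ((real n + 2 * e)\<^sup>2 + s * (real n + 2 * e) + q)" .
  show ?thesis
  proof (cases "n = 0")
    case False
    then have "death_rate a b u u' n = of_nat n * (of_nat n + of_real b)
        * ((of_nat n + u + 2 * of_real e) * (of_nat n + u' + 2 * of_real e))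
        / (2 * (of_nat n + of_real e) * (2 * of_nat n + 2 * of_real e - 1))"
      by (simp add: death_rate_def Let_def mult.assoc)
    then show ?thesis unfolding P by (simp add: death_def delta0_def)
  qed (simp add: death_rate_def death_def)
qed

lemma R_mat_eq:
  assumes "u + u' = of_real s" "u * u' = of_real q"
  shows "R_mat a b N u u' lam nu = of_real (gen N s q lam nu)"
proof -
  have "R_one a b u u' x y = of_real (rate s q x y)" for x y
    unfolding R_one_def rate_def by (simp add: birth_rate_eq[OF assms] death_rate_eq[OF assms])
  moreover have "c_const b N u u' = of_real (gen_const N s)"
    unfolding c_const_def gen_const_def assms(1) by simp
  ultimately show ?thesis by (simp add: R_mat_def Let_def gen_def gen_sum_def)
qed

lemma feller_q_process_gen:
  assumes "feller_semigroup (GT_plus N) P" "has_q_matrix (GT_plus N) P (R_mat a b N u u')"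
    and "u + u' = of_real s" "u * u' = of_real q"
  shows "feller_q_process (GT_plus N) P (gen N s q)"
proof
  fix lam nu assume *: "lam \<in> GT_plus N" "nu \<in> GT_plus N"
  have "((\<lambda>h. complex_of_real ((P h lam nu - of_bool (lam = nu)) / h)) \<longlongrightarrow> of_real (gen N s q lam nu)) (at_right 0)"
    using assms(2) * R_mat_eq[OF assms(3,4)] by (simp add: has_q_matrix_def)
  then show "((\<lambda>h. (P h lam nu - of_bool (lam = nu)) / h) \<longlongrightarrow> gen N s q lam nu) (at_right 0)"
    by (simp only: tendsto_of_real_iff)
next
  fix lam assume lam: "lam \<in> GT_plus N"
  define M where "M = Suc (Suc (shifted N lam 0))"
  have M: "Suc (shifted N lam i) < M" if "i < N" for i
    using shifted_le_first[OF lam that] by (simp add: M_def)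
  have sub: "{nu \<in> GT_plus N. gen N s q lam nu \<noteq> 0} \<subseteq> GT_below N M"
    using gen_row_below[OF lam _ _ M] by auto
  then show "finite {nu \<in> GT_plus N. gen N s q lam nu \<noteq> 0}"
    by (rule finite_subset) (rule finite_GT_below)
  have "(\<Sum>nu | nu \<in> GT_plus N \<and> gen N s q lam nu \<noteq> 0. gen N s q lam nu) = (\<Sum>nu\<in>GT_below N M. gen N s q lam nu)"
    using sub finite_GT_below by (intro sum.mono_neutral_left) (auto simp: GT_below_def)
  then show "(\<Sum>nu | nu \<in> GT_plus N \<and> gen N s q lam nu \<noteq> 0. gen N s q lam nu) = 0"
    using gen_row_sum[OF lam M] by simp
qed (rule assms(1))

lemma Lambda_kernel_eq:
  assumes "jacobi_polynomials a b p" "lam \<in> GT_plus (Suc N)"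
  shows "Lambda_kernel p N lam = kernel N lam"
proof -
  obtain c where "\<And>k. c k \<noteq> 0" "\<And>k. p k = Polynomial.smult (c k) (jac k)"
    using jacobi_polynomials_eq[OF assms(1)] by metis
  then have "Jacobi_norm p n = Jacobi_norm jac n" for n by (rule Jacobi_norm_rescale)
  then have "Lambda_kernel p N lam = Lambda_kernel jac N lam" unfolding Lambda_kernel_def by simp
  then show ?thesis using Lambda_kernel_jac[OF assms(2)] by simp
qed

lemma semigroup_intertwining:
  assumes N: "1 \<le> N"
    and P: "feller_semigroup (GT_plus (Suc N)) P" "has_q_matrix (GT_plus (Suc N)) P (R_mat a b (Suc N) u u')"
    and P': "feller_semigroup (GT_plus N) P'" "has_q_matrix (GT_plus N) P' (R_mat a b N (u - 1) (u' - 1))"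
    and u: "u + u' = of_real s" "u * u' = of_real q"
    and t: "0 \<le> t" and lam: "lam \<in> GT_plus (Suc N)" and mu: "mu \<in> GT_plus N"
  shows "matrix_prod (GT_plus (Suc N)) (P t) (kernel N) lam mu = matrix_prod (GT_plus N) (kernel N) (P' t) lam mu"
proof (rule intertwining[where Q = "gen (Suc N) s q" and Q' = "gen N (s - 2) (q - s + 1)"])
  show "feller_q_process (GT_plus (Suc N)) P (gen (Suc N) s q)"
    using P u by (rule feller_q_process_gen)
  have "(u - 1) + (u' - 1) = of_real (s - 2)" using u by (simp add: algebra_simps)
  moreover have "(u - 1) * (u' - 1) = u * u' - (u + u') + 1" by (simp add: algebra_simps)
  then have "(u - 1) * (u' - 1) = of_real (q - s + 1)" using u by simp
  ultimately show "feller_q_process (GT_plus N) P' (gen N (s - 2) (q - s + 1))"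
    using P' by (intro feller_q_process_gen)
next
  fix x assume x: "x \<in> GT_plus (Suc N)"
  have eq: "{y \<in> GT_plus N. kernel N x y \<noteq> 0} = {y. kernel N x y \<noteq> 0}"
    by (auto simp: kernel_def)
  show "finite {y \<in> GT_plus N. kernel N x y \<noteq> 0}" unfolding eq by (rule kernel_finite[OF x])
  show "(\<Sum>y | y \<in> GT_plus N \<and> kernel N x y \<noteq> 0. kernel N x y) = 1"
    unfolding eq by (rule kernel_sum[OF x])
  fix y assume y: "y \<in> GT_plus N"
  define M where "M = Suc (Suc (shifted (Suc N) x 0 + shifted N y 0))"
  have M: "Suc (shifted (Suc N) x i) < M" if "i < Suc N" for i
    using shifted_le_first[OF x that] by (simp add: M_def)
  have M': "Suc (shifted N y i) < M" if "i < N" for i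
    using shifted_le_first[OF y that] by (simp add: M_def)
  have "(\<Sum>z | z \<in> GT_plus (Suc N) \<and> gen (Suc N) s q x z \<noteq> 0. gen (Suc N) s q x z * kernel N z y)
      = (\<Sum>z\<in>GT_below (Suc N) M. gen (Suc N) s q x z * kernel N z y)"
    using gen_row_below[OF x _ _ M] finite_GT_below
    by (intro sum.mono_neutral_left) (auto simp: GT_below_def)
  also have "\<dots> = (\<Sum>z\<in>GT_below N M. kernel N x z * gen N (s - 2) (q - s + 1) z y)"
    using x y M M' by (intro gen_kernel) auto
  also have "\<dots> = (\<Sum>z | z \<in> GT_plus N \<and> kernel N x z \<noteq> 0. kernel N x z * gen N (s - 2) (q - s + 1) z y)"
  proof (rule sum.mono_neutral_cong)
    show "finite {z. z \<in> GT_plus N \<and> kernel N x z \<noteq> 0}" unfolding eq by (rule kernel_finite[OF x])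
    fix z assume z: "z \<in> {z. z \<in> GT_plus N \<and> kernel N x z \<noteq> 0} - GT_below N M"
    then have "gen N (s - 2) (q - s + 1) z y = 0" using gen_col_below[OF y _ _ M', of z] by auto
    then show "kernel N x z * gen N (s - 2) (q - s + 1) z y = 0" by simp
  qed (auto simp: GT_below_def intro: finite_GT_below[unfolded GT_below_def])
  finally show "(\<Sum>z | z \<in> GT_plus (Suc N) \<and> gen (Suc N) s q x z \<noteq> 0. gen (Suc N) s q x z * kernel N z y)
      = (\<Sum>z | z \<in> GT_plus N \<and> kernel N x z \<noteq> 0. kernel N x z * gen N (s - 2) (q - s + 1) z y)" .
qed (use kernel_nonneg kernel_C0[OF N] t lam mu in auto)

end

theorem theorem5p1:
  fixes a b :: real and z z' :: complex
    and p :: "nat \<Rightarrow> real poly"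
    and P :: "nat \<Rightarrow> real \<Rightarrow> nat list \<Rightarrow> nat list \<Rightarrow> real"
  assumes "a \<ge> b" and "b \<ge> - 1 / 2"
    and "\<forall>k::int. (z - of_int k) * (z' - of_int k) > 0"
    and "\<forall>k::nat. k \<ge> 1 \<longrightarrow>
           (z + of_nat k + 2 * complex_of_real (eps a b))
           * (z' + of_nat k + 2 * complex_of_real (eps a b)) > 0"
    and "z + z' > - (1 + complex_of_real b)"
    and "jacobi_polynomials a b p"
    and "\<forall>N\<ge>1. feller_semigroup (GT_plus N) (P N) \<and>
           has_q_matrix (GT_plus N) (P N)
             (R_mat a b N (z + of_nat N - 1) (z' + of_nat N - 1))"
  shows "\<forall>N\<ge>2. \<forall>t\<ge>0. \<forall>lam\<in>GT_plus (N + 1). \<forall>mu\<in>GT_plus N.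
           matrix_prod (GT_plus (N + 1)) (P (N + 1) t) (Lambda_kernel p N) lam mu
           = matrix_prod (GT_plus N) (Lambda_kernel p N) (P N t) lam mu"
proof (intro allI impI ballI)
  interpret jacobi_parameters a b using assms(1,2) by unfold_locales
  fix N :: nat and t :: real and lam mu
  assume N: "2 \<le> N" and t: "0 \<le> t" and lam: "lam \<in> GT_plus (N + 1)" and mu: "mu \<in> GT_plus N"
  \<comment> \<open>Level N + 1 has the parameter z + (N + 1) - 1 = z + N, and level N has one
    less.\<close>
  define u u' where "u = z + of_nat N" and "u' = z' + of_nat N"
  \<comment> \<open>Comparable complex numbers have equal imaginary parts, so the hypotheses make z
    + z' and, taking k = 0, also z z' real; these are s and q up to the shift by N.\<close>
  have "Im (z + z') = 0" using assms(5) by (auto simp: less_complex_def)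
  then have "z + z' = of_real (Re (z + z'))" by (simp add: complex_eq_iff)
  then obtain s0 where sum: "z + z' = of_real s0" by blast
  have "0 < z * z'" using assms(3)[rule_format, of 0] by simp
  then have "Im (z * z') = 0" by (simp only: less_complex_def) simp
  then have "z * z' = of_real (Re (z * z'))" by (simp add: complex_eq_iff)
  then obtain q0 where prod: "z * z' = of_real q0" by blast
  have "u + u' = (z + z') + 2 * of_nat N" by (simp add: u_def u'_def)
  then have s: "u + u' = of_real (s0 + 2 * real N)" unfolding sum by simp
  have "u * u' = z * z' + (z + z') * of_nat N + of_nat N * of_nat N" by (simp add: u_def u'_def algebra_simps)
  then have q: "u * u' = of_real (q0 + s0 * real N + real N * real N)"
    unfolding sum prod by simp
  have P: "feller_semigroup (GT_plus (Suc N)) (P (Suc N))" "has_q_matrix (GT_plus (Suc N)) (P (Suc N)) (R_mat a b (Suc N) u u')"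
    using assms(7)[rule_format, of "Suc N"] by (simp_all add: u_def u'_def)
  have P': "feller_semigroup (GT_plus N) (P N)" "has_q_matrix (GT_plus N) (P N) (R_mat a b N (u - 1) (u' - 1))"
    using assms(7)[rule_format, of N] N by (simp_all add: u_def u'_def)
  have eq: "Lambda_kernel p N ka = kernel N ka" if "ka \<in> GT_plus (Suc N)" for ka
    using that by (rule Lambda_kernel_eq[OF assms(6)])
  have "matrix_prod (GT_plus (Suc N)) (P (Suc N) t) (Lambda_kernel p N) lam mu
      = matrix_prod (GT_plus (Suc N)) (P (Suc N) t) (kernel N) lam mu"
    unfolding matrix_prod_def by (intro infsum_cong) (simp add: eq)
  also have "\<dots> = matrix_prod (GT_plus N) (kernel N) (P N t) lam mu"
    using N lam mu t by (intro semigroup_intertwining[OF _ P P' s q]) auto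
  also have "\<dots> = matrix_prod (GT_plus N) (Lambda_kernel p N) (P N t) lam mu"
    using lam by (simp add: matrix_prod_def eq)
  finally show "matrix_prod (GT_plus (N + 1)) (P (N + 1) t) (Lambda_kernel p N) lam mu
      = matrix_prod (GT_plus N) (Lambda_kernel p N) (P N t) lam mu"
    by simp
qed

end
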